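(* The global asymptotic-stability decision problem for rational constrained finite-horizon linear MPC (given an MPC instance, decide whether the origin of its closed loop is asymptotically stable relative to its feasible set $\mathcal X_N$) is undecidable: no algorithm terminates on every instance and correctly decides whether the resulting closed loop is globally asymptotically stable. This remains true even when the horizon is fixed to $N=1$ and the weights $Q$, $P$, $R$ are identity matrices of the appropriate dimensions, already for each of the following subclasses of instances: (a) the only inequality constraint is a box constraint on the one-step predicted (terminal) state $x_{1|k}$, and there are no input constraints; (b) the only inequality constraint is a box constraint on the input $u_{0|k}$, and there are no state or terminal constraints; (c) the only inequality constraints are a quadratically softened input box, i.e. $\ell - s_k\le u_{0|k}\le h+s_k$, $s_k\ge 0$ (componentwise), with unbounded slack vector $s_k$, with no hard bounds on the physical state or input, and with a quadratic slack penalty $\rho\|s_k\|^2$ added to the objective, where $\rho>0$ is a fixed rational number not depending on the instance. Moreover, in each of (a), (b), (c), undecidability holds already for the instances of that subclass whose quadratic program is strictly convex, has a unique optimizer, and is feasible for every current state $x_k$.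
   Context: An instance of rational constrained finite-horizon linear MPC consists of a linear plant $x_{k+1}=Fx_k+Gu_k$ with rational matrices $F\in\mathbb{Q}^{n_x\times n_x}$, $G\in\mathbb{Q}^{n_x\times n_u}$, a horizon $N\ge 1$, rational symmetric weights $Q\succeq 0$, $R\succ 0$, $P\succeq 0$, and sets $\mathcal Z\subseteq\mathbb{R}^{n_x+n_u}$, $\mathcal X_f\subseteq\mathbb{R}^{n_x}$ defined by finitely many rational linear inequalities and containing $(0,0)$ and $0$, respectively (selected state, input or terminal constraints may be absent). The dimensions $n_x,n_u$ are part of the instance and may vary. At state $x_k$ the controller solves $$\min_{\mathbf x,\mathbf u}\ \sum_{i=0}^{N-1}\bigl(x_{i|k}^{\mathsf T}Qx_{i|k}+u_{i|k}^{\mathsf T}Ru_{i|k}\bigr)+x_{N|k}^{\mathsf T}Px_{N|k}$$ subject to $x_{0|k}=x_k$, $x_{i+1|k}=Fx_{i|k}+Gu_{i|k}$ and $(x_{i|k},u_{i|k})\in\mathcal Z$ for $i=0,\dots,N-1$, and $x_{N|k}\in\mathcal X_f$. Softened instances are also allowed: nonnegative slack variables $s$ are added to the right-hand sides of selected inequalities (through a rational slack-incidence matrix), become additional decision variables, and are penalized by an additional positive-definite rational quadratic term in the objective; the slack incidence and penalty are part of the finite encoding of the instance. The optimizer is unique, and the receding-horizon law is $\kappa_N(x_k)=u_{0|k}^\star(x_k)$. The closed loop is $x_{k+1}=Fx_k+G\kappa_N(x_k)$. The feasible set $\mathcal X_N$ is the set of $x_k$ for which the optimization problem is feasible. The origin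 is asymptotically stable relative to $\mathcal X_N$ if every closed-loop trajectory initialized in $\mathcal X_N$ remains in $\mathcal X_N$ and converges to the origin, and the origin is Lyapunov stable relative to $\mathcal X_N$ (for every $\varepsilon>0$ there is $\delta>0$ such that $x_0\in\mathcal X_N$, $\|x_0\|<\delta$ imply $\|x_k\|<\varepsilon$ for all $k\ge 0$). When $\mathcal X_N=\mathbb{R}^{n_x}$ this is ordinary global asymptotic stability. A box is a product of compact intervals with rational endpoints; $\|\cdot\|$ is the Euclidean norm. Undecidability for a class of instances means that there is no algorithm which, on every instance in the class (encoded by its rational data in binary), terminates and answers correctly. *)

theory Defs
  imports
    Complex_Main
    "HOL-Library.Nat_Bijection"
    "Jordan_Normal_Form.Matrix"
begin

section \<open>Algorithms\<close>

text \<open>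
  Partial recursive functions on lists of natural numbers.
  In \<open>Prim f g\<close> the recursion argument comes first and \<open>g\<close> receives the predecessor, the
  previous value and the parameters, in this order; \<open>Mu f\<close> minimizes over the first argument
  of \<open>f\<close>, all smaller values having to be defined and nonzero.
\<close>

datatype recf = Zero | Succ | Proj nat | Comp recf "recf list" | Prim recf recf | Mu recf

inductive rec_eval :: "recf \<Rightarrow> nat list \<Rightarrow> nat \<Rightarrow> bool" where
  "rec_eval Zero xs 0"
| "rec_eval Succ [n] (Suc n)"
| "i < length xs \<Longrightarrow> rec_eval (Proj i) xs (xs ! i)"
| "list_all2 (\<lambda>g y. rec_eval g xs y) gs ys \<Longrightarrow> rec_eval f ys z \<Longrightarrow> rec_eval (Comp f gs) xs z"
| "rec_eval f xs z \<Longrightarrow> rec_eval (Prim f g) (0 # xs) z"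
| "rec_eval (Prim f g) (n # xs) y \<Longrightarrow> rec_eval g (n # y # xs) z \<Longrightarrow>
     rec_eval (Prim f g) (Suc n # xs) z"
| "(\<And>m. m < n \<Longrightarrow> \<exists>y. rec_eval f (m # xs) (Suc y)) \<Longrightarrow> rec_eval f (n # xs) 0 \<Longrightarrow>
     rec_eval (Mu f) xs n"

lemma rec_eval_deterministic: "rec_eval f xs y \<Longrightarrow> rec_eval f xs z \<Longrightarrow> y = z"
proof (induction f xs y arbitrary: z rule: rec_eval.induct)
  case (4 xs gs ys f w)
  from "4.prems" obtain ys' where ys': "list_all2 (\<lambda>g y. rec_eval g xs y) gs ys'" "rec_eval f ys' z"
    by cases auto
  have "ys = ys'"
  proof (rule nth_equalityI)
    show "length ys = length ys'" using "4.IH"(1) ys'(1) by (simp add: list_all2_lengthD[symmetric])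
    show "ys ! i = ys' ! i" if "i < length ys" for i
      using list_all2_nthD2[OF "4.IH"(1) that] list_all2_nthD[OF ys'(1), of i] that
        list_all2_lengthD[OF "4.IH"(1)] by simp
  qed
  then show ?case using "4.IH" ys'(2) by blast
next
  case (5 f xs w g)
  from "5.prems" show ?case by cases (simp_all add: "5.IH")
next
  case (6 f g n xs y w)
  from "6.prems" obtain y' where "rec_eval (Prim f g) (n # xs) y'" "rec_eval g (n # y' # xs) z"
    by cases auto
  then show ?case using "6.IH" by blast
next
  case (7 n f xs)
  from "7.prems" have z: "\<And>m. m < z \<Longrightarrow> \<exists>y. rec_eval f (m # xs) (Suc y)" "rec_eval f (z # xs) 0"
    by (cases; simp)+
  have "\<not> z < n" using "7.IH"(1) z(2) by fastforce
  moreover have "\<not> n < z" using "7.IH"(2) z(1) by fastforce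
  ultimately show ?case by simp
qed (erule rec_eval.cases; simp)+

text \<open>
  The algorithm only has to terminate and be correct on inputs from the class \<open>C\<close>; its
  behaviour on other inputs is unconstrained.
\<close>

definition decidable_on :: "('a \<Rightarrow> nat) \<Rightarrow> 'a set \<Rightarrow> ('a \<Rightarrow> bool) \<Rightarrow> bool" where
  "decidable_on code C P \<longleftrightarrow> (\<exists>f. \<forall>a\<in>C. rec_eval f [code a] (if P a then 1 else 0))"

abbreviation undecidable_on :: "('a \<Rightarrow> nat) \<Rightarrow> 'a set \<Rightarrow> ('a \<Rightarrow> bool) \<Rightarrow> bool" where
  "undecidable_on code C P \<equiv> \<not> decidable_on code C P"


section \<open>Model predictive control instances\<close>

abbreviation rmat :: "rat mat \<Rightarrow> real mat" where "rmat \<equiv> map_mat of_rat"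
abbreviation rvec :: "rat vec \<Rightarrow> real vec" where "rvec \<equiv> map_vec of_rat"

definition pos_semidef :: "nat \<Rightarrow> rat mat \<Rightarrow> bool" where
  "pos_semidef n A \<longleftrightarrow> A \<in> carrier_mat n n \<and> transpose_mat A = A \<and>
     (\<forall>v\<in>carrier_vec n. v \<bullet> (rmat A *\<^sub>v v) \<ge> 0)"

definition pos_def :: "nat \<Rightarrow> rat mat \<Rightarrow> bool" where
  "pos_def n A \<longleftrightarrow> A \<in> carrier_mat n n \<and> transpose_mat A = A \<and>
     (\<forall>v\<in>carrier_vec n. v \<noteq> 0\<^sub>v n \<longrightarrow> v \<bullet> (rmat A *\<^sub>v v) > 0)"

text \<open>
  The stage set is \<open>{(x, u). stage_Hx x + stage_Hu u \<le> stage_h}\<close> and the terminal set is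
  \<open>{x. term_H x \<le> term_h}\<close>; a system with no rows means that the constraint is absent.
  All inequalities of the optimization problem are numbered consecutively, first those of
  stages \<open>0, \<dots>, horizon - 1\<close>, then the terminal ones, and row \<open>r\<close> of the incidence matrix
  \<open>slack_E\<close> says how the slack vector enters the right-hand side of inequality \<open>r\<close>.
  The problem has only hard constraints if \<open>slack_dim = 0\<close>.
\<close>

record mpc =
  state_dim :: nat
  input_dim :: nat
  slack_dim :: nat
  horizon :: nat
  plant_F :: "rat mat"
  plant_G :: "rat mat"
  weight_Q :: "rat mat"
  weight_R :: "rat mat"
  weight_P :: "rat mat"
  stage_Hx :: "rat mat"
  stage_Hu :: "rat mat"
  stage_h :: "rat vec"
  term_H :: "rat mat"
  term_h :: "rat vec"
  slack_E :: "rat mat"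
  slack_W :: "rat mat"

abbreviation stage_rows :: "mpc \<Rightarrow> nat" where "stage_rows I \<equiv> dim_vec (stage_h I)"
abbreviation term_rows :: "mpc \<Rightarrow> nat" where "term_rows I \<equiv> dim_vec (term_h I)"

text \<open>Nonnegativity of the right-hand sides says that both sets contain the origin.\<close>

definition mpc_instance :: "mpc \<Rightarrow> bool" where
  "mpc_instance I \<longleftrightarrow>
     state_dim I \<ge> 1 \<and> input_dim I \<ge> 1 \<and> horizon I \<ge> 1 \<and>
     plant_F I \<in> carrier_mat (state_dim I) (state_dim I) \<and>
     plant_G I \<in> carrier_mat (state_dim I) (input_dim I) \<and>
     pos_semidef (state_dim I) (weight_Q I) \<and>
     pos_def (input_dim I) (weight_R I) \<and>
     pos_semidef (state_dim I) (weight_P I) \<and>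
     stage_Hx I \<in> carrier_mat (stage_rows I) (state_dim I) \<and>
     stage_Hu I \<in> carrier_mat (stage_rows I) (input_dim I) \<and>
     term_H I \<in> carrier_mat (term_rows I) (state_dim I) \<and>
     0\<^sub>v (stage_rows I) \<le> stage_h I \<and> 0\<^sub>v (term_rows I) \<le> term_h I \<and>
     slack_E I \<in> carrier_mat (horizon I * stage_rows I + term_rows I) (slack_dim I) \<and>
     pos_def (slack_dim I) (slack_W I)"

definition rat_code :: "rat \<Rightarrow> nat" where
  "rat_code q = prod_encode (map_prod int_encode nat (quotient_of q))"

definition vec_code :: "rat vec \<Rightarrow> nat" where
  "vec_code v = list_encode (map rat_code (list_of_vec v))"

definition mat_code :: "rat mat \<Rightarrow> nat" where
  "mat_code A = list_encode (map (list_encode \<circ> map rat_code) (mat_to_list A))"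

text \<open>
  The code of an instance is a natural number. Its binary numeral and the string listing all
  entries in binary are computable from each other, so decidability does not depend on which
  of the two is given to the algorithm.
\<close>

definition mpc_code :: "mpc \<Rightarrow> nat" where
  "mpc_code I = list_encode
     [state_dim I, input_dim I, slack_dim I, horizon I,
      mat_code (plant_F I), mat_code (plant_G I),
      mat_code (weight_Q I), mat_code (weight_R I), mat_code (weight_P I),
      mat_code (stage_Hx I), mat_code (stage_Hu I), vec_code (stage_h I),
      mat_code (term_H I), vec_code (term_h I),
      mat_code (slack_E I), mat_code (slack_W I)]"

lemma rat_code_inject: "rat_code p = rat_code q \<Longrightarrow> p = q"
  using quotient_of_denom_pos'[of p] quotient_of_denom_pos'[of q]
  by (cases "quotient_of p"; cases "quotient_of q")
    (auto simp: rat_code_def int_encode_eq eq_nat_nat_iff intro!: quotient_of_inject)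

lemma vec_code_inject:
  assumes "vec_code v = vec_code w"
  shows "v = w"
proof -
  have "list_of_vec v = list_of_vec w"
    using assms unfolding vec_code_def list_encode_eq
    by (rule map_injective) (rule injI, erule rat_code_inject)
  then have "vec_of_list (list_of_vec v) = vec_of_list (list_of_vec w)" by simp
  then show ?thesis by (simp only: vec_list)
qed

lemma mat_code_inject:
  assumes "mat_code A = mat_code B" "dim_row A = dim_row B" "dim_col A = dim_col B"
  shows "A = B"
proof -
  have "inj (list_encode \<circ> map rat_code)"
    by (intro inj_compose inj_list_encode inj_mapI injI rat_code_inject)
  then have eq: "mat_to_list A = mat_to_list B"
    using assms(1) unfolding mat_code_def list_encode_eq by (rule map_injective[rotated])
  show ?thesis
  proof (rule eq_matI)
    fix i j assume ij: "i < dim_row B" "j < dim_col B"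
    have "mat_to_list A ! i ! j = mat_to_list B ! i ! j" by (simp add: eq)
    then show "A $$ (i, j) = B $$ (i, j)"
      using ij assms(2,3) by (simp add: mat_to_list_def)
  qed (use assms(2,3) in auto)
qed

lemma inj_on_mpc_code: "inj_on mpc_code {I. mpc_instance I}"
proof (rule inj_onI, clarsimp)
  fix I J assume IJ: "mpc_instance I" "mpc_instance J" "mpc_code I = mpc_code J"
  have dims: "state_dim I = state_dim J" "input_dim I = input_dim J"
      "slack_dim I = slack_dim J" "horizon I = horizon J"
      "stage_h I = stage_h J" "term_h I = term_h J"
    using IJ(3) by (auto simp: mpc_code_def list_encode_eq intro: vec_code_inject)
  have codes: "mat_code (plant_F I) = mat_code (plant_F J)"
      "mat_code (plant_G I) = mat_code (plant_G J)"
      "mat_code (weight_Q I) = mat_code (weight_Q J)"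
      "mat_code (weight_R I) = mat_code (weight_R J)"
      "mat_code (weight_P I) = mat_code (weight_P J)"
      "mat_code (stage_Hx I) = mat_code (stage_Hx J)"
      "mat_code (stage_Hu I) = mat_code (stage_Hu J)"
      "mat_code (term_H I) = mat_code (term_H J)"
      "mat_code (slack_E I) = mat_code (slack_E J)"
      "mat_code (slack_W I) = mat_code (slack_W J)"
    using IJ(3) unfolding mpc_code_def list_encode_eq by simp_all
  have "plant_F K \<in> carrier_mat (state_dim K) (state_dim K)"
      "plant_G K \<in> carrier_mat (state_dim K) (input_dim K)"
      "weight_Q K \<in> carrier_mat (state_dim K) (state_dim K)"
      "weight_R K \<in> carrier_mat (input_dim K) (input_dim K)"
      "weight_P K \<in> carrier_mat (state_dim K) (state_dim K)"
      "stage_Hx K \<in> carrier_mat (stage_rows K) (state_dim K)"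
      "stage_Hu K \<in> carrier_mat (stage_rows K) (input_dim K)"
      "term_H K \<in> carrier_mat (term_rows K) (state_dim K)"
      "slack_E K \<in> carrier_mat (horizon K * stage_rows K + term_rows K) (slack_dim K)"
      "slack_W K \<in> carrier_mat (slack_dim K) (slack_dim K)" if "mpc_instance K" for K
    using that unfolding mpc_instance_def pos_def_def pos_semidef_def by blast+
  note sizes = this[THEN carrier_matD(1)] this[THEN carrier_matD(2)]
  show "I = J"
    by (intro mpc.equality dims codes[THEN mat_code_inject])
      (simp_all add: sizes[OF IJ(1)] sizes[OF IJ(2)] dims)
qed


section \<open>The optimization problem\<close>

text \<open>Decision variables: predicted states, inputs and slacks.\<close>

type_synonym decision = "real vec list \<times> real vec list \<times> real vec"

definition decision_space :: "mpc \<Rightarrow> decision set" where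
  "decision_space I = {(xs, us, s).
     length xs = horizon I + 1 \<and> set xs \<subseteq> carrier_vec (state_dim I) \<and>
     length us = horizon I \<and> set us \<subseteq> carrier_vec (input_dim I) \<and>
     s \<in> carrier_vec (slack_dim I)}"

fun mpc_cost :: "mpc \<Rightarrow> decision \<Rightarrow> real" where
  "mpc_cost I (xs, us, s) =
     (\<Sum>i<horizon I. xs ! i \<bullet> (rmat (weight_Q I) *\<^sub>v (xs ! i)) +
                     us ! i \<bullet> (rmat (weight_R I) *\<^sub>v (us ! i))) +
     xs ! horizon I \<bullet> (rmat (weight_P I) *\<^sub>v (xs ! horizon I)) +
     s \<bullet> (rmat (slack_W I) *\<^sub>v s)"

fun mpc_constraints :: "mpc \<Rightarrow> real vec \<Rightarrow> decision \<Rightarrow> bool" where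
  "mpc_constraints I x (xs, us, s) \<longleftrightarrow>
     xs ! 0 = x \<and>
     (\<forall>i<horizon I. xs ! (i + 1) = rmat (plant_F I) *\<^sub>v (xs ! i) + rmat (plant_G I) *\<^sub>v (us ! i)) \<and>
     (\<forall>i<horizon I. \<forall>j<stage_rows I.
        (rmat (stage_Hx I) *\<^sub>v (xs ! i) + rmat (stage_Hu I) *\<^sub>v (us ! i)) $ j
          \<le> rvec (stage_h I) $ j + (rmat (slack_E I) *\<^sub>v s) $ (i * stage_rows I + j)) \<and>
     (\<forall>j<term_rows I.
        (rmat (term_H I) *\<^sub>v (xs ! horizon I)) $ j
          \<le> rvec (term_h I) $ j + (rmat (slack_E I) *\<^sub>v s) $ (horizon I * stage_rows I + j)) \<and>
     0\<^sub>v (slack_dim I) \<le> s"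

definition mpc_feasible :: "mpc \<Rightarrow> real vec \<Rightarrow> decision \<Rightarrow> bool" where
  "mpc_feasible I x z \<longleftrightarrow> z \<in> decision_space I \<and> mpc_constraints I x z"

definition mpc_optimizer :: "mpc \<Rightarrow> real vec \<Rightarrow> decision \<Rightarrow> bool" where
  "mpc_optimizer I x z \<longleftrightarrow> is_arg_min (mpc_cost I) (mpc_feasible I x) z"

definition feasible_set :: "mpc \<Rightarrow> real vec set" where
  "feasible_set I = {x \<in> carrier_vec (state_dim I). \<exists>z. mpc_feasible I x z}"

definition mpc_law :: "mpc \<Rightarrow> real vec \<Rightarrow> real vec" where
  "mpc_law I x = (case THE z. mpc_optimizer I x z of (xs, us, s) \<Rightarrow> us ! 0)"

definition closed_loop :: "mpc \<Rightarrow> real vec \<Rightarrow> real vec" where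
  "closed_loop I x = rmat (plant_F I) *\<^sub>v x + rmat (plant_G I) *\<^sub>v mpc_law I x"

definition vnorm :: "real vec \<Rightarrow> real" where
  "vnorm v = sqrt (v \<bullet> v)"

text \<open>
  A trajectory that leaves the feasible set violates the first conjunct at the first exit,
  so the values of \<open>mpc_law\<close> at infeasible states are irrelevant.
\<close>

definition asymptotically_stable :: "mpc \<Rightarrow> bool" where
  "asymptotically_stable I \<longleftrightarrow>
     (\<forall>x\<in>feasible_set I.
        (\<forall>k. (closed_loop I ^^ k) x \<in> feasible_set I) \<and>
        (\<lambda>k. vnorm ((closed_loop I ^^ k) x)) \<longlonglongrightarrow> 0) \<and>
     (\<forall>\<epsilon>>0. \<exists>\<delta>>0. \<forall>x\<in>feasible_set I. vnorm x < \<delta> \<longrightarrow>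
        (\<forall>k. vnorm ((closed_loop I ^^ k) x) < \<epsilon>))"


section \<open>Subclasses of instances\<close>

definition unit_weights :: "mpc \<Rightarrow> bool" where
  "unit_weights I \<longleftrightarrow>
     weight_Q I = 1\<^sub>m (state_dim I) \<and> weight_P I = 1\<^sub>m (state_dim I) \<and>
     weight_R I = 1\<^sub>m (input_dim I)"

text \<open>The system \<open>A v \<le> b\<close> is \<open>v \<le> h\<close>, \<open>- v \<le> - l\<close>.\<close>

definition box_system :: "nat \<Rightarrow> rat mat \<Rightarrow> rat vec \<Rightarrow> bool" where
  "box_system n A b \<longleftrightarrow> (\<exists>l\<in>carrier_vec n. \<exists>h\<in>carrier_vec n. l \<le> h \<and>
     A = 1\<^sub>m n @\<^sub>r (- 1\<^sub>m n) \<and> b = h @\<^sub>v (- l))"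

definition terminal_box_class :: "mpc set" where
  "terminal_box_class = {I. mpc_instance I \<and> horizon I = 1 \<and> unit_weights I \<and>
     slack_dim I = 0 \<and> stage_rows I = 0 \<and>
     box_system (state_dim I) (term_H I) (term_h I)}"

definition input_box_class :: "mpc set" where
  "input_box_class = {I. mpc_instance I \<and> horizon I = 1 \<and> unit_weights I \<and>
     slack_dim I = 0 \<and> term_rows I = 0 \<and>
     stage_Hx I = 0\<^sub>m (stage_rows I) (state_dim I) \<and>
     box_system (input_dim I) (stage_Hu I) (stage_h I)}"

text \<open>The same slack \<open>s $ i\<close> relaxes the upper and the lower bound on input \<open>i\<close>.\<close>

definition soft_input_box_class :: "rat \<Rightarrow> mpc set" where
  "soft_input_box_class \<rho> = {I. mpc_instance I \<and> horizon I = 1 \<and> unit_weights I \<and>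
     slack_dim I = input_dim I \<and> term_rows I = 0 \<and>
     stage_Hx I = 0\<^sub>m (stage_rows I) (state_dim I) \<and>
     box_system (input_dim I) (stage_Hu I) (stage_h I) \<and>
     slack_E I = 1\<^sub>m (input_dim I) @\<^sub>r 1\<^sub>m (input_dim I) \<and>
     slack_W I = \<rho> \<cdot>\<^sub>m 1\<^sub>m (input_dim I)}"

fun decision_comb :: "real \<Rightarrow> decision \<Rightarrow> decision \<Rightarrow> decision" where
  "decision_comb t (xs, us, s) (xs', us', s') =
     (map2 (\<lambda>v w. (1 - t) \<cdot>\<^sub>v v + t \<cdot>\<^sub>v w) xs xs',
      map2 (\<lambda>v w. (1 - t) \<cdot>\<^sub>v v + t \<cdot>\<^sub>v w) us us',
      (1 - t) \<cdot>\<^sub>v s + t \<cdot>\<^sub>v s')"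

text \<open>
  Strict convexity in all decision variables jointly, not only after elimination of the
  predicted states or on the feasible set. The constraints are affine.
\<close>

definition strictly_convex_qp :: "mpc \<Rightarrow> bool" where
  "strictly_convex_qp I \<longleftrightarrow>
     (\<forall>z\<in>decision_space I. \<forall>z'\<in>decision_space I. \<forall>t. z \<noteq> z' \<and> 0 < t \<and> t < 1 \<longrightarrow>
        mpc_cost I (decision_comb t z z') < (1 - t) * mpc_cost I z + t * mpc_cost I z')"

definition regular_instances :: "mpc set" where
  "regular_instances = {I. strictly_convex_qp I \<and>
     (\<forall>x\<in>carrier_vec (state_dim I). \<exists>!z. mpc_optimizer I x z) \<and>
     feasible_set I = carrier_vec (state_dim I)}"

end

theory Submission
  imports Defs
begin

text \<open>
  The one-step problem projects a linear function of the state onto a box, so its closed loop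
  iterates \<open>v \<mapsto> clip h (A v)\<close>, where \<open>clip h\<close> truncates each coordinate to \<open>[0, h]\<close>. Networks of such
  units simulate finite systems of guarded affine rules on the unit cube. The simulation multiplies
  everything by an activity that is sent to \<open>0\<close> in finitely many steps unless it is exactly \<open>1\<close>; hence
  the origin is asymptotically stable iff the rule system is not immortal, that is, has no infinite
  orbit from any state whatsoever.

  The quantification over all states, not only the intended initial one, is handled as in Hooper's
  proof that immortality of Turing machines is undecidable. Counters are stacks stored in real
  numbers, and a run of the program interrupts itself before every step by a recursive call that
  restarts the program with as many steps of fuel as the caller has performed, and then undoes
  itself. If the program halts then every orbit eventually makes a call with so much fuel that the
  restarted program gets stuck; if it diverges then the nested runs form an infinite orbit.

  The input \<open>m\<close> of the program enters the instance only through a single bound \<open>1 / 2 ^ m\<close>. The code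
  of the instance is therefore an elementary function of \<open>m\<close> and of a number \<open>K\<close> that encodes all its
  other entries. From a decision procedure one obtains a program which on input \<open>m\<close> halts iff the
  procedure declares the instance with \<open>K = m\<close> unstable; for its own \<open>K\<close> this is a contradiction.
\<close>

section \<open>Networks of saturated units\<close>

text \<open>The iteration \<open>v \<mapsto> clip h (A v)\<close> has no constant input, and the
  origin is always an equilibrium. Constants can only be multiples of the activity \<open>c\<close>,
  which a hostile initial state sets to any value. In one rule step \<open>c\<close> is bounded by
  \<open>3 * min 1 c - 2 * min 1 (2 * c)\<close>, cut off at \<open>0\<close>: \<open>1\<close> is a
  repelling fixed point, the defect \<open>1 - c\<close> triples, and values below
  \<open>1/2\<close> vanish at once. Hence exact computations survive, inexact ones die, and small
  states die within a fixed number of steps, which gives Lyapunov stability. A hostile initial state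
  can also contain infinite stacks, as if in the middle of a fabricated recursion with unlimited
  fuel. What remains under control is the fuel of a fresh call, because it is the step count of its
  caller; if the program halts, surviving a call bounds that count. An ordinary reduction would need
  the map from programs to instance codes to be recursive. With a single entry depending on the
  input, the matrices of the instance are mere constants inside the number \<open>K\<close>, and
  only \<open>template\<close> has to be recursive.\<close>

definition clip :: "real \<Rightarrow> real \<Rightarrow> real" where "clip h x = max 0 (min h x)"

text \<open>Each register after a machine step depends on at most one old register, so a single
  \<open>source\<close> per target is enough; \<open>param\<close> multiplies the only number that
  depends on the input of the program.\<close>

record rule =
  lower :: "nat \<Rightarrow> rat"
  upper :: "nat \<Rightarrow> rat"
  coeff :: "nat \<Rightarrow> rat"
  source :: "nat \<Rightarrow> nat"
  const :: "nat \<Rightarrow> rat"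
  param :: "nat \<Rightarrow> rat"

definition rule_step :: "nat \<Rightarrow> rule list \<Rightarrow> real \<Rightarrow> (nat \<Rightarrow> real) \<Rightarrow> (nat \<Rightarrow> real) \<Rightarrow> bool" where
  "rule_step d rules e x y \<longleftrightarrow> (\<exists>i<length rules.
     (\<forall>r<d. of_rat (lower (rules ! i) r) \<le> x r \<and> x r \<le> of_rat (upper (rules ! i) r)) \<and>
     (\<forall>r<d. y r = clip 1 (of_rat (coeff (rules ! i) r) * x (source (rules ! i) r) +
        of_rat (const (rules ! i) r) + of_rat (param (rules ! i) r) * e)))"

definition rules_immortal :: "nat \<Rightarrow> rule list \<Rightarrow> real \<Rightarrow> bool" where
  "rules_immortal d rules e \<longleftrightarrow> (\<exists>x. \<forall>k::nat. rule_step d rules e (x k) (x (Suc k)))"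

datatype node = Par nat | Alive | Alive' | Gain | Gain' | High nat nat | Low nat nat
  | Gap nat | Val nat | Sel nat | Act nat | Out nat nat

definition lin :: "(rat \<times> 'a) list \<Rightarrow> ('a \<Rightarrow> real) \<Rightarrow> real" where
  "lin ts v = (\<Sum>(a, k)\<leftarrow>ts. of_rat a * v k)"

lemma lin_simps [simp]:
  "lin [] v = 0" "lin ((a, k) # ts) v = of_rat a * v k + lin ts v" "lin (ts @ us) v = lin ts v + lin us v"
  by (simp_all add: lin_def)

lemma lin_map: "lin (map (\<lambda>i. (a, f i)) [0..<n]) v = of_rat a * (\<Sum>i<n. v (f i))"
  by (induction n) (simp_all add: algebra_simps)

lemma lin_bound:
  assumes "\<And>a k. (a, k) \<in> set ts \<Longrightarrow> \<bar>v k\<bar> \<le> B"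
  shows "\<bar>lin ts v\<bar> \<le> (\<Sum>(a, k)\<leftarrow>ts. \<bar>of_rat a\<bar>) * B"
  using assms
proof (induction ts)
  case (Cons t ts)
  obtain a k where t: "t = (a, k)" by fastforce
  have "\<bar>of_rat a * v k + lin ts v\<bar> \<le> \<bar>of_rat a\<bar> * \<bar>v k\<bar> + \<bar>lin ts v\<bar>"
    by (metis abs_mult abs_triangle_ineq)
  also have "\<dots> \<le> \<bar>of_rat a\<bar> * B + (\<Sum>(a, k)\<leftarrow>ts. \<bar>of_rat a\<bar>) * B"
    using Cons t by (intro add_mono mult_left_mono) auto
  finally show ?case by (simp add: t algebra_simps)
qed simp

text \<open>\<open>M\<close> dominates every update on the unit cube, so subtracting it silences the
  rules that are not selected.\<close>

lemma affine_le:
  fixes a b p :: real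
  assumes "\<bar>a\<bar> + \<bar>b\<bar> + \<bar>p\<bar> \<le> M" "0 \<le> x" "x \<le> 1" "0 \<le> e" "e \<le> 1"
  shows "a * x + b + p * e - M \<le> 0"
proof -
  have "a * x \<le> \<bar>a\<bar> * 1" "p * e \<le> \<bar>p\<bar> * 1" using assms by (intro mult_mono; auto)+
  then show ?thesis using assms by linarith
qed

lemma clip_nonpos: "x \<le> 0 \<Longrightarrow> clip h x = 0"
  by (simp add: clip_def)

lemma clip_bounds [simp]: "0 \<le> clip h x" "h \<ge> 0 \<Longrightarrow> clip h x \<le> h"
  by (auto simp: clip_def)

text \<open>The \<open>2\<close> in \<open>separated\<close>: a rule survives only if its guard,
  scaled by the activity \<open>c\<close>, is violated by less than \<open>c / K\<close>. Two
  surviving rules would then have scaled guards less than \<open>2 * c / K\<close> apart.\<close>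

locale network =
  fixes d :: nat and rules :: "rule list" and K M :: rat
  assumes bounds: "\<And>i r. i < length rules \<Longrightarrow> r < d \<Longrightarrow>
      0 \<le> lower (rules ! i) r \<and> upper (rules ! i) r \<le> 1 \<and> source (rules ! i) r < d"
    and separated: "\<And>i j. i < length rules \<Longrightarrow> j < length rules \<Longrightarrow> i \<noteq> j \<Longrightarrow>
      \<exists>r<d. K * (lower (rules ! j) r - upper (rules ! i) r) \<ge> 2 \<or> K * (lower (rules ! i) r - upper (rules ! j) r) \<ge> 2"
    and K: "K > 0"
    and M: "\<And>i r. i < length rules \<Longrightarrow> r < d \<Longrightarrow>
      \<bar>coeff (rules ! i) r\<bar> + \<bar>const (rules ! i) r\<bar> + \<bar>param (rules ! i) r\<bar> \<le> M"
begin

abbreviation n :: nat where "n \<equiv> length rules"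

abbreviation acts :: "rat \<Rightarrow> (rat \<times> node) list" where
  "acts a \<equiv> map (\<lambda>i. (a, Act i)) [0..<n]"
abbreviation outs :: "rat \<Rightarrow> nat \<Rightarrow> (rat \<times> node) list" where
  "outs a r \<equiv> map (\<lambda>i. (a, Out i r)) [0..<n]"

text \<open>
  The activity is the sum of all \<open>Act i\<close>, and the value of register \<open>r\<close> is the sum of all \<open>Out i r\<close>; one
  rule step takes three network steps. \<open>High\<close> and \<open>Low\<close> detect violations of the guard of rule \<open>i\<close>,
  amplified by \<open>K\<close>, so that \<open>Sel i\<close> survives only if the guard holds. The multiples of \<open>M\<close> in \<open>Out i r\<close>
  cancel if rule \<open>i\<close> is selected and suppress its output otherwise. \<open>Par 0\<close>, the only unit with
  bound \<open>e\<close>, feeds the parameter into the network.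
\<close>

fun terms :: "node \<Rightarrow> (rat \<times> node) list" where
  "terms (Par p) = (if p = 0 then [(1, Alive')] else [(1, Par (p - 1))])"
| "terms Alive = acts 1"
| "terms Alive' = [(1, Alive)]"
| "terms Gain = acts 2"
| "terms Gain' = [(1, Gain)]"
| "terms (High i r) = outs K r @ acts (- K * upper (rules ! i) r)"
| "terms (Low i r) = outs (- K) r @ acts (K * lower (rules ! i) r)"
| "terms (Gap r) = acts 1 @ outs (- 1) r"
| "terms (Val r) = [(1, Alive), (- 1, Gap r)]"
| "terms (Sel i) = (1, Alive) # map (\<lambda>r. (- 1, High i r)) [0..<d] @ map (\<lambda>r. (- 1, Low i r)) [0..<d]"
| "terms (Act i) = [(3, Sel i), (- 2, Gain')]"
| "terms (Out i r) = [(coeff (rules ! i) r, Val (source (rules ! i) r)),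
     (const (rules ! i) r - M, Alive'), (param (rules ! i) r, Par 2), (M, Sel i)]"

definition nodes :: "node list" where
  "nodes = [Par 0, Par 1, Par 2, Alive, Alive', Gain, Gain'] @
     map (\<lambda>(i, r). High i r) (List.product [0..<n] [0..<d]) @
     map (\<lambda>(i, r). Low i r) (List.product [0..<n] [0..<d]) @
     map Gap [0..<d] @ map Val [0..<d] @ map Sel [0..<n] @ map Act [0..<n] @
     map (\<lambda>(i, r). Out i r) (List.product [0..<n] [0..<d])"

lemma distinct_nodes: "distinct nodes"
  by (auto simp: nodes_def distinct_map distinct_product inj_on_def)

lemma in_nodes [simp]:
  "Par p \<in> set nodes \<longleftrightarrow> p < 3" "Alive \<in> set nodes" "Alive' \<in> set nodes" "Gain \<in> set nodes" "Gain' \<in> set nodes"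
  "High i r \<in> set nodes \<longleftrightarrow> i < n \<and> r < d" "Low i r \<in> set nodes \<longleftrightarrow> i < n \<and> r < d"
  "Gap r \<in> set nodes \<longleftrightarrow> r < d" "Val r \<in> set nodes \<longleftrightarrow> r < d"
  "Sel i \<in> set nodes \<longleftrightarrow> i < n" "Act i \<in> set nodes \<longleftrightarrow> i < n" "Out i r \<in> set nodes \<longleftrightarrow> i < n \<and> r < d"
  by (auto simp: nodes_def image_iff numeral_3_eq_3 less_Suc_eq)

lemma terms_in_nodes: "k \<in> set nodes \<Longrightarrow> (a, l) \<in> set (terms k) \<Longrightarrow> l \<in> set nodes"
  using bounds by (cases k) (auto split: if_splits)

fun limit :: "real \<Rightarrow> node \<Rightarrow> real" where
  "limit e (Par p) = (if p = 0 then e else 1)"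
| "limit e _ = 1"

end

section \<open>Activity and registers along a trajectory\<close>

locale trajectory = network +
  fixes e :: real and v :: "nat \<Rightarrow> node \<Rightarrow> real"
  assumes e: "0 < e" "e \<le> 1"
    and step: "\<And>t k. k \<in> set nodes \<Longrightarrow> v (Suc t) k = clip (limit e k) (lin (terms k) (v t))"
begin

definition c :: "nat \<Rightarrow> real" where "c t = (\<Sum>i<n. v t (Act i))"
definition x :: "nat \<Rightarrow> nat \<Rightarrow> real" where "x t r = (\<Sum>i<n. v t (Out i r))"

lemma v_nonneg: "t > 0 \<Longrightarrow> k \<in> set nodes \<Longrightarrow> 0 \<le> v t k"
  by (cases t) (auto simp: step)

lemma c_nonneg: "t > 0 \<Longrightarrow> 0 \<le> c t" and x_nonneg: "t > 0 \<Longrightarrow> r < d \<Longrightarrow> 0 \<le> x t r"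
  by (auto simp: c_def x_def intro!: sum_nonneg v_nonneg)

lemma lin_acts: "lin (acts a) (v t) = of_rat a * c t" and lin_outs: "lin (outs a r) (v t) = of_rat a * x t r"
  by (simp_all add: lin_map c_def x_def)

lemma Alive: "v (Suc t) Alive = clip 1 (c t)"
  and Gain: "v (Suc t) Gain = clip 1 (2 * c t)"
  by (simp_all add: step lin_acts)

lemma Alive': "v (Suc (Suc t)) Alive' = clip 1 (c t)"
  and Gain': "v (Suc (Suc t)) Gain' = clip 1 (2 * c t)"
  by (simp_all add: step Alive Gain) (simp_all add: clip_def)

text \<open>Two delays let the parameter meet \<open>Val\<close> and \<open>Sel\<close> when
  \<open>Out\<close> is computed. \<open>Par 0\<close> is itself fed by the activity of three steps
  before, so it equals \<open>e\<close> only if the preceding rule step was alive too.\<close>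

lemma Par: "v (Suc (Suc (Suc t))) (Par 0) = clip e (clip 1 (c t))"
  "v (Suc (Suc t)) (Par 2) = clip 1 (v t (Par 0))"
  by (simp_all add: step Alive') (simp_all add: clip_def)

lemma High: "i < n \<Longrightarrow> r < d \<Longrightarrow> v (Suc t) (High i r) = clip 1 (of_rat K * (x t r - of_rat (upper (rules ! i) r) * c t))"
  and Low: "i < n \<Longrightarrow> r < d \<Longrightarrow> v (Suc t) (Low i r) = clip 1 (of_rat K * (of_rat (lower (rules ! i) r) * c t - x t r))"
  by (simp_all add: step lin_acts lin_outs of_rat_mult of_rat_minus algebra_simps)

text \<open>For \<open>0 \<le> c t \<le> 1\<close> and \<open>0 \<le> x t r\<close> the two
  complements produce the minimum of \<open>x t r\<close> and \<open>c t\<close>: the register is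
  delayed by two steps to meet \<open>Sel\<close>, and it vanishes together with the
  activity.\<close>

lemma Val: "r < d \<Longrightarrow> v (Suc (Suc t)) (Val r) = clip 1 (clip 1 (c t) - clip 1 (c t - x t r))"
  by (simp add: step Alive lin_acts lin_outs of_rat_minus)

lemma Sel: "i < n \<Longrightarrow> v (Suc t) (Sel i) =
    clip 1 (v t Alive - (\<Sum>r<d. v t (High i r)) - (\<Sum>r<d. v t (Low i r)))"
  by (simp add: step lin_map of_rat_minus algebra_simps)

lemma Act: "i < n \<Longrightarrow> v (Suc (Suc (Suc t))) (Act i) = clip 1 (3 * v (Suc (Suc t)) (Sel i) - 2 * clip 1 (2 * c t))"
  by (simp add: step[of "Act i"] Gain' of_rat_minus)

lemma Out: "i < n \<Longrightarrow> r < d \<Longrightarrow> v (Suc t) (Out i r) = clip 1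
    (of_rat (coeff (rules ! i) r) * v t (Val (source (rules ! i) r)) + of_rat (const (rules ! i) r) * v t Alive'
      + of_rat (param (rules ! i) r) * v t (Par 2) - of_rat M * (v t Alive' - v t (Sel i)))"
  by (simp add: step of_rat_diff algebra_simps)

lemma Sel_le: "i < n \<Longrightarrow> v (Suc (Suc t)) (Sel i) \<le> clip 1 (c t)"
proof -
  assume i: "i < n"
  have "0 \<le> (\<Sum>r<d. v (Suc t) (High i r))" "0 \<le> (\<Sum>r<d. v (Suc t) (Low i r))"
    using i by (auto intro!: sum_nonneg v_nonneg)
  then show ?thesis using i by (simp add: Sel Alive) (simp add: clip_def)
qed

text \<open>Every detected violation is subtracted from \<open>Alive\<close>, so a surviving
  selector bounds each of them strictly by the activity; clipping is monotone and can be removed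
  from the comparison.\<close>

lemma Sel_pos:
  assumes "i < n" "r < d" "v (Suc (Suc t)) (Sel i) > 0" "t > 0"
  shows "of_rat K * (x t r - of_rat (upper (rules ! i) r) * c t) < c t"
    and "of_rat K * (of_rat (lower (rules ! i) r) * c t - x t r) < c t"
    and "c t > 0"
proof -
  have nonneg: "0 \<le> v (Suc t) (High i r)" "0 \<le> v (Suc t) (Low i r)" if "r < d" for r
    using that assms by (auto intro!: v_nonneg)
  have "v (Suc t) (High i r) \<le> (\<Sum>r<d. v (Suc t) (High i r))"
       "v (Suc t) (Low i r) \<le> (\<Sum>r<d. v (Suc t) (Low i r))"
    using nonneg assms by (auto intro!: member_le_sum)
  moreover have "0 \<le> (\<Sum>r<d. v (Suc t) (High i r))" "0 \<le> (\<Sum>r<d. v (Suc t) (Low i r))"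
    using nonneg by (auto intro!: sum_nonneg)
  moreover have "v (Suc t) Alive - (\<Sum>r<d. v (Suc t) (High i r)) - (\<Sum>r<d. v (Suc t) (Low i r)) > 0"
    using assms(3) Sel[OF assms(1), of "Suc t"] by (simp add: clip_def split: if_splits)
  ultimately have "v (Suc t) (High i r) < clip 1 (c t)" "v (Suc t) (Low i r) < clip 1 (c t)" "clip 1 (c t) > 0"
    by (auto simp: Alive)
  then show "of_rat K * (x t r - of_rat (upper (rules ! i) r) * c t) < c t"
    and "of_rat K * (of_rat (lower (rules ! i) r) * c t - x t r) < c t" "c t > 0"
    using assms by (auto simp: High Low) (auto simp: clip_def split: if_splits)
qed

lemma Sel_unique:
  assumes "i < n" "j < n" "i \<noteq> j" "t > 0" "v (Suc (Suc t)) (Sel i) > 0" "v (Suc (Suc t)) (Sel j) > 0"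
  shows False
proof -
  obtain r where r: "r < d" "K * (lower (rules ! j) r - upper (rules ! i) r) \<ge> 2 \<or> K * (lower (rules ! i) r - upper (rules ! j) r) \<ge> 2"
    using separated[of i j] assms by blast
  have gap: False if "i < n" "j < n" "v (Suc (Suc t)) (Sel i) > 0" "v (Suc (Suc t)) (Sel j) > 0"
    "K * (lower (rules ! j) r - upper (rules ! i) r) \<ge> 2" for i j
  proof -
    have "(of_rat (K * (lower (rules ! j) r - upper (rules ! i) r)) :: real) \<ge> of_rat 2"
      using that(5) unfolding of_rat_less_eq .
    then have "of_rat K * (of_rat (lower (rules ! j) r) - of_rat (upper (rules ! i) r) :: real) \<ge> 2"
      by (simp add: of_rat_mult of_rat_diff)
    then have "of_rat K * (of_rat (lower (rules ! j) r) - of_rat (upper (rules ! i) r)) * c t \<ge> 2 * c t"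
      using c_nonneg assms by (intro mult_right_mono) auto
    moreover have "of_rat K * (of_rat (lower (rules ! j) r) - of_rat (upper (rules ! i) r)) * c t < 2 * c t"
      using Sel_pos(1)[of i r t] Sel_pos(2)[of j r t] that r assms by (simp add: algebra_simps)
    ultimately show False by simp
  qed
  from r assms show False using gap[of i j] gap[of j i] by blast
qed

lemma Act_pos: "i < n \<Longrightarrow> t > 0 \<Longrightarrow> v (Suc (Suc (Suc t))) (Act i) > 0 \<Longrightarrow> v (Suc (Suc t)) (Sel i) > 0"
  using c_nonneg[of t] by (auto simp: Act) (auto simp: clip_def split: if_splits)

text \<open>At most one selector survives, so the activity comes from a single rule and cannot
  accumulate over several.\<close>

lemma c_cases:
  assumes "t > 0"
  obtains "c (Suc (Suc (Suc t))) = 0"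
    | i where "i < n" "c (Suc (Suc (Suc t))) = v (Suc (Suc (Suc t))) (Act i)" "v (Suc (Suc (Suc t))) (Act i) > 0"
        "\<And>j. j < n \<Longrightarrow> j \<noteq> i \<Longrightarrow> v (Suc (Suc t)) (Sel j) = 0"
proof (cases "\<exists>i<n. v (Suc (Suc (Suc t))) (Act i) > 0")
  case True
  then obtain i where i: "i < n" "v (Suc (Suc (Suc t))) (Act i) > 0" by blast
  have sel: "v (Suc (Suc t)) (Sel j) = 0" if "j < n" "j \<noteq> i" for j
    using Sel_unique[of i j t] Act_pos[of i t] that i assms v_nonneg[of "Suc (Suc t)" "Sel j"] by fastforce
  then have "v (Suc (Suc (Suc t))) (Act j) = 0" if "j < n" "j \<noteq> i" for j
    using Act_pos[of j t] assms v_nonneg[of "Suc (Suc (Suc t))" "Act j"] that by fastforce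
  then have "c (Suc (Suc (Suc t))) = v (Suc (Suc (Suc t))) (Act i)"
    unfolding c_def using i sum.remove[of "{..<n}" i "\<lambda>i. v (Suc (Suc (Suc t))) (Act i)"] by simp
  then show ?thesis using i sel that by blast
next
  case False
  then have "v (Suc (Suc (Suc t))) (Act i) = 0" if "i < n" for i
    using v_nonneg[of "Suc (Suc (Suc t))" "Act i"] that by fastforce
  then show ?thesis using that by (simp add: c_def)
qed

lemma c_decrease:
  assumes "t > 0"
  shows "c (Suc (Suc (Suc t))) \<le> max 0 (3 * clip 1 (c t) - 2 * clip 1 (2 * c t))"
  using assms
proof (cases rule: c_cases)
  case (2 i)
  then show ?thesis using Sel_le[of i t] c_nonneg[OF assms]
    by (simp add: Act) (auto simp: clip_def max_def min_def split: if_splits)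
qed simp

lemma c_le_1: "t > 3 \<Longrightarrow> c t \<le> 1"
  using c_decrease[of "t - 3"] c_nonneg[of "t - 3"]
  by (simp add: clip_def eval_nat_numeral Suc_diff_Suc split: if_splits)

lemma c_half: "t > 0 \<Longrightarrow> c t < 1/2 \<Longrightarrow> c (t + 3) = 0"
  using c_decrease[of t] c_nonneg[of t] c_nonneg[of "t + 3"]
  by (simp add: clip_def eval_nat_numeral split: if_splits)

lemma c_zero: "t > 0 \<Longrightarrow> c t = 0 \<Longrightarrow> c (t + 3 * k) = 0"
proof (induction k)
  case (Suc k)
  then show ?case using c_half[of "t + 3 * k"] by (simp add: algebra_simps)
qed simp

text \<open>While \<open>c < 1\<close> the defect \<open>1 - c\<close> at least triples in each rule
  step, hence exceeds \<open>1\<close> after finitely many.\<close>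

lemma c_dies:
  assumes "t > 0" "c t < 1"
  shows "\<exists>k. c (t + 3 * k) = 0"
proof -
  have "c (t + 3 * k) \<le> max 0 (1 - 3 ^ k * (1 - c t))" for k
  proof (induction k)
    case (Suc k)
    have c: "c (t + 3 * k) < 1"
    proof -
      have "0 < 3 ^ k * (1 - c t)" using assms by simp
      with Suc show ?thesis by simp
    qed
    have "c (t + 3 * Suc k) \<le> max 0 (3 * c (t + 3 * k) - 2)"
      using c_decrease[of "t + 3 * k"] c_nonneg[of "t + 3 * k"] c assms
      by (simp add: clip_def eval_nat_numeral split: if_splits)
    with Suc c show ?case by (simp add: max_def algebra_simps split: if_splits)
  qed (use assms c_nonneg[of t] in auto)
  moreover obtain k where "(3::real) ^ k > 1 / (1 - c t)"
    using real_arch_pow[of 3] by auto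
  then have "1 - 3 ^ k * (1 - c t) < 0" using assms by (simp add: divide_simps split: if_splits)
  ultimately show ?thesis using c_nonneg assms by (intro exI[of _ k]) (smt (verit) add_pos_nonneg zero_le)
qed

text \<open>\<open>Sel\<close> and \<open>Val\<close> are bounded by the activity, which cuts the
  cycles through \<open>Out\<close>. The longest remaining chain runs through the delayed parameter,
  \<open>Out\<close> and the detectors, and is flushed within 8 steps.\<close>

lemma all_zero:
  assumes "\<And>t. t \<ge> T \<Longrightarrow> c t = 0" "t \<ge> T + 8" "k \<in> set nodes"
  shows "v t k = 0"
proof -
  have c: "c s = 0" if "s > T" for s using that assms(1) by auto
  have s0: "clip h 0 = 0" for h by (simp add: clip_def)
  have al: "v s Alive = 0" "v s Gain = 0" if s: "s \<ge> T + 1" for s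
    using assms(1)[of "s - 1"] s Alive[of "s - 1"] Gain[of "s - 1"] by (simp_all add: s0)
  have al': "v s Alive' = 0" "v s Gain' = 0" if s: "s \<ge> T + 2" for s
    using assms(1)[of "s - 2"] s Alive'[of "s - 2"] Gain'[of "s - 2"] by (simp_all add: s0 eval_nat_numeral Suc_diff_Suc)
  have p0: "v s (Par 0) = 0" if s: "s \<ge> T + 3" for s
    using al'[of "s - 1"] s step[of "Par 0" "s - 1"] by (simp add: s0)
  have p1: "v s (Par 1) = 0" if s: "s \<ge> T + 4" for s
    using p0[of "s - 1"] s step[of "Par 1" "s - 1"] by (simp add: s0)
  have p2: "v s (Par 2) = 0" if s: "s \<ge> T + 5" for s
    using p1[of "s - 1"] s step[of "Par 2" "s - 1"] by (simp add: s0)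
  have sel: "v s (Sel i) = 0" if s: "s \<ge> T + 3" "i < n" for s i
    using assms(1)[of "s - 2"] s Sel_le[of i "s - 2"] v_nonneg[of s "Sel i"] by (simp add: s0 eval_nat_numeral Suc_diff_Suc)
  have val: "v s (Val r) = 0" if s: "s \<ge> T + 3" "r < d" for s r
    using assms(1)[of "s - 2"] s Val[of r "s - 2"] x_nonneg[of "s - 2" r] by (simp add: s0 eval_nat_numeral Suc_diff_Suc clip_def)
  have act: "v s (Act i) = 0" if s: "s \<ge> T + 4" "i < n" for s i
    using al'[of "s - 1"] sel[of "s - 1" i] s step[of "Act i" "s - 1"] by (simp add: s0)
  have out: "v s (Out i r) = 0" if s: "s \<ge> T + 6" "i < n" "r < d" for s i r
    using al'[of "s - 1"] sel[of "s - 1" i] val[of "s - 1" "source (rules ! i) r"] p2[of "s - 1"] s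
      step[of "Out i r" "s - 1"] bounds[of i r] by (simp add: s0)
  have x: "x s r = 0" if s: "s \<ge> T + 6" "r < d" for s r
    using out[of s] s by (simp add: x_def)
  have "v s (High i r) = 0" "v s (Low i r) = 0" if s: "s \<ge> T + 7" "i < n" "r < d" for s i r
    using x[of "s - 1" r] c[of "s - 1"] High[of i r "s - 1"] Low[of i r "s - 1"] s by (simp_all add: s0)
  moreover have "v s (Gap r) = 0" if s: "s \<ge> T + 7" "r < d" for s r
    using x[of "s - 1" r] c[of "s - 1"] s step[of "Gap r" "s - 1"] by (simp add: s0 lin_acts lin_outs)
  moreover have "v t (Par p) = 0" if "p < 3" for p
    using that p0 p1 p2 assms(2) by (simp add: numeral_3_eq_3 less_Suc_eq) (auto simp: numeral_2_eq_2)
  ultimately show ?thesis using assms(2,3) al al' sel val act out by (cases k) auto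
qed

text \<open>If the total activity never drops below 1 then it is exactly 1 and a single rule is active.\<close>

lemma alive_rule_step:
  assumes t: "t > 0" and alive: "c t \<ge> 1" "c (t + 3) \<ge> 1" "c (t + 6) \<ge> 1"
  shows "rule_step d rules e (x (t + 3)) (x (t + 6))"
proof -
  define s where "s = t + 3"
  have s: "s > 3" "c s = 1" using t alive c_le_1[of s] by (auto simp: s_def)
  then have s0: "s > 0" by simp
  have s3: "t + 6 = Suc (Suc (Suc s))" by (simp add: s_def)
  have c3: "c (Suc (Suc (Suc s))) \<ge> 1" using alive by (simp add: s3)
  obtain i where i: "i < n" "v (Suc (Suc (Suc s))) (Act i) \<ge> 1"
    and sel0: "\<And>j. j < n \<Longrightarrow> j \<noteq> i \<Longrightarrow> v (Suc (Suc s)) (Sel j) = 0"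
    using s0 c3 by (cases rule: c_cases) auto
  have sel: "v (Suc (Suc s)) (Sel i) = 1"
    using i s Sel_le[OF i(1), of s] by (simp add: Act) (simp add: clip_def)
  have alive': "v (Suc (Suc s)) Alive' = 1" using s by (simp add: Alive' clip_def)
  \<comment> \<open>At time \<open>s\<close> the unit \<open>Par 0\<close> holds \<open>e\<close>
    because the activity was at least \<open>1\<close> already at \<open>t = s - 3\<close>.\<close>
  have par: "v (Suc (Suc s)) (Par 2) = e"
    using alive e Par(1)[of t] by (simp add: Par(2)) (simp add: s_def clip_def eval_nat_numeral)
  have nonneg: "0 \<le> v (Suc s) (High i r)" "0 \<le> v (Suc s) (Low i r)" if "r < d" for r
    using that i by (auto intro!: v_nonneg)
  have "(\<Sum>r<d. v (Suc s) (High i r)) + (\<Sum>r<d. v (Suc s) (Low i r)) \<le> 0"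
    using sel Sel[OF i(1), of "Suc s"] s by (simp add: Alive) (simp add: clip_def split: if_splits)
  moreover have "0 \<le> (\<Sum>r<d. v (Suc s) (High i r))" "0 \<le> (\<Sum>r<d. v (Suc s) (Low i r))"
    using nonneg by (auto intro!: sum_nonneg)
  ultimately have z: "(\<Sum>r<d. v (Suc s) (High i r)) = 0" "(\<Sum>r<d. v (Suc s) (Low i r)) = 0" by linarith+
  have zero: "v (Suc s) (High i r) = 0" "v (Suc s) (Low i r) = 0" if "r < d" for r
  proof -
    have "v (Suc s) (High i r) \<le> (\<Sum>r<d. v (Suc s) (High i r))"
         "v (Suc s) (Low i r) \<le> (\<Sum>r<d. v (Suc s) (Low i r))"
      using nonneg that by (auto intro!: member_le_sum)
    with z nonneg[OF that] show "v (Suc s) (High i r) = 0" "v (Suc s) (Low i r) = 0" by linarith+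
  qed
  have Kr: "(of_rat K :: real) > 0" using K by simp
  have "of_rat K * (x s r - of_rat (upper (rules ! i) r)) \<le> 0" "of_rat K * (of_rat (lower (rules ! i) r) - x s r) \<le> 0" if "r < d" for r
    using zero[OF that] that i s by (simp_all add: High Low) (simp_all add: clip_def split: if_splits)
  then have box: "of_rat (lower (rules ! i) r) \<le> x s r" "x s r \<le> of_rat (upper (rules ! i) r)" if "r < d" for r
    using that Kr by (auto simp: mult_le_0_iff)
  have x1: "x s r \<le> 1" if "r < d" for r
  proof -
    have "(of_rat (upper (rules ! i) r) :: real) \<le> 1" using bounds[OF i(1) that] by simp
    then show ?thesis using box(2)[OF that] by linarith
  qed
  have val: "v (Suc (Suc s)) (Val r) = x s r" if "r < d" for r
    using x1[OF that] x_nonneg[OF s0 that] s that by (simp add: Val) (simp add: clip_def)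
  have out0: "v (Suc (Suc (Suc s))) (Out j r) = 0" if "j < n" "j \<noteq> i" "r < d" for j r
  proof -
    have src: "source (rules ! j) r < d" using bounds that by simp
    let ?a = "of_rat (coeff (rules ! j) r) :: real" and ?b = "of_rat (const (rules ! j) r) :: real" and ?p = "of_rat (param (rules ! j) r) :: real"
    have "(of_rat (\<bar>coeff (rules ! j) r\<bar> + \<bar>const (rules ! j) r\<bar> + \<bar>param (rules ! j) r\<bar>) :: real) \<le> of_rat M"
      using M that unfolding of_rat_less_eq by simp
    then have "\<bar>?a\<bar> + \<bar>?b\<bar> + \<bar>?p\<bar> \<le> of_rat M" unfolding of_rat_add abs_of_rat .
    then have "?a * x s (source (rules ! j) r) + ?b + ?p * e - of_rat M \<le> 0"
      using x1 x_nonneg s0 src e by (intro affine_le) auto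
    then show ?thesis using that sel0 src by (simp add: Out val alive' par) (simp add: clip_def)
  qed
  have "x (Suc (Suc (Suc s))) r = v (Suc (Suc (Suc s))) (Out i r)" if "r < d" for r
    unfolding x_def using i out0 that sum.remove[of "{..<n}" i "\<lambda>i. v (Suc (Suc (Suc s))) (Out i r)"] by simp
  then show ?thesis unfolding rule_step_def s3 s_def[symmetric]
    using i box bounds by (intro exI[of _ i]) (simp add: Out val alive' par sel)
qed

text \<open>A rule step takes three network steps, so a trajectory interleaves three computations,
  one for each residue of the time modulo 3. Each of them must die.\<close>

lemma dies_unless_immortal:
  assumes "\<not> rules_immortal d rules e"
  shows "\<exists>T. \<forall>t\<ge>T. \<forall>k\<in>set nodes. v t k = 0"
proof -
  have "\<exists>k. c (t + 3 * k) < 1" if "t > 0" for t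
  proof (rule ccontr)
    assume "\<nexists>k. c (t + 3 * k) < 1"
    then have ge: "c (t + 3 * k) \<ge> 1" for k by (simp add: not_less)
    have "rule_step d rules e (x (t + 3 * k + 3)) (x (t + 3 * Suc k + 3))" for k
      using alive_rule_step[of "t + 3 * k"] that ge[of k] ge[of "Suc k"] ge[of "Suc (Suc k)"]
      by (simp add: algebra_simps)
    then have "rules_immortal d rules e" unfolding rules_immortal_def
      by (intro exI[of _ "\<lambda>k. x (t + 3 * k + 3)"]) blast
    with assms show False by simp
  qed
  then have "\<exists>k. c (t + 3 * k) = 0" if "t > 0" for t
    using c_dies[of "t + 3 * k" for k] that by (metis add.assoc add_gr_0 distrib_left)
  then obtain k where k: "\<And>t. t > 0 \<Longrightarrow> c (t + 3 * k t) = 0" by metis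
  define T where "T = 3 + 3 * (k 1 + k 2 + k 3)"
  have "c t = 0" if "t \<ge> T" for t
  proof -
    \<comment> \<open>The representatives are 1, 2, 3 and not 0, 1, 2: values at time 0 are
      arbitrary, possibly negative.\<close>
    have "\<exists>r. (r = 1 \<or> r = 2 \<or> r = 3) \<and> t mod 3 = r mod 3"
      by (rule exI[of _ "if t mod 3 = 0 then 3 else t mod 3"]) auto
    then obtain r where r: "r = 1 \<or> r = 2 \<or> r = 3" "t mod 3 = r mod 3" by blast
    have le: "r + 3 * k r \<le> t" using r(1) that by (auto simp: T_def)
    have "(r + 3 * k r) mod 3 = t mod 3" using r by simp
    then have "3 dvd t - (r + 3 * k r)" using le by (metis mod_eq_dvd_iff_nat)
    then obtain q where "t = r + 3 * k r + 3 * q" using le by (metis dvdE le_add_diff_inverse)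
    then show ?thesis using c_zero[of "r + 3 * k r" q] k[of r] r(1) by force
  qed
  then show ?thesis using all_zero by blast
qed

text \<open>The hypotheses cover the three interleaved computations. The bound
  \<open>12 = 4 + 8\<close> does not depend on the trajectory, and this uniformity yields Lyapunov
  stability.\<close>

lemma small_dies:
  assumes "c 1 < 1/2" "c 2 < 1/2" "c 3 < 1/2" "t \<ge> 12" "k \<in> set nodes"
  shows "v t k = 0"
proof -
  have "c t = 0" if "t \<ge> 4" for t
    using that
  proof (induction t rule: less_induct)
    case (less t)
    have "c (t - 3) < 1/2"
    proof (cases "t \<ge> 7")
      case False
      then have "t = 4 \<or> t = 5 \<or> t = 6" using less.prems by auto
      then show ?thesis using assms by auto
    qed (use less in auto)
    then show ?case using c_half[of "t - 3"] less.prems by simp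
  qed
  then show ?thesis using all_zero[of 4 t k] assms by simp
qed

text \<open>Converse direction: on exact data the applicable rule keeps the activity at
  \<open>1\<close>, while every other guard is violated so far that a detector saturates and cancels
  \<open>Alive\<close>.\<close>

lemma rule_step_alive:
  assumes c: "c t = 1" and x: "\<And>r. r < d \<Longrightarrow> x t r = y r" and par: "v t (Par 0) = e"
    and rule: "rule_step d rules e y y'"
  shows "c (t + 3) = 1 \<and> (\<forall>r<d. x (t + 3) r = y' r) \<and> v (t + 3) (Par 0) = e"
proof -
  have t3: "t + 3 = Suc (Suc (Suc t))" by simp
  obtain i where i: "i < n" and box: "\<And>r. r < d \<Longrightarrow> of_rat (lower (rules ! i) r) \<le> x t r \<and> x t r \<le> of_rat (upper (rules ! i) r)"
    and y': "\<And>r. r < d \<Longrightarrow> y' r = clip 1 (of_rat (coeff (rules ! i) r) * x t (source (rules ! i) r) +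
        of_rat (const (rules ! i) r) + of_rat (param (rules ! i) r) * e)"
    using rule x bounds unfolding rule_step_def by auto
  have Kr: "(of_rat K :: real) > 0" using K by simp
  have unit: "0 \<le> x t r" "x t r \<le> 1" if "r < d" for r
  proof -
    have "(of_rat (upper (rules ! i) r) :: real) \<le> 1" "(0 :: real) \<le> of_rat (lower (rules ! i) r)"
      using bounds[OF i that] by simp_all
    with box[OF that] show "0 \<le> x t r" "x t r \<le> 1" by linarith+
  qed
  have "v (Suc t) (High i r) = 0" "v (Suc t) (Low i r) = 0" if "r < d" for r
    using that i c box[OF that] Kr by (auto simp: High Low intro!: clip_nonpos mult_nonneg_nonpos)
  then have sel: "v (Suc (Suc t)) (Sel i) = 1" using i c by (simp add: Sel Alive clip_def)
  have sel0: "v (Suc (Suc t)) (Sel j) = 0" if j: "j < n" "j \<noteq> i" for j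
  proof -
    have one: "of_rat K * a \<ge> 1" if "K * (p - q) \<ge> 2" "a \<ge> of_rat p - of_rat q" for p q and a :: real
    proof -
      have "(of_rat 2 :: real) \<le> of_rat (K * (p - q))" using that(1) unfolding of_rat_less_eq .
      also have "\<dots> = of_rat K * (of_rat p - of_rat q)" by (simp add: of_rat_mult of_rat_diff)
      also have "\<dots> \<le> of_rat K * a" using that Kr by (intro mult_left_mono) auto
      finally show ?thesis by simp
    qed
    obtain r where r: "r < d" "K * (lower (rules ! j) r - upper (rules ! i) r) \<ge> 2 \<or> K * (lower (rules ! i) r - upper (rules ! j) r) \<ge> 2"
      using separated[of i j] i j by blast
    then have "v (Suc t) (Low j r) = 1 \<or> v (Suc t) (High j r) = 1"
    proof (elim disjE)
      assume "K * (lower (rules ! j) r - upper (rules ! i) r) \<ge> 2"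
      from one[OF this, of "of_rat (lower (rules ! j) r) - x t r"] show ?thesis
        using box[OF r(1)] j r c by (simp add: Low clip_def)
    next
      assume "K * (lower (rules ! i) r - upper (rules ! j) r) \<ge> 2"
      from one[OF this, of "x t r - of_rat (upper (rules ! j) r)"] show ?thesis
        using box[OF r(1)] j r c by (simp add: High clip_def)
    qed
    moreover have nonneg: "0 \<le> v (Suc t) (High j r)" "0 \<le> v (Suc t) (Low j r)" if "r < d" for r
      using that j by (auto intro!: v_nonneg)
    moreover have "0 \<le> (\<Sum>r<d. v (Suc t) (High j r))" "0 \<le> (\<Sum>r<d. v (Suc t) (Low j r))"
      using nonneg by (auto intro!: sum_nonneg)
    moreover have "v (Suc t) (High j r) \<le> (\<Sum>r<d. v (Suc t) (High j r))"
       "v (Suc t) (Low j r) \<le> (\<Sum>r<d. v (Suc t) (Low j r))"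
      using nonneg r by (auto intro!: member_le_sum)
    ultimately have "(\<Sum>r<d. v (Suc t) (High j r)) + (\<Sum>r<d. v (Suc t) (Low j r)) \<ge> 1" by auto
    then show ?thesis using j c by (simp add: Sel Alive clip_def)
  qed
  have alive': "v (Suc (Suc t)) Alive' = 1" using c by (simp add: Alive' clip_def)
  have par2: "v (Suc (Suc t)) (Par 2) = e" using par e by (simp add: Par(2) clip_def)
  have val: "v (Suc (Suc t)) (Val r) = x t r" if "r < d" for r
    using unit[OF that] c that by (simp add: Val) (simp add: clip_def)
  have out0: "v (Suc (Suc (Suc t))) (Out j r) = 0" if "j < n" "j \<noteq> i" "r < d" for j r
  proof -
    have src: "source (rules ! j) r < d" using bounds that by simp
    let ?a = "of_rat (coeff (rules ! j) r) :: real" and ?b = "of_rat (const (rules ! j) r) :: real" and ?p = "of_rat (param (rules ! j) r) :: real"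
    have "(of_rat (\<bar>coeff (rules ! j) r\<bar> + \<bar>const (rules ! j) r\<bar> + \<bar>param (rules ! j) r\<bar>) :: real) \<le> of_rat M"
      using M that unfolding of_rat_less_eq by simp
    then have "\<bar>?a\<bar> + \<bar>?b\<bar> + \<bar>?p\<bar> \<le> of_rat M" unfolding of_rat_add abs_of_rat .
    then have "?a * x t (source (rules ! j) r) + ?b + ?p * e - of_rat M \<le> 0"
      using unit src e by (intro affine_le) auto
    then show ?thesis using that sel0 src by (simp add: Out val alive' par2) (simp add: clip_def)
  qed
  have act0: "v (Suc (Suc (Suc t))) (Act j) = 0" if "j < n" "j \<noteq> i" for j
    using that sel0 c by (simp add: Act) (simp add: clip_def)
  have "x (Suc (Suc (Suc t))) r = y' r" if "r < d" for r
  proof -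
    have "x (Suc (Suc (Suc t))) r = v (Suc (Suc (Suc t))) (Out i r)"
      unfolding x_def using i out0 that sum.remove[of "{..<n}" i "\<lambda>i. v (Suc (Suc (Suc t))) (Out i r)"] by simp
    also have "\<dots> = y' r"
      using val[of "source (rules ! i) r"] bounds[OF i that]
      by (simp only: Out[OF i that] y'[OF that] alive' par2 sel) simp
    finally show ?thesis .
  qed
  moreover have "c (Suc (Suc (Suc t))) = v (Suc (Suc (Suc t))) (Act i)"
    unfolding c_def using i act0 sum.remove[of "{..<n}" i "\<lambda>i. v (Suc (Suc (Suc t))) (Act i)"] by simp
  moreover have "v (Suc (Suc (Suc t))) (Act i) = 1"
    using c by (simp only: Act[OF i] sel) (simp add: clip_def)
  moreover have "v (Suc (Suc (Suc t))) (Par 0) = e"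
    using c e by (simp only: Par(1)) (simp add: clip_def)
  ultimately show ?thesis unfolding t3 by simp
qed

lemma alive_forever:
  assumes "c 0 = 1" "\<And>r. r < d \<Longrightarrow> x 0 r = y 0 r" "v 0 (Par 0) = e"
    and "\<And>k. rule_step d rules e (y k) (y (Suc k))"
  shows "c (3 * k) = 1"
proof -
  have "c (3 * k) = 1 \<and> (\<forall>r<d. x (3 * k) r = y k r) \<and> v (3 * k) (Par 0) = e"
  proof (induction k)
    case (Suc k)
    then show ?case using rule_step_alive[of "3 * k" "y k" "y (Suc k)"] assms(4)[of k]
      by (simp add: algebra_simps)
  qed (use assms in auto)
  then show ?thesis by blast
qed

end

section \<open>From networks to clipped linear systems\<close>

definition sat_trajectory :: "nat \<Rightarrow> (nat \<Rightarrow> nat \<Rightarrow> rat) \<Rightarrow> (nat \<Rightarrow> real) \<Rightarrow> (nat \<Rightarrow> nat \<Rightarrow> real) \<Rightarrow> bool" where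
  "sat_trajectory N A h u \<longleftrightarrow>
     (\<forall>t. \<forall>i<N. u (Suc t) i = clip (h i) (\<Sum>j<N. of_rat (A i j) * u t j))"

text \<open>Extinction in finite time, not mere convergence: it makes the convergence of a plant
  state immediate even if that state is only partially read out.\<close>

definition sat_stable :: "nat \<Rightarrow> (nat \<Rightarrow> nat \<Rightarrow> rat) \<Rightarrow> (nat \<Rightarrow> real) \<Rightarrow> bool" where
  "sat_stable N A h \<longleftrightarrow>
     (\<forall>u. sat_trajectory N A h u \<longrightarrow> (\<exists>T. \<forall>t\<ge>T. \<forall>i<N. u t i = 0)) \<and>
     (\<forall>\<epsilon>>0. \<exists>\<delta>>0. \<forall>u. sat_trajectory N A h u \<longrightarrow> (\<forall>i<N. \<bar>u 0 i\<bar> \<le> \<delta>) \<longrightarrow> (\<forall>t. \<forall>i<N. \<bar>u t i\<bar> \<le> \<epsilon>))"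

definition sat_unstable :: "nat \<Rightarrow> (nat \<Rightarrow> nat \<Rightarrow> rat) \<Rightarrow> (nat \<Rightarrow> real) \<Rightarrow> bool" where
  "sat_unstable N A h \<longleftrightarrow> (\<exists>u. sat_trajectory N A h u \<and> \<not> (\<forall>i<N. (\<lambda>t. u t i) \<longlonglongrightarrow> 0))"

lemma abs_clip_le: "h \<ge> 0 \<Longrightarrow> \<bar>clip h x\<bar> \<le> \<bar>x\<bar>"
  by (auto simp: clip_def)

context network
begin

definition weight :: "nat \<Rightarrow> nat \<Rightarrow> rat" where
  "weight i j = (\<Sum>(a, k)\<leftarrow>terms (nodes ! i). if k = nodes ! j then a else 0)"

abbreviation size :: nat where "size \<equiv> length nodes"

definition index :: "node \<Rightarrow> nat" where "index = inv_into {..<size} ((!) nodes)"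

lemma bij_nodes: "bij_betw ((!) nodes) {..<size} (set nodes)"
  using distinct_nodes by (simp add: bij_betw_nth)

lemma index_nodes [simp]: "i < size \<Longrightarrow> index (nodes ! i) = i"
  using bij_nodes by (auto simp: index_def bij_betw_def inv_into_f_f)

lemma index_less: "k \<in> set nodes \<Longrightarrow> index k < size" and nodes_index: "k \<in> set nodes \<Longrightarrow> nodes ! index k = k"
  by (metis in_set_conv_nth index_nodes)+

lemma weight_sum:
  assumes "i < size"
  shows "(\<Sum>j<size. of_rat (weight i j) * u j) = lin (terms (nodes ! i)) (\<lambda>k. u (index k))"
proof -
  have ind: "set ts \<subseteq> UNIV \<times> set nodes \<Longrightarrow>
    (\<Sum>j<size. of_rat (\<Sum>(a, k)\<leftarrow>ts. if k = nodes ! j then a else 0) * u j) = lin ts (\<lambda>k. u (index k))"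
    for ts
  proof (induction ts)
    case (Cons t ts)
    obtain a k where t: "t = (a, k)" by fastforce
    have "t \<in> UNIV \<times> set nodes" using Cons.prems by (rule subsetD) simp
    then have k: "k \<in> set nodes" by (simp add: t)
    have "(\<Sum>j<size. of_rat (if k = nodes ! j then a else 0) * u j) = (\<Sum>j<size. if j = index k then of_rat a * u j else 0)"
    proof (rule sum.cong[OF refl])
      fix j assume "j \<in> {..<size}"
      then have "k = nodes ! j \<longleftrightarrow> j = index k" using nodes_index[OF k] index_nodes[of j] by auto
      then show "of_rat (if k = nodes ! j then a else 0) * u j = (if j = index k then of_rat a * u j else 0)" by simp
    qed
    also have "\<dots> = of_rat a * u (index k)" using k by (simp add: index_less)
    finally have *: "(\<Sum>j<size. of_rat (if k = nodes ! j then a else 0) * u j) = of_rat a * u (index k)" .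
    have "set ts \<subseteq> UNIV \<times> set nodes" using Cons.prems by simp
    from Cons.IH[OF this] show ?case
      by (simp only: t list.map sum_list.Cons prod.case of_rat_add distrib_right sum.distrib lin_simps *)
  qed simp
  have "set (terms (nodes ! i)) \<subseteq> UNIV \<times> set nodes"
    using terms_in_nodes[OF nth_mem[OF assms]] by auto
  then show ?thesis unfolding weight_def by (rule ind)
qed

abbreviation bound :: "real \<Rightarrow> nat \<Rightarrow> real" where "bound e i \<equiv> if i = 0 then e else 1"

lemma size_pos: "size > 0"
  by (simp add: nodes_def)

lemma limit_1: "k \<noteq> Par 0 \<Longrightarrow> limit e k = 1"
  by (cases k) auto

text \<open>The only varying bound sits at index \<open>0\<close>, where it becomes the head of an
  encoded vector.\<close>

lemma limit_nodes: "i < size \<Longrightarrow> limit e (nodes ! i) = bound e i"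
proof -
  assume i: "i < size"
  have 0: "nodes ! 0 = Par 0" by (simp add: nodes_def)
  show ?thesis
  proof (cases "i = 0")
    case False
    then have "nodes ! i \<noteq> nodes ! 0" using i size_pos distinct_nodes nth_eq_iff_index_eq by blast
    then have "nodes ! i \<noteq> Par 0" using 0 by simp
    then have "limit e (nodes ! i) = 1" by (rule limit_1)
    then show ?thesis using False by simp
  qed (use 0 in simp)
qed

lemma trajectory_of_sat:
  assumes "0 < e" "e \<le> 1" "sat_trajectory size weight (bound e) u"
  shows "trajectory d rules K M e (\<lambda>t k. u t (index k))"
proof unfold_locales
  fix t k assume k: "k \<in> set nodes"
  then have "limit e k = bound e (index k)" using limit_nodes[of "index k"] by (simp add: index_less nodes_index)
  then show "u (Suc t) (index k) = clip (limit e k) (lin (terms k) (\<lambda>k. u t (index k)))"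
    using assms(3) k weight_sum[of "index k" "u t"] index_less[OF k] unfolding sat_trajectory_def by (simp add: nodes_index)
qed (use assms in auto)

lemma unstable_if_immortal:
  assumes e: "0 < e" "e \<le> 1" and imm: "rules_immortal d rules e"
  shows "sat_unstable size weight (bound e)"
proof -
  obtain y where y: "\<And>k::nat. rule_step d rules e (y k) (y (Suc k))" using imm by (auto simp: rules_immortal_def)
  then have n: "n > 0" using y[of 0] by (auto simp: rule_step_def)
  \<comment> \<open>Which unit carries the activity and the registers is immaterial, since only the
    sums \<open>c\<close> and \<open>x\<close> matter; rule \<open>0\<close> is chosen for all of
    them.\<close>
  define w :: "node \<Rightarrow> real" where
    "w k = (case k of Act i \<Rightarrow> if i = 0 then 1 else 0 | Out i r \<Rightarrow> if i = 0 then y 0 r else 0 | Par p \<Rightarrow> e | _ \<Rightarrow> 0)" for k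
  define u where "u t = ((\<lambda>u i. clip (bound e i) (\<Sum>j<size. of_rat (weight i j) * u j)) ^^ t) (\<lambda>i. w (nodes ! i))" for t
  have u: "sat_trajectory size weight (bound e) u" by (simp add: sat_trajectory_def u_def)
  interpret trajectory d rules K M e "\<lambda>t k. u t (index k)"
    using e u by (rule trajectory_of_sat)
  have u0: "u 0 (index k) = w k" if "k \<in> set nodes" for k
    using that by (simp add: u_def nodes_index)
  have "c 0 = (\<Sum>i<n. if i = 0 then 1 else 0)" unfolding c_def by (intro sum.cong) (auto simp: u0 w_def)
  then have "c 0 = 1" using n by simp
  moreover have "x 0 r = y 0 r" if "r < d" for r
  proof -
    have "x 0 r = (\<Sum>i<n. if i = 0 then y 0 r else 0)"
      unfolding x_def using that by (intro sum.cong) (auto simp: u0 w_def)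
    then show ?thesis using n by simp
  qed
  ultimately have c: "c (3 * k) = 1" for k
    by (intro alive_forever[of y]) (auto simp: u0 w_def intro: y)
  have "\<not> (\<forall>i<size. (\<lambda>t. u t i) \<longlonglongrightarrow> 0)"
  proof
    assume conv: "\<forall>i<size. (\<lambda>t. u t i) \<longlonglongrightarrow> 0"
    have "(\<lambda>t. u t (index (Act i))) \<longlonglongrightarrow> 0" if "i < n" for i
      using conv index_less[of "Act i"] that by (metis in_nodes(11))
    then have "c \<longlonglongrightarrow> (\<Sum>i<n. 0)" unfolding c_def by (intro tendsto_sum) blast
    moreover have "strict_mono (\<lambda>k::nat. 3 * k)" by (auto simp: strict_mono_def)
    ultimately have "(c \<circ> (\<lambda>k. 3 * k)) \<longlonglongrightarrow> 0" by (intro LIMSEQ_subseq_LIMSEQ) auto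
    then show False using c by (simp add: o_def LIMSEQ_const_iff)
  qed
  then show ?thesis using u unfolding sat_unstable_def by blast
qed

lemma stable_if_not_immortal:
  assumes e: "0 < e" "e \<le> 1" and imm: "\<not> rules_immortal d rules e"
  shows "sat_stable size weight (bound e)"
proof -
  have conv: "\<exists>T. \<forall>t\<ge>T. \<forall>i<size. u t i = 0" if u: "sat_trajectory size weight (bound e) u" for u
  proof -
    interpret trajectory d rules K M e "\<lambda>t k. u t (index k)"
      using e u by (rule trajectory_of_sat)
    obtain T where "\<forall>t\<ge>T. \<forall>k\<in>set nodes. u t (index k) = 0" using dies_unless_immortal[OF imm] by blast
    then have "\<forall>t\<ge>T. \<forall>i<size. u t i = 0" by (metis index_nodes nth_mem)
    then show ?thesis by blast
  qed
  \<comment> \<open>The gain of one network step in the maximum norm; the summand \<open>1\<close>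
    makes its powers increasing.\<close>
  define \<Lambda> :: real where "\<Lambda> = 1 + (\<Sum>k\<in>set nodes. \<Sum>(a, l)\<leftarrow>terms k. \<bar>of_rat a\<bar>)"
  have nonneg: "0 \<le> (\<Sum>(a, l)\<leftarrow>ts. \<bar>of_rat a :: real\<bar>)" for ts :: "(rat \<times> node) list"
    by (induction ts) auto
  then have "(\<Sum>(a, l)\<leftarrow>terms k. \<bar>of_rat a\<bar>) \<le> \<Lambda>" if "k \<in> set nodes" for k
    using member_le_sum[of k "set nodes" "\<lambda>k. \<Sum>(a, l)\<leftarrow>terms k. \<bar>of_rat a :: real\<bar>"] that by (simp add: \<Lambda>_def)
  have \<Lambda>1: "\<Lambda> \<ge> 1" using nonneg by (auto simp: \<Lambda>_def intro!: sum_nonneg)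
  have growth: "\<bar>u t i\<bar> \<le> \<Lambda> ^ t * \<delta>" if u: "sat_trajectory size weight (bound e) u" and "\<forall>i<size. \<bar>u 0 i\<bar> \<le> \<delta>" "i < size" for u t i \<delta>
    using that(3)
  proof (induction t arbitrary: i)
    case 0
    then show ?case using that by simp
  next
    case (Suc t)
    have "\<bar>u 0 0\<bar> \<le> \<delta>" using that(2) size_pos by blast
    then have \<delta>: "\<delta> \<ge> 0" by linarith
    have "\<bar>u (Suc t) i\<bar> \<le> \<bar>lin (terms (nodes ! i)) (\<lambda>k. u t (index k))\<bar>"
      using u Suc(2) e abs_clip_le weight_sum[of i "u t"] unfolding sat_trajectory_def by simp
    also have "\<dots> \<le> (\<Sum>(a, k)\<leftarrow>terms (nodes ! i). \<bar>of_rat a\<bar>) * (\<Lambda> ^ t * \<delta>)"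
      using Suc terms_in_nodes index_less by (intro lin_bound) (meson nth_mem)
    also have "\<dots> \<le> \<Lambda> * (\<Lambda> ^ t * \<delta>)"
      using \<open>\<And>k. k \<in> set nodes \<Longrightarrow> _\<close> Suc(2) \<Lambda>1 \<delta> by (intro mult_right_mono) auto
    finally show ?case by simp
  qed
  have "\<exists>\<delta>>0. \<forall>u. sat_trajectory size weight (bound e) u \<longrightarrow> (\<forall>i<size. \<bar>u 0 i\<bar> \<le> \<delta>) \<longrightarrow> (\<forall>t. \<forall>i<size. \<bar>u t i\<bar> \<le> \<epsilon>)"
    if \<epsilon>: "\<epsilon> > 0" for \<epsilon>
  proof -
    \<comment> \<open>\<open>\<gamma>\<close> keeps the sum of \<open>n\<close> activities below
      \<open>1/2\<close>; \<open>\<delta>\<close> compensates the growth during the 12 steps after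
      which \<open>small_dies\<close> takes over.\<close>
    define \<gamma> where "\<gamma> = min \<epsilon> (1 / (2 * (real n + 1)))"
    have \<gamma>: "\<gamma> > 0" using \<epsilon> by (simp add: \<gamma>_def)
    define \<delta> where "\<delta> = \<gamma> / \<Lambda> ^ 12"
    have \<delta>: "\<delta> > 0" using \<gamma> \<Lambda>1 by (simp add: \<delta>_def)
    have "\<bar>u t i\<bar> \<le> \<epsilon>" if u: "sat_trajectory size weight (bound e) u" and small: "\<forall>i<size. \<bar>u 0 i\<bar> \<le> \<delta>" and i: "i < size" for u t i
    proof -
      interpret trajectory d rules K M e "\<lambda>t k. u t (index k)"
        using e u by (rule trajectory_of_sat)
      have small_t: "\<bar>u t i\<bar> \<le> \<gamma>" if "t \<le> 12" "i < size" for t i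
      proof -
        have "\<bar>u t i\<bar> \<le> \<Lambda> ^ t * \<delta>" using growth[OF u small that(2)] .
        also have "\<dots> \<le> \<Lambda> ^ 12 * \<delta>" using \<Lambda>1 \<delta> that by (intro mult_right_mono power_increasing) auto
        also have "\<dots> = \<gamma>" using \<Lambda>1 by (simp add: \<delta>_def)
        finally show ?thesis .
      qed
      have "c t < 1/2" if "t \<le> 12" for t
      proof -
        have "c t \<le> (\<Sum>i<n. \<gamma>)" unfolding c_def
          using small_t[OF that] index_less by (intro sum_mono) (metis abs_le_D1 in_nodes(11) lessThan_iff)
        also have "\<dots> = real n * \<gamma>" by simp
        also have "\<dots> \<le> real n * (1 / (2 * (real n + 1)))" by (intro mult_left_mono) (auto simp: \<gamma>_def)
        also have "\<dots> < 1/2" by (simp add: divide_simps)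
        finally show ?thesis .
      qed
      then have "u t i = 0" if "t \<ge> 12" using small_dies[of t "nodes ! i"] that i by simp
      then show ?thesis using small_t[of t i] i \<epsilon> by (cases "t \<le> 12") (auto simp: \<gamma>_def)
    qed
    then show ?thesis using \<delta> by blast
  qed
  with conv show ?thesis unfolding sat_stable_def by blast
qed

end

text \<open>The parameter \<open>e\<close> is only a bound of the system, so \<open>N\<close> and
  \<open>A\<close> are fixed before it. The diagonalization relies on this order of
  quantifiers.\<close>

theorem saturated_simulation:
  assumes bounds: "\<And>\<rho> r. \<rho> \<in> set rules \<Longrightarrow> r < d \<Longrightarrow> 0 \<le> lower \<rho> r \<and> upper \<rho> r \<le> 1 \<and> source \<rho> r < d"
    and separated: "\<And>i j. i < length rules \<Longrightarrow> j < length rules \<Longrightarrow> i \<noteq> j \<Longrightarrow>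
      \<exists>r<d. upper (rules ! i) r < lower (rules ! j) r \<or> upper (rules ! j) r < lower (rules ! i) r"
  shows "\<exists>N A. N > 1 \<and> (\<forall>e. 0 < e \<and> e \<le> 1 \<longrightarrow> (if rules_immortal d rules e
    then sat_unstable N A (\<lambda>i. if i = 0 then e else 1) else sat_stable N A (\<lambda>i. if i = 0 then e else 1)))"
proof -
  let ?n = "length rules"
  define G where "G = (\<lambda>(i, j, r). 2 / \<bar>lower (rules ! j) r - upper (rules ! i) r\<bar>) ` ({..<?n} \<times> {..<?n} \<times> {..<d})"
  define K where "K = Max (insert 1 G)"
  define B where "B = (\<lambda>(i, r). \<bar>coeff (rules ! i) r\<bar> + \<bar>const (rules ! i) r\<bar> + \<bar>param (rules ! i) r\<bar>) ` ({..<?n} \<times> {..<d})"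
  define M where "M = Max (insert 1 B)"
  have fin: "finite G" "finite B" by (auto simp: G_def B_def)
  have K1: "K \<ge> 1" using fin by (auto simp: K_def)
  have gap: "K * (lower (rules ! j) r - upper (rules ! i) r) \<ge> 2"
    if "i < ?n" "j < ?n" "r < d" "upper (rules ! i) r < lower (rules ! j) r" for i j r
  proof -
    have "2 / \<bar>lower (rules ! j) r - upper (rules ! i) r\<bar> \<in> G" unfolding G_def using that by force
    then have "2 / \<bar>lower (rules ! j) r - upper (rules ! i) r\<bar> \<le> K" using fin by (auto simp: K_def)
    then show ?thesis using that by (simp add: divide_simps split: if_splits)
  qed
  interpret network d rules K M
  proof unfold_locales
    fix i r assume "i < ?n" "r < d"
    then have "\<bar>coeff (rules ! i) r\<bar> + \<bar>const (rules ! i) r\<bar> + \<bar>param (rules ! i) r\<bar> \<in> B" unfolding B_def by force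
    then show "\<bar>coeff (rules ! i) r\<bar> + \<bar>const (rules ! i) r\<bar> + \<bar>param (rules ! i) r\<bar> \<le> M"
      using fin by (auto simp: M_def)
  next
    fix i j assume ij: "i < ?n" "j < ?n" "i \<noteq> j"
    then show "\<exists>r<d. K * (lower (rules ! j) r - upper (rules ! i) r) \<ge> 2 \<or> K * (lower (rules ! i) r - upper (rules ! j) r) \<ge> 2"
      using separated[OF ij] gap by blast
  qed (use bounds K1 in auto)
  have "size > 1" by (simp add: nodes_def)
  then show ?thesis using unstable_if_immortal stable_if_not_immortal
    by (intro exI[of _ size] exI[of _ weight]) simp
qed

section \<open>Closed loops of one-step problems\<close>

lemma scalar_prod_self: "v \<in> carrier_vec n \<Longrightarrow> v \<bullet> v = (\<Sum>i<n. (v $ i)\<^sup>2)" for v :: "real vec"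
  by (simp add: scalar_prod_def power2_eq_square atLeast0LessThan)

lemma abs_le_vnorm: "v \<in> carrier_vec n \<Longrightarrow> r < n \<Longrightarrow> \<bar>v $ r\<bar> \<le> vnorm v"
proof -
  assume v: "v \<in> carrier_vec n" "r < n"
  have "(v $ r)\<^sup>2 \<le> (\<Sum>i<n. (v $ i)\<^sup>2)" using v(2) by (intro member_le_sum) auto
  then have "sqrt ((v $ r)\<^sup>2) \<le> vnorm v" unfolding vnorm_def scalar_prod_self[OF v(1)] by (rule real_sqrt_le_mono)
  then show ?thesis by simp
qed

lemma vnorm_le:
  assumes "v \<in> carrier_vec n" "\<And>r. r < n \<Longrightarrow> \<bar>v $ r\<bar> \<le> B" "0 \<le> B"
  shows "vnorm v \<le> real n * B"
proof -
  have "(\<Sum>i<n. (v $ i)\<^sup>2) \<le> (\<Sum>i<n. B\<^sup>2)"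
    using assms(2) by (intro sum_mono) (metis abs_ge_zero lessThan_iff power2_abs power_mono)
  also have "\<dots> = real n * B\<^sup>2" by simp
  also have "\<dots> \<le> (real n * real n) * B\<^sup>2"
    by (intro mult_right_mono) (cases n; simp)+
  also have "\<dots> = (real n * B)\<^sup>2" by (simp add: power2_eq_square)
  finally have "vnorm v \<le> sqrt ((real n * B)\<^sup>2)"
    unfolding vnorm_def scalar_prod_self[OF assms(1)] by (rule real_sqrt_le_mono)
  then show ?thesis using assms(3) by simp
qed

lemma vnorm_nonneg: "0 \<le> vnorm v"
  unfolding vnorm_def by (simp add: scalar_prod_def sum_nonneg)

text \<open>\<open>V\<close> reads the coordinates of the clipped system from the plant state and
  may lose information. Only the successor state is controlled by the readout, hence
  \<open>closed_le\<close> bounds \<open>closed_loop I x\<close> and not \<open>x\<close>.\<close>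

locale sat_readout =
  fixes I :: mpc and n k :: nat and A :: "nat \<Rightarrow> nat \<Rightarrow> rat" and h :: "nat \<Rightarrow> real"
    and V :: "real vec \<Rightarrow> nat \<Rightarrow> real" and C :: real
  assumes n: "state_dim I = n" and feasible: "feasible_set I = carrier_vec n"
    and closed: "\<And>x. x \<in> carrier_vec n \<Longrightarrow> closed_loop I x \<in> carrier_vec n"
    and sat: "\<And>x i. x \<in> carrier_vec n \<Longrightarrow> i < k \<Longrightarrow>
      V (closed_loop I x) i = clip (h i) (\<Sum>j<k. of_rat (A i j) * V x j)"
    and C: "C \<ge> 0"
    and closed_le: "\<And>x B r. x \<in> carrier_vec n \<Longrightarrow> 0 \<le> B \<Longrightarrow> (\<And>i. i < k \<Longrightarrow> \<bar>V x i\<bar> \<le> B) \<Longrightarrow> r < n \<Longrightarrow>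
      \<bar>closed_loop I x $ r\<bar> \<le> C * B"
    and V_le: "\<And>x B i. x \<in> carrier_vec n \<Longrightarrow> (\<And>r. r < n \<Longrightarrow> \<bar>x $ r\<bar> \<le> B) \<Longrightarrow> i < k \<Longrightarrow> \<bar>V x i\<bar> \<le> C * B"
    and surj: "\<And>u. \<exists>x\<in>carrier_vec n. \<forall>i<k. V x i = u i"
begin

lemma iterate: "x \<in> carrier_vec n \<Longrightarrow> (closed_loop I ^^ t) x \<in> carrier_vec n"
  by (induction t) (auto simp: closed)

lemma trajectory: "x \<in> carrier_vec n \<Longrightarrow> sat_trajectory k A h (\<lambda>t. V ((closed_loop I ^^ t) x))"
  by (simp add: sat_trajectory_def sat iterate)

lemma stable:
  assumes "sat_stable k A h"
  shows "asymptotically_stable I"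
  unfolding asymptotically_stable_def feasible
proof (intro conjI ballI allI impI)
  fix x :: "real vec" and t assume "x \<in> carrier_vec n"
  then show "(closed_loop I ^^ t) x \<in> carrier_vec n" by (rule iterate)
next
  fix x :: "real vec" assume x: "x \<in> carrier_vec n"
  then obtain T where T: "\<And>t i. t \<ge> T \<Longrightarrow> i < k \<Longrightarrow> V ((closed_loop I ^^ t) x) i = 0"
    using assms trajectory[OF x] unfolding sat_stable_def by blast
  have "vnorm ((closed_loop I ^^ t) x) = 0" if "t \<ge> Suc T" for t
  proof -
    have t: "t = Suc (t - 1)" using that by simp
    have "\<bar>closed_loop I ((closed_loop I ^^ (t - 1)) x) $ r\<bar> \<le> C * 0" if "r < n" for r
      using T[of "t - 1"] \<open>t \<ge> Suc T\<close> that by (intro closed_le iterate x) auto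
    then have "\<bar>(closed_loop I ^^ t) x $ r\<bar> \<le> 0" if "r < n" for r using that t by (metis comp_apply funpow.simps(2) mult_zero_right)
    then have "vnorm ((closed_loop I ^^ t) x) \<le> real n * 0" by (intro vnorm_le iterate x) auto
    then show ?thesis using vnorm_nonneg[of "(closed_loop I ^^ t) x"] by simp
  qed
  then have "\<forall>\<^sub>F t in sequentially. vnorm ((closed_loop I ^^ t) x) = 0"
    unfolding eventually_sequentially by blast
  then show "(\<lambda>t. vnorm ((closed_loop I ^^ t) x)) \<longlonglongrightarrow> 0" by (rule tendsto_eventually)
next
  fix \<epsilon> :: real assume \<epsilon>: "\<epsilon> > 0"
  define \<epsilon>' where "\<epsilon>' = \<epsilon> / (2 * (real n + 1) * (C + 1))"
  have \<epsilon>': "\<epsilon>' > 0" using \<epsilon> C by (simp add: \<epsilon>'_def)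
  obtain \<delta>' where \<delta>': "\<delta>' > 0" "\<And>u t i. sat_trajectory k A h u \<Longrightarrow> (\<forall>i<k. \<bar>u 0 i\<bar> \<le> \<delta>') \<Longrightarrow> i < k \<Longrightarrow> \<bar>u t i\<bar> \<le> \<epsilon>'"
    using assms \<epsilon>' unfolding sat_stable_def by metis
  \<comment> \<open>The minimum with \<open>\<epsilon>\<close> serves time \<open>0\<close>, where
    the state is not a successor and \<open>closed_le\<close> says nothing about it.\<close>
  define \<delta> where "\<delta> = min \<epsilon> (\<delta>' / (C + 1))"
  have \<delta>: "\<delta> > 0" using \<epsilon> \<delta>' C by (simp add: \<delta>_def)
  have "vnorm ((closed_loop I ^^ t) x) < \<epsilon>" if x: "x \<in> carrier_vec n" "vnorm x < \<delta>" for x t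
  proof (cases t)
    case 0
    then show ?thesis using x by (simp add: \<delta>_def)
  next
    case (Suc l)
    have "\<bar>V ((closed_loop I ^^ 0) x) i\<bar> \<le> \<delta>'" if "i < k" for i
    proof -
      have "\<bar>V x i\<bar> \<le> C * \<delta>" using x that abs_le_vnorm[OF x(1)] by (intro V_le) force+
      also have "\<dots> \<le> C * (\<delta>' / (C + 1))" using C by (intro mult_left_mono) (auto simp: \<delta>_def)
      also have "\<dots> \<le> \<delta>'" using C \<delta>' by (simp add: divide_simps mult_right_mono)
      finally show ?thesis by simp
    qed
    then have "\<bar>V ((closed_loop I ^^ l) x) i\<bar> \<le> \<epsilon>'" if "i < k" for i
      using \<delta>'(2)[OF trajectory[OF x(1)], of i l] that by blast
    then have "\<bar>closed_loop I ((closed_loop I ^^ l) x) $ r\<bar> \<le> C * \<epsilon>'" if "r < n" for r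
      using \<epsilon>' that by (intro closed_le iterate x) auto
    then have "vnorm ((closed_loop I ^^ t) x) \<le> real n * (C * \<epsilon>')"
      using C \<epsilon>' Suc by (intro vnorm_le iterate x) auto
    also have "\<dots> \<le> (real n + 1) * ((C + 1) * \<epsilon>')"
      using C \<epsilon>' by (intro mult_mono) auto
    also have "\<dots> = \<epsilon> / 2" using C by (simp add: \<epsilon>'_def divide_simps)
    finally show ?thesis using \<epsilon> by simp
  qed
  then show "\<exists>\<delta>>0. \<forall>x\<in>carrier_vec n. vnorm x < \<delta> \<longrightarrow> (\<forall>t. vnorm ((closed_loop I ^^ t) x) < \<epsilon>)"
    using \<delta> by blast
qed

lemma unstable:
  assumes "sat_unstable k A h"
  shows "\<not> asymptotically_stable I"
proof
  assume stable: "asymptotically_stable I"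
  obtain u where u: "sat_trajectory k A h u" "\<not> (\<forall>i<k. (\<lambda>t. u t i) \<longlonglongrightarrow> 0)"
    using assms unfolding sat_unstable_def by blast
  obtain x where x: "x \<in> carrier_vec n" "\<forall>i<k. V x i = u 0 i" using surj by blast
  have eq: "\<forall>i<k. V ((closed_loop I ^^ t) x) i = u t i" for t
  proof (induction t)
    case (Suc t)
    show ?case
    proof (intro allI impI)
      fix i assume i: "i < k"
      have "V ((closed_loop I ^^ Suc t) x) i = clip (h i) (\<Sum>j<k. of_rat (A i j) * V ((closed_loop I ^^ t) x) j)"
        using sat[OF iterate[OF x(1)] i] by simp
      also have "(\<Sum>j<k. of_rat (A i j) * V ((closed_loop I ^^ t) x) j) = (\<Sum>j<k. of_rat (A i j) * u t j)"
        using Suc by (intro sum.cong) auto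
      also have "clip (h i) \<dots> = u (Suc t) i" using u(1) i by (simp add: sat_trajectory_def)
      finally show "V ((closed_loop I ^^ Suc t) x) i = u (Suc t) i" .
    qed
  qed (use x in simp)
  have "(\<lambda>t. vnorm ((closed_loop I ^^ t) x)) \<longlonglongrightarrow> 0"
    using stable x(1) unfolding asymptotically_stable_def feasible by blast
  then have lim: "(\<lambda>t. C * vnorm ((closed_loop I ^^ t) x)) \<longlonglongrightarrow> 0" by (rule tendsto_mult_right_zero)
  have "(\<lambda>t. u t i) \<longlonglongrightarrow> 0" if i: "i < k" for i
  proof (rule tendsto_0_le[OF lim, where K = 1])
    have "norm (u t i) \<le> C * vnorm ((closed_loop I ^^ t) x)" for t
      using V_le[OF iterate[OF x(1), of t] abs_le_vnorm[OF iterate[OF x(1), of t]] i] eq[of t] i by simp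
    then have "norm (u t i) \<le> norm (C * vnorm ((closed_loop I ^^ t) x)) * 1" for t
      using C by (simp add: abs_mult vnorm_nonneg)
    then show "\<forall>\<^sub>F t in sequentially. norm (u t i) \<le> norm (C * vnorm ((closed_loop I ^^ t) x)) * 1" by simp
  qed
  then show False using u(2) by blast
qed

end

section \<open>Quadratic one-step problems\<close>

lemma mpc_optimizer_unique:
  assumes "mpc_feasible I x z" "\<And>z'. mpc_feasible I x z' \<Longrightarrow> z' \<noteq> z \<Longrightarrow> mpc_cost I z < mpc_cost I z'"
  shows "mpc_optimizer I x z' \<longleftrightarrow> z' = z"
  using assms unfolding mpc_optimizer_def is_arg_min_def by (metis order_less_asym)

lemma mpc_law_unique:
  assumes "\<And>z'. mpc_optimizer I x z' \<longleftrightarrow> z' = (xs, us, s)"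
  shows "mpc_law I x = us ! 0"
  unfolding mpc_law_def assms by simp

text \<open>The cost becomes a weighted sum of squares of all decision variables. Without slacks the
  value of \<open>\<rho>\<close> is arbitrary, which lets the hard and the softened problems share
  one treatment.\<close>

definition quadratic :: "mpc \<Rightarrow> rat \<Rightarrow> bool" where
  "quadratic I \<rho> \<longleftrightarrow> horizon I = 1 \<and> unit_weights I \<and> slack_W I = \<rho> \<cdot>\<^sub>m 1\<^sub>m (slack_dim I) \<and> \<rho> > 0"

lemma rmat_one: "rmat (1\<^sub>m n) = 1\<^sub>m n"
  by (rule eq_matI) auto

lemma rmat_smult_one: "rmat (\<rho> \<cdot>\<^sub>m 1\<^sub>m n) = of_rat \<rho> \<cdot>\<^sub>m 1\<^sub>m n"
  by (rule eq_matI) (auto simp: of_rat_mult)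

lemma vec_add_diff: "a \<in> carrier_vec n \<Longrightarrow> b \<in> carrier_vec n \<Longrightarrow> a + (b - a) = b"
  and vec_diff_add: "a \<in> carrier_vec n \<Longrightarrow> b \<in> carrier_vec n \<Longrightarrow> (a + b) - a = b"
  and vec_diff_index: "a \<in> carrier_vec n \<Longrightarrow> i < n \<Longrightarrow> (b - a) $ i = b $ i - a $ i" for a b :: "real vec"
  by (auto intro!: eq_vecI)

lemma rmat_mult_index:
  assumes "M \<in> carrier_mat n m" "x \<in> carrier_vec m" "i < n"
  shows "(rmat M *\<^sub>v x) $ i = (\<Sum>j<m. of_rat (M $$ (i, j)) * x $ j)"
proof -
  have "(rmat M *\<^sub>v x) $ i = (\<Sum>j\<in>{0..<m}. row (rmat M) i $ j * x $ j)"
    using assms by (auto simp: scalar_prod_def)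
  also have "\<dots> = (\<Sum>j\<in>{0..<m}. of_rat (M $$ (i, j)) * x $ j)" using assms by (intro sum.cong) auto
  finally show ?thesis by (simp add: atLeast0LessThan)
qed

lemma smult_one_mult_vec: "s \<in> carrier_vec n \<Longrightarrow> (c \<cdot>\<^sub>m 1\<^sub>m n) *\<^sub>v s = c \<cdot>\<^sub>v s" for c :: real
proof (rule eq_vecI)
  fix i assume s: "s \<in> carrier_vec n" and "i < dim_vec (c \<cdot>\<^sub>v s)"
  then have i: "i < n" by simp
  have "row (c \<cdot>\<^sub>m 1\<^sub>m n) i = c \<cdot>\<^sub>v unit_vec n i" using i by simp
  then show "((c \<cdot>\<^sub>m 1\<^sub>m n) *\<^sub>v s) $ i = (c \<cdot>\<^sub>v s) $ i" using i s by simp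
qed simp

lemma decision_cases:
  assumes "horizon I = 1" "z \<in> decision_space I"
  obtains x y u s where "z = ([x, y], [u], s)" "x \<in> carrier_vec (state_dim I)" "y \<in> carrier_vec (state_dim I)"
    "u \<in> carrier_vec (input_dim I)" "s \<in> carrier_vec (slack_dim I)"
proof -
  obtain xs us s where z: "z = (xs, us, s)" by (cases z)
  then have l: "length xs = 2" "length us = 1" "set xs \<subseteq> carrier_vec (state_dim I)" "set us \<subseteq> carrier_vec (input_dim I)"
    "s \<in> carrier_vec (slack_dim I)" using assms by (auto simp: decision_space_def)
  obtain x y where "xs = [x, y]" using l(1) by (metis One_nat_def Suc_1 length_0_conv length_Suc_conv)
  moreover obtain u where "us = [u]" using l(2) by (metis One_nat_def length_0_conv length_Suc_conv)
  ultimately show ?thesis using that l z by simp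
qed

lemma constraints_one_step:
  assumes "horizon I = 1"
  shows "mpc_constraints I x ([x', y], [u], s) \<longleftrightarrow> x' = x \<and>
    y = rmat (plant_F I) *\<^sub>v x' + rmat (plant_G I) *\<^sub>v u \<and>
    (\<forall>j<stage_rows I. (rmat (stage_Hx I) *\<^sub>v x' + rmat (stage_Hu I) *\<^sub>v u) $ j
      \<le> rvec (stage_h I) $ j + (rmat (slack_E I) *\<^sub>v s) $ j) \<and>
    (\<forall>j<term_rows I. (rmat (term_H I) *\<^sub>v y) $ j
      \<le> rvec (term_h I) $ j + (rmat (slack_E I) *\<^sub>v s) $ (stage_rows I + j)) \<and>
    0\<^sub>v (slack_dim I) \<le> s"
  using assms by simp

lemma in_decision_space:
  "horizon I = 1 \<Longrightarrow> ([x, y], [u], s) \<in> decision_space I \<longleftrightarrow> x \<in> carrier_vec (state_dim I) \<and> y \<in> carrier_vec (state_dim I) \<and>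
    u \<in> carrier_vec (input_dim I) \<and> s \<in> carrier_vec (slack_dim I)"
  by (auto simp: decision_space_def)

lemma quadratic_cost:
  assumes "quadratic I \<rho>" "([x, y], [u], s) \<in> decision_space I"
  shows "mpc_cost I ([x, y], [u], s) = (\<Sum>i<state_dim I. (x $ i)\<^sup>2) + (\<Sum>i<input_dim I. (u $ i)\<^sup>2) +
    (\<Sum>i<state_dim I. (y $ i)\<^sup>2) + of_rat \<rho> * (\<Sum>i<slack_dim I. (s $ i)\<^sup>2)"
proof -
  have h: "horizon I = 1" and w: "unit_weights I" and W: "slack_W I = \<rho> \<cdot>\<^sub>m 1\<^sub>m (slack_dim I)"
    using assms(1) by (auto simp: quadratic_def)
  have c: "x \<in> carrier_vec (state_dim I)" "y \<in> carrier_vec (state_dim I)" "u \<in> carrier_vec (input_dim I)" "s \<in> carrier_vec (slack_dim I)"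
    using assms(2) in_decision_space[OF h] by auto
  have "s \<bullet> (rmat (slack_W I) *\<^sub>v s) = of_rat \<rho> * (s \<bullet> s)"
    unfolding W rmat_smult_one smult_one_mult_vec[OF c(4)] using c(4) by simp
  then show ?thesis
    using w c by (simp add: h unit_weights_def rmat_one scalar_prod_self[OF c(1)] scalar_prod_self[OF c(2)]
      scalar_prod_self[OF c(3)] scalar_prod_self[OF c(4)])
qed

text \<open>The convexity defect is given explicitly, so that strictness can be read off from
  squared differences.\<close>

lemma square_comb: "((1 - t) * a + t * b)\<^sup>2 = (1 - t) * a\<^sup>2 + t * b\<^sup>2 - t * (1 - t) * (a - b)\<^sup>2" for a b t :: real
  by (simp add: power2_eq_square algebra_simps)

lemma sum_squares_comb:
  "(\<Sum>i<n. ((1 - t) * f i + t * g i)\<^sup>2) = (1 - t) * (\<Sum>i<n. (f i)\<^sup>2) + t * (\<Sum>i<n. (g i)\<^sup>2) - t * (1 - t) * (\<Sum>i<n. (f i - g i)\<^sup>2)" for t :: real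
  by (simp add: square_comb sum.distrib sum_subtractf sum_distrib_left)

lemma vec_diff_pos:
  fixes v w :: "real vec"
  assumes "v \<in> carrier_vec n" "w \<in> carrier_vec n" "v \<noteq> w"
  shows "(\<Sum>i<n. (v $ i - w $ i)\<^sup>2) > 0"
proof -
  obtain i where "i < n" "v $ i \<noteq> w $ i" using assms by (metis carrier_vecD eq_vecI)
  then show ?thesis by (intro sum_pos2[of _ i]) auto
qed

lemma quadratic_strictly_convex:
  assumes q: "quadratic I \<rho>"
  shows "strictly_convex_qp I"
  unfolding strictly_convex_qp_def
proof (intro ballI allI impI)
  have h: "horizon I = 1" and \<rho>: "(of_rat \<rho> :: real) > 0" using q by (auto simp: quadratic_def)
  fix z z' and t :: real
  assume z: "z \<in> decision_space I" and z': "z' \<in> decision_space I" and t: "z \<noteq> z' \<and> 0 < t \<and> t < 1"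
  obtain x y u s where ze: "z = ([x, y], [u], s)" and c: "x \<in> carrier_vec (state_dim I)" "y \<in> carrier_vec (state_dim I)"
    "u \<in> carrier_vec (input_dim I)" "s \<in> carrier_vec (slack_dim I)" using decision_cases[OF h z] .
  obtain x' y' u' s' where ze': "z' = ([x', y'], [u'], s')" and c': "x' \<in> carrier_vec (state_dim I)" "y' \<in> carrier_vec (state_dim I)"
    "u' \<in> carrier_vec (input_dim I)" "s' \<in> carrier_vec (slack_dim I)" using decision_cases[OF h z'] .
  let ?c = "\<lambda>v w. (1 - t) \<cdot>\<^sub>v v + t \<cdot>\<^sub>v w :: real vec"
  let ?d = "\<lambda>n v w. \<Sum>i<n. (v $ i - w $ i :: real)\<^sup>2"
  have comb: "(\<Sum>i<n. (?c v w $ i)\<^sup>2) = (1 - t) * (\<Sum>i<n. (v $ i)\<^sup>2) + t * (\<Sum>i<n. (w $ i)\<^sup>2) - t * (1 - t) * ?d n v w"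
    if "v \<in> carrier_vec n" "w \<in> carrier_vec n" for v w n
  proof -
    have "(\<Sum>i<n. (?c v w $ i)\<^sup>2) = (\<Sum>i<n. ((1 - t) * v $ i + t * w $ i)\<^sup>2)"
      using that by (intro sum.cong) auto
    then show ?thesis by (simp only: sum_squares_comb)
  qed
  have zc: "decision_comb t z z' = ([?c x x', ?c y y'], [?c u u'], ?c s s')" by (simp add: ze ze')
  have D: "([?c x x', ?c y y'], [?c u u'], ?c s s') \<in> decision_space I"
    unfolding in_decision_space[OF h] using c c' by simp
  have mz: "mpc_cost I z = (\<Sum>i<state_dim I. (x $ i)\<^sup>2) + (\<Sum>i<input_dim I. (u $ i)\<^sup>2) +
      (\<Sum>i<state_dim I. (y $ i)\<^sup>2) + of_rat \<rho> * (\<Sum>i<slack_dim I. (s $ i)\<^sup>2)"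
    unfolding ze by (rule quadratic_cost[OF q z[unfolded ze]])
  have mz': "mpc_cost I z' = (\<Sum>i<state_dim I. (x' $ i)\<^sup>2) + (\<Sum>i<input_dim I. (u' $ i)\<^sup>2) +
      (\<Sum>i<state_dim I. (y' $ i)\<^sup>2) + of_rat \<rho> * (\<Sum>i<slack_dim I. (s' $ i)\<^sup>2)"
    unfolding ze' by (rule quadratic_cost[OF q z'[unfolded ze']])
  have cost: "mpc_cost I (decision_comb t z z') = (1 - t) * mpc_cost I z + t * mpc_cost I z' -
    t * (1 - t) * (?d (state_dim I) x x' + ?d (input_dim I) u u' + ?d (state_dim I) y y' + of_rat \<rho> * ?d (slack_dim I) s s')"
    unfolding zc quadratic_cost[OF q D] comb[OF c(1) c'(1)] comb[OF c(2) c'(2)] comb[OF c(3) c'(3)] comb[OF c(4) c'(4)] mz mz'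
    by (simp add: algebra_simps)
  have nonneg: "0 \<le> ?d n v w" for n v w by (intro sum_nonneg) simp
  have "x \<noteq> x' \<or> y \<noteq> y' \<or> u \<noteq> u' \<or> s \<noteq> s'" using t by (auto simp: ze ze')
  then have "?d (state_dim I) x x' > 0 \<or> ?d (state_dim I) y y' > 0 \<or> ?d (input_dim I) u u' > 0 \<or> ?d (slack_dim I) s s' > 0"
    using vec_diff_pos c c' by blast
  then have "?d (state_dim I) x x' + ?d (input_dim I) u u' + ?d (state_dim I) y y' + of_rat \<rho> * ?d (slack_dim I) s s' > 0"
  proof (elim disjE)
    assume "?d (slack_dim I) s s' > 0"
    then have "of_rat \<rho> * ?d (slack_dim I) s s' > 0" using \<rho> by simp
    then show ?thesis using nonneg[of x x' "state_dim I"] nonneg[of y y' "state_dim I"] nonneg[of u u' "input_dim I"] by linarith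
  qed (use nonneg[of x x' "state_dim I"] nonneg[of y y' "state_dim I"] nonneg[of u u' "input_dim I"]
        mult_nonneg_nonneg[OF less_imp_le[OF \<rho>] nonneg[of s s' "slack_dim I"]] in linarith)+
  then have "t * (1 - t) * (?d (state_dim I) x x' + ?d (input_dim I) u u' + ?d (state_dim I) y y' + of_rat \<rho> * ?d (slack_dim I) s s') > 0"
    using t by simp
  then show "mpc_cost I (decision_comb t z z') < (1 - t) * mpc_cost I z + t * mpc_cost I z'" using cost by linarith
qed

text \<open>The variational inequality of the projection onto \<open>[0, h]\<close>: the correction
  \<open>clip h t - t\<close> is zero or points into the interval.\<close>

lemma proj_le: "0 \<le> y \<Longrightarrow> y \<le> h \<Longrightarrow> 0 \<le> (clip h t - t) * (y - clip h t)"
proof -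
  assume y: "0 \<le> y" "y \<le> h"
  consider "t < 0" | "0 \<le> t" "t \<le> h" | "t > h" by linarith
  then show ?thesis
  proof cases
    case 1
    then have "clip h t = 0" using y by (simp add: clip_def)
    then show ?thesis using 1 y by (simp add: mult_le_0_iff)
  next
    case 3
    then have "clip h t = h" using y by (simp add: clip_def)
    then show ?thesis using 3 y by (simp add: mult_nonpos_nonpos)
  qed (simp add: clip_def)
qed

section \<open>Box systems and the terminal box\<close>

abbreviation box_A :: "nat \<Rightarrow> rat mat" where "box_A k \<equiv> 1\<^sub>m k @\<^sub>r (- 1\<^sub>m k)"
text \<open>All lower bounds are zero; the form \<open>- 0\<^sub>v k\<close> matches
  \<open>box_system\<close> literally.\<close>

abbreviation box_b :: "nat \<Rightarrow> (nat \<Rightarrow> rat) \<Rightarrow> rat vec" where "box_b k h \<equiv> vec k h @\<^sub>v (- 0\<^sub>v k)"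

lemma box_system_box: "(\<And>i. i < k \<Longrightarrow> 0 \<le> h i) \<Longrightarrow> box_system k (box_A k) (box_b k h)"
  unfolding box_system_def by (intro bexI[of _ "0\<^sub>v k"] bexI[of _ "vec k h"]) (auto simp: less_eq_vec_def)

lemma append_rows_index:
  "A \<in> carrier_mat n k \<Longrightarrow> B \<in> carrier_mat m k \<Longrightarrow> j < n + m \<Longrightarrow> c < k \<Longrightarrow>
    (A @\<^sub>r B) $$ (j, c) = (if j < n then A $$ (j, c) else B $$ (j - n, c))"
  by (simp add: append_rows_def)

lemma box_A_mult: "v \<in> carrier_vec k \<Longrightarrow> j < k + k \<Longrightarrow> (rmat (box_A k) *\<^sub>v v) $ j = (if j < k then v $ j else - v $ (j - k))"
proof -
  assume v: "v \<in> carrier_vec k" and j: "j < k + k"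
  have dims: "box_A k \<in> carrier_mat (k + k) k" by (intro carrier_append_rows) auto
  have "(rmat (box_A k) *\<^sub>v v) $ j = (\<Sum>c<k. of_rat (box_A k $$ (j, c)) * v $ c)"
    using dims v j by (rule rmat_mult_index)
  also have "\<dots> = (\<Sum>c<k. if c = (if j < k then j else j - k) then (if j < k then v $ c else - v $ c) else 0)"
    using j by (intro sum.cong) (auto simp: append_rows_index[of _ k k _ k])
  also have "\<dots> = (if j < k then v $ j else - v $ (j - k))" using j by auto
  finally show ?thesis .
qed

lemma soft_E_mult: "s \<in> carrier_vec k \<Longrightarrow> j < k + k \<Longrightarrow> (rmat (1\<^sub>m k @\<^sub>r 1\<^sub>m k) *\<^sub>v s) $ j = (if j < k then s $ j else s $ (j - k))"
proof -
  assume v: "s \<in> carrier_vec k" and j: "j < k + k"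
  have dims: "(1\<^sub>m k @\<^sub>r 1\<^sub>m k :: rat mat) \<in> carrier_mat (k + k) k" by (intro carrier_append_rows) auto
  have "(rmat (1\<^sub>m k @\<^sub>r 1\<^sub>m k) *\<^sub>v s) $ j = (\<Sum>c<k. of_rat ((1\<^sub>m k @\<^sub>r 1\<^sub>m k) $$ (j, c)) * s $ c)"
    using dims v j by (rule rmat_mult_index)
  also have "\<dots> = (\<Sum>c<k. if c = (if j < k then j else j - k) then s $ c else 0)"
    using j by (intro sum.cong) (auto simp: append_rows_index[of _ k k _ k])
  also have "\<dots> = (if j < k then s $ j else s $ (j - k))" using j by auto
  finally show ?thesis .
qed

lemma box_b_index: "j < k + k \<Longrightarrow> rvec (box_b k h) $ j = (if j < k then of_rat (h j) else 0)"
  by simp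

lemma zero_mult: "s \<in> carrier_vec m \<Longrightarrow> j < n \<Longrightarrow> (rmat (0\<^sub>m n m) *\<^sub>v s) $ j = 0"
  by (simp add: scalar_prod_def)

lemma all_less_add: "(\<forall>j<k + k. P j) \<longleftrightarrow> (\<forall>i<k. P i \<and> P (k + i))" for k :: nat
proof (intro iffI allI impI)
  fix j assume *: "\<forall>i<k. P i \<and> P (k + i)" "j < k + k"
  show "P j"
  proof (cases "j < k")
    case False
    then have "j - k < k" "k + (j - k) = j" using *(2) by auto
    then show ?thesis using *(1) by metis
  qed (use * in auto)
qed auto

lemma box_rows:
  assumes v: "v \<in> carrier_vec k"
  shows "(\<forall>j<k + k. (rmat (box_A k) *\<^sub>v v) $ j \<le> rvec (box_b k h) $ j + e j) \<longleftrightarrow>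
    (\<forall>i<k. v $ i \<le> of_rat (h i) + e i \<and> - v $ i \<le> e (k + i))"
proof -
  have "(rmat (box_A k) *\<^sub>v v) $ i = v $ i" "(rmat (box_A k) *\<^sub>v v) $ (k + i) = - v $ i"
    "rvec (box_b k h) $ i = of_rat (h i)" "rvec (box_b k h) $ (k + i) = 0" if "i < k" for i
    using box_A_mult[OF v, of i] box_A_mult[OF v, of "k + i"] box_b_index[of i k h] box_b_index[of "k + i" k h] that
    by simp_all
  then show ?thesis unfolding all_less_add by (metis add_0)
qed

lemma pos_semidef_one: "pos_semidef n (1\<^sub>m n)"
  by (auto simp: pos_semidef_def rmat_one transpose_one scalar_prod_self sum_nonneg)

lemma pos_def_smult: "\<rho> > 0 \<Longrightarrow> pos_def n (\<rho> \<cdot>\<^sub>m 1\<^sub>m n)"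
  unfolding pos_def_def
proof (intro conjI ballI impI)
  show "(\<rho> \<cdot>\<^sub>m 1\<^sub>m n)\<^sup>T = \<rho> \<cdot>\<^sub>m 1\<^sub>m n" by (rule eq_matI) auto
  fix v :: "real vec" assume \<rho>: "\<rho> > 0" and v: "v \<in> carrier_vec n" "v \<noteq> 0\<^sub>v n"
  have "v \<bullet> (rmat (\<rho> \<cdot>\<^sub>m 1\<^sub>m n) *\<^sub>v v) = of_rat \<rho> * (\<Sum>i<n. (v $ i - 0\<^sub>v n $ i)\<^sup>2)"
    unfolding rmat_smult_one smult_one_mult_vec[OF v(1)] using v by (simp add: scalar_prod_self)
  then show "v \<bullet> (rmat (\<rho> \<cdot>\<^sub>m 1\<^sub>m n) *\<^sub>v v) > 0" using vec_diff_pos[OF v(1) _ v(2)] \<rho> by simp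
qed simp

lemma pos_def_one: "pos_def n (1\<^sub>m n)"
proof -
  have "1 \<cdot>\<^sub>m 1\<^sub>m n = (1\<^sub>m n :: rat mat)" by (rule eq_matI) auto
  then show ?thesis using pos_def_smult[of 1 n] by simp
qed

lemma abs_sum_le:
  fixes i k :: nat
  assumes "i < k" "\<And>j. j < k \<Longrightarrow> \<bar>v j\<bar> \<le> B" "0 \<le> B"
  shows "\<bar>\<Sum>j<k. of_rat (A i j) * v j\<bar> \<le> (\<Sum>i<k. \<Sum>j<k. \<bar>of_rat (A i j)\<bar>) * (B :: real)"
proof -
  have "\<bar>\<Sum>j<k. of_rat (A i j) * v j\<bar> \<le> (\<Sum>j<k. \<bar>of_rat (A i j) * v j\<bar>)" by (rule sum_abs)
  also have "\<dots> \<le> (\<Sum>j<k. \<bar>of_rat (A i j)\<bar> * B)"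
    unfolding abs_mult using assms by (intro sum_mono mult_left_mono) auto
  also have "\<dots> = (\<Sum>j<k. \<bar>of_rat (A i j)\<bar>) * B" by (simp add: sum_distrib_right)
  also have "\<dots> \<le> (\<Sum>i<k. \<Sum>j<k. \<bar>of_rat (A i j)\<bar>) * B"
  proof (rule mult_right_mono)
    show "(\<Sum>j<k. \<bar>of_rat (A i j) :: real\<bar>) \<le> (\<Sum>i<k. \<Sum>j<k. \<bar>of_rat (A i j)\<bar>)"
      using assms(1) by (intro member_le_sum[of i "{..<k}" "\<lambda>i. \<Sum>j<k. \<bar>of_rat (A i j) :: real\<bar>"]) (simp_all add: sum_nonneg)
  qed (rule assms(3))
  finally show ?thesis .
qed

text \<open>Let \<open>t = A x\<close> and let \<open>y\<close> be the predicted state, so that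
  \<open>u = y - 2 * t\<close>. In each coordinate
  \<open>u^2 + y^2 = 2 * (y - t)^2 + 2 * t^2\<close>, so the best \<open>y\<close> in the box is the
  projection of \<open>A x\<close>. This explains the factor \<open>2\<close> in
  \<open>plant_F\<close>. As \<open>plant_G\<close> is the identity, every point of the box is
  reachable from every state.\<close>

definition terminal_mpc :: "nat \<Rightarrow> (nat \<Rightarrow> nat \<Rightarrow> rat) \<Rightarrow> (nat \<Rightarrow> rat) \<Rightarrow> mpc" where
  "terminal_mpc k A h = \<lparr>state_dim = k, input_dim = k, slack_dim = 0, horizon = 1,
     plant_F = mat k k (\<lambda>(i, j). 2 * A i j), plant_G = 1\<^sub>m k,
     weight_Q = 1\<^sub>m k, weight_R = 1\<^sub>m k, weight_P = 1\<^sub>m k,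
     stage_Hx = 0\<^sub>m 0 k, stage_Hu = 0\<^sub>m 0 k, stage_h = 0\<^sub>v 0,
     term_H = box_A k, term_h = box_b k h,
     slack_E = 0\<^sub>m (k + k) 0, slack_W = 1 \<cdot>\<^sub>m 1\<^sub>m 0\<rparr>"

locale terminal_box =
  fixes k :: nat and A :: "nat \<Rightarrow> nat \<Rightarrow> rat" and h :: "nat \<Rightarrow> rat"
  assumes k: "k \<ge> 1" and h: "\<And>i. i < k \<Longrightarrow> 0 \<le> h i"
begin

abbreviation "I \<equiv> terminal_mpc k A h"

lemma sel: "state_dim I = k" "input_dim I = k" "slack_dim I = 0" "horizon I = 1" "plant_G I = 1\<^sub>m k"
  "plant_F I = mat k k (\<lambda>(i, j). 2 * A i j)" "stage_h I = 0\<^sub>v 0" "term_H I = box_A k" "term_h I = box_b k h"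
  "slack_E I = 0\<^sub>m (k + k) 0"
  by (simp_all add: terminal_mpc_def)

lemma F_carrier: "plant_F I \<in> carrier_mat k k" "rmat (plant_F I) \<in> carrier_mat k k"
  by (simp_all add: sel)

lemma quadratic: "quadratic I 1"
  by (simp add: quadratic_def unit_weights_def terminal_mpc_def)

lemma in_class: "I \<in> terminal_box_class"
proof -
  have b: "box_A k \<in> carrier_mat (k + k) k" by (intro carrier_append_rows) auto
  have h': "0\<^sub>v (k + k) \<le> box_b k h" using h by (auto simp: less_eq_vec_def)
  show ?thesis
    using b h' k pos_def_smult[of 1 0] pos_def_one box_system_box[of k h] h
    by (simp add: terminal_box_class_def mpc_instance_def terminal_mpc_def unit_weights_def pos_semidef_one)
qed

lemma feasible_iff:
  assumes x: "x \<in> carrier_vec k"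
  shows "mpc_feasible I x z \<longleftrightarrow> (\<exists>y\<in>carrier_vec k. (\<forall>i<k. 0 \<le> y $ i \<and> y $ i \<le> of_rat (h i)) \<and>
    z = ([x, y], [y - rmat (plant_F I) *\<^sub>v x], 0\<^sub>v 0))"
proof -
  let ?F = "rmat (plant_F I)"
  have F: "?F *\<^sub>v x \<in> carrier_vec k" using F_carrier(2) x by (rule mult_mat_vec_carrier)
  have box: "(\<forall>j<k + k. (rmat (box_A k) *\<^sub>v y) $ j \<le> rvec (box_b k h) $ j + (rmat (0\<^sub>m (k + k) 0) *\<^sub>v s) $ j)
      \<longleftrightarrow> (\<forall>i<k. 0 \<le> y $ i \<and> y $ i \<le> of_rat (h i))" if "y \<in> carrier_vec k" "s \<in> carrier_vec 0" for y s
  proof -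
    have "(rmat (0\<^sub>m (k + k) 0) *\<^sub>v s) $ i = 0" if "i < k + k" for i by (rule zero_mult) fact+
    then show ?thesis unfolding box_rows[OF that(1)] by auto
  qed
  have con: "mpc_constraints I x ([x', y], [u], s) \<longleftrightarrow> x' = x \<and> y = ?F *\<^sub>v x + u \<and>
      (\<forall>i<k. 0 \<le> y $ i \<and> y $ i \<le> of_rat (h i))" if "y \<in> carrier_vec k" "u \<in> carrier_vec k" "s \<in> carrier_vec 0" for x' y u s
  proof -
    have "rmat (plant_G I) *\<^sub>v u = u" unfolding sel rmat_one using that(2) by simp
    moreover have "stage_rows I = 0" "term_rows I = k + k" by (simp_all add: sel)
    moreover have "0\<^sub>v 0 \<le> s" using that(3) by (simp add: less_eq_vec_def)
    ultimately show ?thesis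
      unfolding constraints_one_step[OF sel(4)] sel(3) using box[OF that(1,3)] by (auto simp: sel(8-10) simp del: index_map_vec)
  qed
  show ?thesis
  proof
    assume z: "mpc_feasible I x z"
    then have "z \<in> decision_space I" unfolding mpc_feasible_def by blast
    then obtain x' y u s where ze: "z = ([x', y], [u], s)" and c: "y \<in> carrier_vec k" "u \<in> carrier_vec k" "s \<in> carrier_vec 0"
      using decision_cases[OF sel(4)] unfolding sel(1-3) by metis
    have *: "x' = x" "y = ?F *\<^sub>v x + u" "\<forall>i<k. 0 \<le> y $ i \<and> y $ i \<le> of_rat (h i)"
      using z con[OF c] unfolding mpc_feasible_def ze by blast+
    have "u = y - ?F *\<^sub>v x" using *(2) vec_diff_add[OF F c(2)] by simp
    moreover have "s = 0\<^sub>v 0" using c(3) by (intro eq_vecI) auto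
    ultimately show "\<exists>y\<in>carrier_vec k. (\<forall>i<k. 0 \<le> y $ i \<and> y $ i \<le> of_rat (h i)) \<and>
        z = ([x, y], [y - ?F *\<^sub>v x], 0\<^sub>v 0)" using ze c(1) *(1,3) by (intro bexI[of _ y]) simp_all
  next
    assume "\<exists>y\<in>carrier_vec k. (\<forall>i<k. 0 \<le> y $ i \<and> y $ i \<le> of_rat (h i)) \<and>
        z = ([x, y], [y - ?F *\<^sub>v x], 0\<^sub>v 0)"
    then obtain y where y: "y \<in> carrier_vec k" "\<forall>i<k. 0 \<le> y $ i \<and> y $ i \<le> of_rat (h i)" "z = ([x, y], [y - ?F *\<^sub>v x], 0\<^sub>v 0)" by blast
    have u: "y - ?F *\<^sub>v x \<in> carrier_vec k" by (rule minus_carrier_vec[OF y(1) F])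
    show "mpc_feasible I x z"
      unfolding mpc_feasible_def y(3) in_decision_space[OF sel(4)] con[OF y(1) u zero_carrier_vec]
      using x y(1,2) u vec_add_diff[OF F y(1)] by (simp add: sel(1-3))
  qed
qed

definition opt :: "real vec \<Rightarrow> real vec" where
  "opt x = vec k (\<lambda>i. clip (of_rat (h i)) (\<Sum>j<k. of_rat (A i j) * x $ j))"

lemma opt_carrier: "opt x \<in> carrier_vec k"
  by (simp add: opt_def)

lemma optimizer_iff:
  assumes x: "x \<in> carrier_vec k"
  shows "mpc_optimizer I x z \<longleftrightarrow> z = ([x, opt x], [opt x - rmat (plant_F I) *\<^sub>v x], 0\<^sub>v 0)"
proof (rule mpc_optimizer_unique)
  let ?F = "rmat (plant_F I)"
  let ?z = "([x, opt x], [opt x - ?F *\<^sub>v x], 0\<^sub>v 0)"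
  define t where "t i = (\<Sum>j<k. of_rat (A i j) * x $ j)" for i
  have Fx: "(?F *\<^sub>v x) $ i = 2 * t i" if "i < k" for i
    unfolding rmat_mult_index[OF F_carrier(1) x that] t_def using that
    by (simp add: sel of_rat_mult sum_distrib_left mult.assoc)
  have F: "?F *\<^sub>v x \<in> carrier_vec k" using F_carrier(2) x by (rule mult_mat_vec_carrier)
  show feas: "mpc_feasible I x ?z"
    unfolding feasible_iff[OF x] using h by (intro bexI[of _ "opt x"]) (auto simp: opt_def)
  fix z assume z: "mpc_feasible I x z" "z \<noteq> ?z"
  then obtain y where y: "y \<in> carrier_vec k" "\<forall>i<k. 0 \<le> y $ i \<and> y $ i \<le> of_rat (h i)" "z = ([x, y], [y - ?F *\<^sub>v x], 0\<^sub>v 0)"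
    unfolding feasible_iff[OF x] by blast
  have cost: "mpc_cost I ([x, y], [y - ?F *\<^sub>v x], 0\<^sub>v 0) = (\<Sum>i<k. (x $ i)\<^sup>2) + ((\<Sum>i<k. (y $ i - 2 * t i)\<^sup>2 + (y $ i)\<^sup>2))"
    if "y \<in> carrier_vec k" for y
  proof -
    have D: "([x, y], [y - ?F *\<^sub>v x], 0\<^sub>v 0) \<in> decision_space I"
      unfolding in_decision_space[OF sel(4)] sel(1-3) using x that minus_carrier_vec[OF that F] zero_carrier_vec by blast
    have "(\<Sum>i<k. ((y - ?F *\<^sub>v x) $ i)\<^sup>2) = (\<Sum>i<k. (y $ i - 2 * t i)\<^sup>2)"
      using F by (intro sum.cong) (simp_all add: vec_diff_index Fx)
    then show ?thesis unfolding quadratic_cost[OF quadratic D] sel(1-3) by (simp add: sum.distrib)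
  qed
  have "y \<noteq> opt x" using z y by auto
  then have "0 < (\<Sum>i<k. (y $ i - opt x $ i)\<^sup>2)" using vec_diff_pos y opt_carrier by blast
  also have "\<dots> \<le> (\<Sum>i<k. ((y $ i - 2 * t i)\<^sup>2 + (y $ i)\<^sup>2) - ((opt x $ i - 2 * t i)\<^sup>2 + (opt x $ i)\<^sup>2))"
  proof (rule sum_mono)
    fix i assume i: "i \<in> {..<k}"
    then have o: "opt x $ i = clip (of_rat (h i)) (t i)" by (simp add: opt_def t_def)
    have "0 \<le> (opt x $ i - t i) * (y $ i - opt x $ i)" unfolding o using y i by (intro proj_le) auto
    \<comment> \<open>An exact expansion at the optimizer; its linear term is nonnegative by the
      projection inequality.\<close>
    moreover have "((y $ i - 2 * t i)\<^sup>2 + (y $ i)\<^sup>2) - ((opt x $ i - 2 * t i)\<^sup>2 + (opt x $ i)\<^sup>2) =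
      2 * (y $ i - opt x $ i)\<^sup>2 + 4 * ((opt x $ i - t i) * (y $ i - opt x $ i))"
      by (simp add: power2_eq_square algebra_simps)
    ultimately show "(y $ i - opt x $ i)\<^sup>2 \<le> ((y $ i - 2 * t i)\<^sup>2 + (y $ i)\<^sup>2) - ((opt x $ i - 2 * t i)\<^sup>2 + (opt x $ i)\<^sup>2)"
      using zero_le_power2[of "y $ i - opt x $ i"] by linarith
  qed
  finally show "mpc_cost I ?z < mpc_cost I z"
    unfolding y(3) cost[OF y(1)] cost[OF opt_carrier] by (simp add: sum_subtractf)
qed

lemma closed_loop: "x \<in> carrier_vec k \<Longrightarrow> closed_loop I x = opt x"
proof -
  assume x: "x \<in> carrier_vec k"
  have F: "rmat (plant_F I) *\<^sub>v x \<in> carrier_vec k" using F_carrier(2) x by (rule mult_mat_vec_carrier)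
  have "mpc_law I x = opt x - rmat (plant_F I) *\<^sub>v x"
    using mpc_law_unique[OF optimizer_iff[OF x]] by simp
  moreover have "rmat (plant_G I) *\<^sub>v (opt x - rmat (plant_F I) *\<^sub>v x) = opt x - rmat (plant_F I) *\<^sub>v x"
    unfolding sel(5) rmat_one by (rule one_mult_mat_vec[OF minus_carrier_vec[OF opt_carrier F]])
  ultimately show ?thesis using vec_add_diff[OF F opt_carrier] by (simp add: closed_loop_def)
qed

lemma feasible_set: "feasible_set I = carrier_vec k"
  using optimizer_iff unfolding feasible_set_def mpc_optimizer_def is_arg_min_def sel(1) by blast

lemma regular: "I \<in> regular_instances"
proof -
  have "\<exists>!z. mpc_optimizer I x z" if "x \<in> carrier_vec k" for x
    unfolding optimizer_iff[OF that] by simp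
  then show ?thesis using quadratic_strictly_convex[OF quadratic] feasible_set
    by (simp add: regular_instances_def sel(1))
qed

sublocale sat_readout I k k A "\<lambda>i. of_rat (h i)" "\<lambda>x i. x $ i" "1 + (\<Sum>i<k. \<Sum>j<k. \<bar>of_rat (A i j)\<bar>)"
proof unfold_locales
  let ?S = "\<Sum>i<k. \<Sum>j<k. \<bar>of_rat (A i j) :: real\<bar>"
  have S: "0 \<le> ?S" by (intro sum_nonneg) auto
  then show "0 \<le> 1 + ?S" by simp
  show "closed_loop I x \<in> carrier_vec k" if "x \<in> carrier_vec k" for x using that by (simp add: closed_loop opt_carrier)
  show "closed_loop I x $ i = clip (of_rat (h i)) (\<Sum>j<k. of_rat (A i j) * x $ j)" if "x \<in> carrier_vec k" "i < k" for x i
    using that by (simp add: closed_loop opt_def)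
  show "\<bar>closed_loop I x $ r\<bar> \<le> (1 + ?S) * B"
    if "x \<in> carrier_vec k" "0 \<le> B" "\<And>i. i < k \<Longrightarrow> \<bar>x $ i\<bar> \<le> B" "r < k" for x B r
  proof -
    have "\<bar>closed_loop I x $ r\<bar> \<le> \<bar>\<Sum>j<k. of_rat (A r j) * x $ j\<bar>"
    proof -
      have "closed_loop I x $ r = clip (of_rat (h r)) (\<Sum>j<k. of_rat (A r j) * x $ j)"
        using that by (simp add: closed_loop opt_def)
      then show ?thesis using abs_clip_le[of "of_rat (h r)"] h[OF that(4)] by (simp only:) simp
    qed
    also have "\<dots> \<le> ?S * B" using that by (intro abs_sum_le) auto
    also have "\<dots> \<le> (1 + ?S) * B" using that by (intro mult_right_mono) auto
    finally show ?thesis .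
  qed
  show "\<bar>x $ i\<bar> \<le> (1 + ?S) * B" if "x \<in> carrier_vec k" "\<And>r. r < k \<Longrightarrow> \<bar>x $ r\<bar> \<le> B" "i < k" for x B i
  proof -
    have B: "\<bar>x $ i\<bar> \<le> 1 * B" "0 \<le> B" using that(2)[OF that(3)] by auto
    have "1 * B \<le> (1 + ?S) * B" using S B(2) by (intro mult_right_mono) auto
    with B(1) show ?thesis by linarith
  qed
  show "\<exists>x\<in>carrier_vec k. \<forall>i<k. x $ i = u i" for u :: "nat \<Rightarrow> real"
    by (intro bexI[of _ "vec k u"]) auto
qed (simp_all add: sel feasible_set)

end

section \<open>Hard and softened boxes on the input\<close>

lemma sum_lessThan_add: "(\<Sum>c<k + m. f c) = (\<Sum>c<k. f c) + (\<Sum>c<m. f (k + c))" for f :: "nat \<Rightarrow> real"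
  by (induction m) (simp_all add: add.assoc)

text \<open>\<open>l = 0\<close> is the hard box and \<open>l = k\<close> the softened one; both
  belong to one family of instances.\<close>

definition slack_rows :: "nat \<Rightarrow> nat \<Rightarrow> rat mat" where
  "slack_rows k l = (if l = 0 then 0\<^sub>m (k + k) 0 else 1\<^sub>m k @\<^sub>r 1\<^sub>m k)"

text \<open>
  The second half of the state keeps the predicted state before the input is added. For \<open>p\<close> and \<open>q\<close>
  chosen according to the slack penalty, \<open>p * x $ i - q * x $ (k + i)\<close> is then a clipped linear function
  although the softened optimizer itself is not.
\<close>

definition input_mpc :: "nat \<Rightarrow> (nat \<Rightarrow> nat \<Rightarrow> rat) \<Rightarrow> (nat \<Rightarrow> rat) \<Rightarrow> rat \<Rightarrow> rat \<Rightarrow> nat \<Rightarrow> rat \<Rightarrow> mpc" where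
  "input_mpc k A h p q l \<rho> = \<lparr>state_dim = k + k, input_dim = k, slack_dim = l, horizon = 1,
     plant_F = mat (k + k) (k + k) (\<lambda>(r, c).
       if c < k then - 2 * A (r mod k) c * p else 2 * A (r mod k) (c - k) * q),
     plant_G = mat (k + k) k (\<lambda>(r, c). if r = c then 1 else 0),
     weight_Q = 1\<^sub>m (k + k), weight_R = 1\<^sub>m k, weight_P = 1\<^sub>m (k + k),
     stage_Hx = 0\<^sub>m (k + k) (k + k), stage_Hu = box_A k, stage_h = box_b k h,
     term_H = 0\<^sub>m 0 (k + k), term_h = 0\<^sub>v 0,
     slack_E = slack_rows k l, slack_W = \<rho> \<cdot>\<^sub>m 1\<^sub>m l\<rparr>"

text \<open>The problem decouples into scalar ones: minimize
  \<open>u^2 + (u - 2 * t)^2 + \<rho> * s^2\<close> over the possibly softened interval, with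
  solution \<open>U b t\<close>, \<open>S b t\<close>. \<open>variational\<close> is the first-order
  condition, the partial derivatives being \<open>4 * (u - t)\<close> and
  \<open>2 * \<rho> * s\<close>. The next state holds \<open>U b t - 2 * t\<close> and
  \<open>- 2 * t\<close> in its two halves; \<open>U_clip\<close> says that their combination with
  \<open>p\<close> and \<open>- q\<close> is the clipped value.\<close>

locale input_box =
  fixes k :: nat and A :: "nat \<Rightarrow> nat \<Rightarrow> rat" and h :: "nat \<Rightarrow> rat" and p q :: rat and l :: nat and \<rho> :: rat
    and U S :: "real \<Rightarrow> real \<Rightarrow> real"
  assumes k: "k \<ge> 1" and h: "\<And>i. i < k \<Longrightarrow> 0 \<le> h i" and p: "p > 0" and \<rho>: "\<rho> > 0" and l: "l = 0 \<or> l = k"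
    and U_box: "\<And>b t. 0 \<le> b \<Longrightarrow> 0 \<le> S b t \<and> - S b t \<le> U b t \<and> U b t \<le> b + S b t"
    and hard: "\<And>b t. l = 0 \<Longrightarrow> S b t = 0"
    and variational: "\<And>b t u s. 0 \<le> b \<Longrightarrow> 0 \<le> s \<Longrightarrow> - s \<le> u \<Longrightarrow> u \<le> b + s \<Longrightarrow> (l = 0 \<Longrightarrow> s = 0) \<Longrightarrow>
      0 \<le> 4 * (U b t - t) * (u - U b t) + 2 * of_rat \<rho> * S b t * (s - S b t)"
    and U_le: "\<And>b t. 0 \<le> b \<Longrightarrow> \<bar>U b t\<bar> \<le> \<bar>t\<bar>"
    and U_clip: "\<And>b t. 0 \<le> b \<Longrightarrow> of_rat p * (U b t - 2 * t) + 2 * of_rat q * t = clip b t"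
begin

abbreviation "I \<equiv> input_mpc k A h p q l \<rho>"
abbreviation "F \<equiv> rmat (plant_F I)"
abbreviation "G \<equiv> rmat (plant_G I)"

lemma sel: "state_dim I = k + k" "input_dim I = k" "slack_dim I = l" "horizon I = 1"
  "stage_Hx I = 0\<^sub>m (k + k) (k + k)" "stage_Hu I = box_A k" "stage_h I = box_b k h"
  "term_h I = 0\<^sub>v 0" "slack_E I = slack_rows k l"
  by (simp_all add: input_mpc_def)

lemma F_carrier: "plant_F I \<in> carrier_mat (k + k) (k + k)" "F \<in> carrier_mat (k + k) (k + k)"
  and G_carrier: "plant_G I \<in> carrier_mat (k + k) k" "G \<in> carrier_mat (k + k) k"
  by (simp_all add: input_mpc_def)

lemma quadratic: "quadratic I \<rho>"
  using \<rho> by (simp add: quadratic_def unit_weights_def input_mpc_def)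

lemma mpc_instance: "mpc_instance I"
proof -
  have "box_A k \<in> carrier_mat (k + k) k" by (intro carrier_append_rows) auto
  moreover have "slack_rows k l \<in> carrier_mat (k + k) l"
    using l by (auto simp: slack_rows_def intro!: carrier_append_rows)
  moreover have "0\<^sub>v (k + k) \<le> box_b k h" using h by (auto simp: less_eq_vec_def)
  ultimately show ?thesis
    using k pos_def_smult[OF \<rho>] pos_def_one
    by (simp add: mpc_instance_def input_mpc_def pos_semidef_one)
qed

lemma in_input_box_class: "l = 0 \<Longrightarrow> I \<in> input_box_class"
  using mpc_instance box_system_box[of k h] h
  by (simp add: input_box_class_def input_mpc_def unit_weights_def)

lemma in_soft_input_box_class: "l = k \<Longrightarrow> I \<in> soft_input_box_class \<rho>"
  using mpc_instance box_system_box[of k h] h k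
  by (simp add: soft_input_box_class_def input_mpc_def unit_weights_def slack_rows_def)

definition readout :: "real vec \<Rightarrow> nat \<Rightarrow> real" where
  "readout x i = of_rat p * x $ i - of_rat q * x $ (k + i)"

definition drive :: "real vec \<Rightarrow> nat \<Rightarrow> real" where
  "drive x i = (\<Sum>j<k. of_rat (A i j) * readout x j)"

lemma F_index:
  assumes x: "x \<in> carrier_vec (k + k)" and r: "r < k + k"
  shows "(F *\<^sub>v x) $ r = - 2 * drive x (r mod k)"
proof -
  have "(F *\<^sub>v x) $ r = (\<Sum>c<k + k. of_rat (plant_F I $$ (r, c)) * x $ c)"
    by (rule rmat_mult_index[OF F_carrier(1) x r])
  also have "\<dots> = (\<Sum>c<k. of_rat (plant_F I $$ (r, c)) * x $ c) + (\<Sum>c<k. of_rat (plant_F I $$ (r, k + c)) * x $ (k + c))"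
    by (rule sum_lessThan_add)
  also have "\<dots> = (\<Sum>c<k. - 2 * of_rat (A (r mod k) c) * of_rat p * x $ c) + (\<Sum>c<k. 2 * of_rat (A (r mod k) c) * of_rat q * x $ (k + c))"
    using r by (intro arg_cong2[where f = plus] sum.cong) (simp_all add: input_mpc_def of_rat_mult of_rat_minus)
  also have "\<dots> = (\<Sum>c<k. - 2 * (of_rat (A (r mod k) c) * readout x c))"
    unfolding sum.distrib[symmetric] by (intro sum.cong) (simp_all add: readout_def algebra_simps)
  finally show ?thesis by (simp add: drive_def sum_distrib_left)
qed

lemma G_index:
  assumes u: "u \<in> carrier_vec k" and r: "r < k + k"
  shows "(G *\<^sub>v u) $ r = (if r < k then u $ r else 0)"
proof -
  have "(G *\<^sub>v u) $ r = (\<Sum>c<k. of_rat (plant_G I $$ (r, c)) * u $ c)"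
    by (rule rmat_mult_index[OF G_carrier(1) u r])
  also have "\<dots> = (\<Sum>c<k. if c = r then u $ c else 0)"
    using r by (intro sum.cong) (simp_all add: input_mpc_def)
  finally show ?thesis by simp
qed

abbreviation "next_state x u \<equiv> F *\<^sub>v x + G *\<^sub>v u"

lemma next_state_carrier:
  "x \<in> carrier_vec (k + k) \<Longrightarrow> u \<in> carrier_vec k \<Longrightarrow> next_state x u \<in> carrier_vec (k + k)"
  by (rule add_carrier_vec[OF mult_mat_vec_carrier[OF F_carrier(2)] mult_mat_vec_carrier[OF G_carrier(2)]])

lemma next_state_index:
  assumes "x \<in> carrier_vec (k + k)" "u \<in> carrier_vec k" "i < k"
  shows "next_state x u $ i = u $ i - 2 * drive x i" "next_state x u $ (k + i) = - 2 * drive x i"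
proof -
  have "next_state x u $ r = (F *\<^sub>v x) $ r + (G *\<^sub>v u) $ r" if "r < k + k" for r
    using that carrier_vecD[OF mult_mat_vec_carrier[OF G_carrier(2) assms(2)]] by (intro index_add_vec(1)) simp
  note * = this[of i] this[of "k + i"]
  show "next_state x u $ i = u $ i - 2 * drive x i" "next_state x u $ (k + i) = - 2 * drive x i"
    using * F_index[OF assms(1), of i] F_index[OF assms(1), of "k + i"] G_index[OF assms(2), of i] G_index[OF assms(2), of "k + i"] assms(3)
    by simp_all
qed

definition slack :: "real vec \<Rightarrow> nat \<Rightarrow> real" where
  "slack s i = (if i < l then s $ i else 0)"

definition admissible :: "real vec \<Rightarrow> real vec \<Rightarrow> bool" where
  "admissible u s \<longleftrightarrow> u \<in> carrier_vec k \<and> s \<in> carrier_vec l \<and>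
    (\<forall>i<k. 0 \<le> slack s i \<and> - slack s i \<le> u $ i \<and> u $ i \<le> of_rat (h i) + slack s i)"

lemma slack_rows_mult:
  assumes s: "s \<in> carrier_vec l" and j: "j < k + k"
  shows "(rmat (slack_rows k l) *\<^sub>v s) $ j = slack s (if j < k then j else j - k)"
proof (cases "l = 0")
  case True
  then show ?thesis using zero_mult[of s 0 j "k + k"] s j unfolding slack_rows_def slack_def by simp
next
  case False
  then show ?thesis using l soft_E_mult[of s k j] s j unfolding slack_rows_def slack_def by auto
qed

lemma constraints_iff:
  assumes x: "x' \<in> carrier_vec (k + k)" and u: "u \<in> carrier_vec k" and s: "s \<in> carrier_vec l"
  shows "mpc_constraints I x ([x', y], [u], s) \<longleftrightarrow> x' = x \<and> y = next_state x' u \<and> admissible u s"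
proof -
  let ?e = "\<lambda>j. (rmat (slack_rows k l) *\<^sub>v s) $ j"
  have Hx: "(rmat (0\<^sub>m (k + k) (k + k)) *\<^sub>v x' + rmat (box_A k) *\<^sub>v u) $ j = (rmat (box_A k) *\<^sub>v u) $ j" if "j < k + k" for j
  proof -
    have "dim_vec (rmat (box_A k) *\<^sub>v u) = k + k" by (simp add: append_rows_def)
    then have "(rmat (0\<^sub>m (k + k) (k + k)) *\<^sub>v x' + rmat (box_A k) *\<^sub>v u) $ j = (rmat (0\<^sub>m (k + k) (k + k)) *\<^sub>v x') $ j + (rmat (box_A k) *\<^sub>v u) $ j"
      using that by (intro index_add_vec(1)) simp
    then show ?thesis using zero_mult[OF x that] by simp
  qed
  have rows: "stage_rows I = k + k" "term_rows I = 0" by (simp_all add: sel)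
  have e: "?e i = slack s i" "?e (k + i) = slack s i" if "i < k" for i
    using slack_rows_mult[OF s, of i] slack_rows_mult[OF s, of "k + i"] that by simp_all
  have "(\<forall>j<k + k. (rmat (0\<^sub>m (k + k) (k + k)) *\<^sub>v x' + rmat (box_A k) *\<^sub>v u) $ j \<le> rvec (box_b k h) $ j + ?e j)
      \<longleftrightarrow> (\<forall>j<k + k. (rmat (box_A k) *\<^sub>v u) $ j \<le> rvec (box_b k h) $ j + ?e j)"
    using Hx by (metis (no_types, lifting))
  also have "\<dots> \<longleftrightarrow> (\<forall>i<k. u $ i \<le> of_rat (h i) + slack s i \<and> - u $ i \<le> slack s i)"
    unfolding box_rows[OF u] using e by (metis (no_types, lifting))
  finally have stage: "(\<forall>j<k + k. (rmat (0\<^sub>m (k + k) (k + k)) *\<^sub>v x' + rmat (box_A k) *\<^sub>v u) $ j \<le> rvec (box_b k h) $ j + ?e j)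
      \<longleftrightarrow> (\<forall>i<k. u $ i \<le> of_rat (h i) + slack s i \<and> - u $ i \<le> slack s i)" .
  have nonneg: "0\<^sub>v l \<le> s \<longleftrightarrow> (\<forall>i<k. 0 \<le> slack s i)"
    using s l by (auto simp: less_eq_vec_def slack_def)
  have "(- slack s i \<le> u $ i) = (- u $ i \<le> slack s i)" for i by linarith
  then have adm: "admissible u s \<longleftrightarrow> (\<forall>i<k. u $ i \<le> of_rat (h i) + slack s i \<and> - u $ i \<le> slack s i) \<and> (\<forall>i<k. 0 \<le> slack s i)"
    unfolding admissible_def using u s by auto
  show ?thesis
    unfolding constraints_one_step[OF sel(4)] unfolding rows
    unfolding sel(3,5,6,7,9) unfolding stage nonneg adm by simp
qed

lemma feasible_iff:
  assumes x: "x \<in> carrier_vec (k + k)"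
  shows "mpc_feasible I x z \<longleftrightarrow> (\<exists>u s. admissible u s \<and> z = ([x, next_state x u], [u], s))"
proof
  assume z: "mpc_feasible I x z"
  then have "z \<in> decision_space I" unfolding mpc_feasible_def by blast
  then obtain x' y u s where ze: "z = ([x', y], [u], s)" and c: "x' \<in> carrier_vec (k + k)" "u \<in> carrier_vec k" "s \<in> carrier_vec l"
    using decision_cases[OF sel(4)] unfolding sel(1-3) by metis
  have "x' = x \<and> y = next_state x' u \<and> admissible u s"
    using z constraints_iff[OF c] unfolding mpc_feasible_def ze by blast
  then show "\<exists>u s. admissible u s \<and> z = ([x, next_state x u], [u], s)" unfolding ze by blast
next
  assume "\<exists>u s. admissible u s \<and> z = ([x, next_state x u], [u], s)"
  then obtain u s where a: "admissible u s" and z: "z = ([x, next_state x u], [u], s)" by blast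
  have c: "u \<in> carrier_vec k" "s \<in> carrier_vec l" using a unfolding admissible_def by blast+
  show "mpc_feasible I x z"
    unfolding mpc_feasible_def z in_decision_space[OF sel(4)] constraints_iff[OF x c] sel(1-3)
    using a x c next_state_carrier[OF x c(1)] by blast
qed

definition opt_u :: "real vec \<Rightarrow> real vec" where
  "opt_u x = vec k (\<lambda>i. U (of_rat (h i)) (drive x i))"

definition opt_s :: "real vec \<Rightarrow> real vec" where
  "opt_s x = vec l (\<lambda>i. S (of_rat (h i)) (drive x i))"

lemma opt_index: "i < k \<Longrightarrow> opt_u x $ i = U (of_rat (h i)) (drive x i)"
  "i < k \<Longrightarrow> slack (opt_s x) i = S (of_rat (h i)) (drive x i)"
  using l hard by (auto simp: opt_u_def opt_s_def slack_def)

lemma h_real: "i < k \<Longrightarrow> (0::real) \<le> of_rat (h i)"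
  using h by simp

lemma opt_admissible: "admissible (opt_u x) (opt_s x)"
proof -
  have "0 \<le> slack (opt_s x) i \<and> - slack (opt_s x) i \<le> opt_u x $ i \<and> opt_u x $ i \<le> of_rat (h i) + slack (opt_s x) i" if "i < k" for i
    unfolding opt_index[OF that] using U_box[OF h_real[OF that]] .
  then show ?thesis unfolding admissible_def by (simp add: opt_u_def opt_s_def)
qed

lemma cost:
  assumes x: "x \<in> carrier_vec (k + k)" and u: "u \<in> carrier_vec k" and s: "s \<in> carrier_vec l"
  shows "mpc_cost I ([x, next_state x u], [u], s) = (\<Sum>i<k + k. (x $ i)\<^sup>2) + (\<Sum>i<k. (2 * drive x i)\<^sup>2) +
    (\<Sum>i<k. (u $ i)\<^sup>2 + (u $ i - 2 * drive x i)\<^sup>2 + of_rat \<rho> * (slack s i)\<^sup>2)"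
proof -
  have D: "([x, next_state x u], [u], s) \<in> decision_space I"
    unfolding in_decision_space[OF sel(4)] sel(1-3) using x u s next_state_carrier[OF x u] by blast
  have "(\<Sum>i<k + k. (next_state x u $ i)\<^sup>2) = (\<Sum>i<k. (u $ i - 2 * drive x i)\<^sup>2) + (\<Sum>i<k. (2 * drive x i)\<^sup>2)"
    unfolding sum_lessThan_add using next_state_index[OF x u] by simp
  moreover have "(\<Sum>i<l. (s $ i)\<^sup>2) = (\<Sum>i<k. (slack s i)\<^sup>2)"
    using l by (auto simp: slack_def)
  ultimately show ?thesis
    unfolding quadratic_cost[OF quadratic D] sel(1-3) by (simp add: sum.distrib sum_distrib_left)
qed

lemma optimizer_iff:
  assumes x: "x \<in> carrier_vec (k + k)"
  shows "mpc_optimizer I x z \<longleftrightarrow> z = ([x, next_state x (opt_u x)], [opt_u x], opt_s x)"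
proof (rule mpc_optimizer_unique)
  let ?u = "opt_u x" and ?s = "opt_s x"
  have c: "?u \<in> carrier_vec k" "?s \<in> carrier_vec l" using opt_admissible unfolding admissible_def by blast+
  show "mpc_feasible I x ([x, next_state x ?u], [?u], ?s)"
    unfolding feasible_iff[OF x] using opt_admissible by blast
  fix z assume z: "mpc_feasible I x z" "z \<noteq> ([x, next_state x ?u], [?u], ?s)"
  then obtain u s where a: "admissible u s" and ze: "z = ([x, next_state x u], [u], s)"
    unfolding feasible_iff[OF x] by blast
  have c': "u \<in> carrier_vec k" "s \<in> carrier_vec l" using a unfolding admissible_def by blast+
  have \<rho>': "(0::real) < of_rat \<rho>" using \<rho> by simp
  let ?f = "\<lambda>u s i. (u $ i)\<^sup>2 + (u $ i - 2 * drive x i)\<^sup>2 + of_rat \<rho> * (slack s i)\<^sup>2"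
  have "u \<noteq> ?u \<or> s \<noteq> ?s" using z(2) ze by auto
  then have "(\<Sum>i<k. (u $ i - ?u $ i)\<^sup>2) > 0 \<or> (\<Sum>i<l. (s $ i - ?s $ i)\<^sup>2) > 0"
    using vec_diff_pos c c' by blast
  moreover have "(\<Sum>i<l. (s $ i - ?s $ i)\<^sup>2) = (\<Sum>i<k. (slack s i - slack ?s i)\<^sup>2)"
    using l by (auto simp: slack_def)
  moreover have "0 \<le> (\<Sum>i<k. (u $ i - ?u $ i)\<^sup>2)" "0 \<le> (\<Sum>i<k. (slack s i - slack ?s i)\<^sup>2)"
    by (intro sum_nonneg; simp)+
  ultimately have "0 < 2 * (\<Sum>i<k. (u $ i - ?u $ i)\<^sup>2) + of_rat \<rho> * (\<Sum>i<k. (slack s i - slack ?s i)\<^sup>2)"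
    using \<rho>' by (smt (verit) mult_pos_pos mult_nonneg_nonneg)
  also have "\<dots> = (\<Sum>i<k. 2 * (u $ i - ?u $ i)\<^sup>2 + of_rat \<rho> * (slack s i - slack ?s i)\<^sup>2)"
    by (simp add: sum.distrib sum_distrib_left)
  also have "\<dots> \<le> (\<Sum>i<k. ?f u s i - ?f ?u ?s i)"
  proof (rule sum_mono)
    fix i assume "i \<in> {..<k}"
    then have i: "i < k" by simp
    have hard_s: "l = 0 \<Longrightarrow> slack s i = 0" unfolding slack_def by simp
    have "0 \<le> 4 * (?u $ i - drive x i) * (u $ i - ?u $ i) + 2 * of_rat \<rho> * slack ?s i * (slack s i - slack ?s i)"
      unfolding opt_index[OF i] using a i hard_s unfolding admissible_def by (intro variational h_real) auto
    moreover have "?f u s i - ?f ?u ?s i = 2 * (u $ i - ?u $ i)\<^sup>2 + of_rat \<rho> * (slack s i - slack ?s i)\<^sup>2 +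
        (4 * (?u $ i - drive x i) * (u $ i - ?u $ i) + 2 * of_rat \<rho> * slack ?s i * (slack s i - slack ?s i))"
      by (simp add: power2_eq_square algebra_simps)
    ultimately show "2 * (u $ i - ?u $ i)\<^sup>2 + of_rat \<rho> * (slack s i - slack ?s i)\<^sup>2 \<le> ?f u s i - ?f ?u ?s i" by linarith
  qed
  finally show "mpc_cost I ([x, next_state x ?u], [?u], ?s) < mpc_cost I z"
    unfolding ze cost[OF x c] cost[OF x c'] sum_subtractf by linarith
qed

lemma closed_loop: "x \<in> carrier_vec (k + k) \<Longrightarrow> closed_loop I x = next_state x (opt_u x)"
  using mpc_law_unique[OF optimizer_iff] by (simp add: closed_loop_def)

lemma feasible_set: "feasible_set I = carrier_vec (k + k)"
  using optimizer_iff unfolding feasible_set_def mpc_optimizer_def is_arg_min_def sel(1) by blast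

lemma regular: "I \<in> regular_instances"
proof -
  have "\<exists>!z. mpc_optimizer I x z" if "x \<in> carrier_vec (k + k)" for x
    unfolding optimizer_iff[OF that] by simp
  then show ?thesis using quadratic_strictly_convex[OF quadratic] feasible_set
    by (simp add: regular_instances_def sel(1))
qed

text \<open>The factor \<open>3\<close> bounds \<open>U b t - 2 * t\<close>, since
  \<open>U b t\<close> is at most \<open>t\<close> in absolute value.\<close>

abbreviation "gain \<equiv> 3 * (\<Sum>i<k. \<Sum>j<k. \<bar>of_rat (A i j)\<bar>) + \<bar>of_rat p\<bar> + \<bar>of_rat q\<bar> :: real"

sublocale sat_readout I "k + k" k A "\<lambda>i. of_rat (h i)" readout gain
proof unfold_locales
  let ?S = "\<Sum>i<k. \<Sum>j<k. \<bar>of_rat (A i j) :: real\<bar>"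
  have S: "0 \<le> ?S" by (intro sum_nonneg) auto
  then show "0 \<le> gain" by simp
  have u: "opt_u x \<in> carrier_vec k" for x by (simp add: opt_u_def)
  show closed: "closed_loop I x \<in> carrier_vec (k + k)" if "x \<in> carrier_vec (k + k)" for x
    unfolding closed_loop[OF that] by (rule next_state_carrier[OF that u])
  have index: "closed_loop I x $ i = opt_u x $ i - 2 * drive x i" "closed_loop I x $ (k + i) = - 2 * drive x i"
    if "x \<in> carrier_vec (k + k)" "i < k" for x i
    unfolding closed_loop[OF that(1)] by (rule next_state_index[OF that(1) u that(2)])+
  show "readout (closed_loop I x) i = clip (of_rat (h i)) (\<Sum>j<k. of_rat (A i j) * readout x j)"
    if "x \<in> carrier_vec (k + k)" "i < k" for x i
    unfolding readout_def[of "closed_loop I x"] index[OF that] opt_index[OF that(2)] drive_def[symmetric]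
    using U_clip[OF h_real[OF that(2)], of "drive x i"] by (simp add: algebra_simps)
  show "\<bar>closed_loop I x $ r\<bar> \<le> gain * B"
    if x: "x \<in> carrier_vec (k + k)" and B: "0 \<le> B" "\<And>i. i < k \<Longrightarrow> \<bar>readout x i\<bar> \<le> B" and r: "r < k + k" for x B r
  proof -
    have d: "\<bar>drive x i\<bar> \<le> ?S * B" if "i < k" for i
      unfolding drive_def using that B by (intro abs_sum_le) auto
    have "\<bar>closed_loop I x $ r\<bar> \<le> 3 * (?S * B)"
    proof (cases "r < k")
      case True
      then show ?thesis
        unfolding index(1)[OF x True] opt_index[OF True] using U_le[OF h_real[OF True], of "drive x r"] d[OF True] by linarith
    next
      case False
      then have rk: "r - k < k" "k + (r - k) = r" using r by auto
      have "0 \<le> ?S * B" using S B(1) by simp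
      then show ?thesis using index(2)[OF x rk(1)] d[OF rk(1)] unfolding rk(2) by linarith
    qed
    also have "3 * (?S * B) = (3 * ?S) * B" by simp
    also have "\<dots> \<le> gain * B" using B(1) by (intro mult_right_mono) auto
    finally show ?thesis .
  qed
  show "\<bar>readout x i\<bar> \<le> gain * B" if x: "x \<in> carrier_vec (k + k)" and B: "\<And>r. r < k + k \<Longrightarrow> \<bar>x $ r\<bar> \<le> B" and i: "i < k" for x B i
  proof -
    have b: "\<bar>x $ i\<bar> \<le> B" "\<bar>x $ (k + i)\<bar> \<le> B" using B i by auto
    then have "0 \<le> B" by linarith
    have "\<bar>readout x i\<bar> \<le> \<bar>of_rat p\<bar> * \<bar>x $ i\<bar> + \<bar>of_rat q\<bar> * \<bar>x $ (k + i)\<bar>"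
      unfolding readout_def abs_mult[symmetric] by linarith
    also have "\<dots> \<le> \<bar>of_rat p\<bar> * B + \<bar>of_rat q\<bar> * B" using b by (intro add_mono mult_left_mono) auto
    also have "\<dots> = (\<bar>of_rat p\<bar> + \<bar>of_rat q\<bar>) * B" by (simp add: algebra_simps)
    also have "\<dots> \<le> gain * B" using S \<open>0 \<le> B\<close> by (intro mult_right_mono) auto
    finally show ?thesis .
  qed
  show "\<exists>x\<in>carrier_vec (k + k). \<forall>i<k. readout x i = v i" for v :: "nat \<Rightarrow> real"
    using p by (intro bexI[of _ "vec (k + k) (\<lambda>r. if r < k then v r / of_rat p else 0)"]) (auto simp: readout_def)
qed (simp_all add: sel feasible_set)

end

text \<open>With \<open>p = q = 1\<close> the readout, the difference of the two halves, recovers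
  the input just applied, which is already clipped.\<close>

lemma hard_input_box:
  assumes "k \<ge> 1" "\<And>i. i < k \<Longrightarrow> 0 \<le> h i"
  shows "input_box k h 1 1 0 1 clip (\<lambda>_ _. 0)"
proof
  fix b t u s :: real
  show "0 \<le> b \<Longrightarrow> 0 \<le> s \<Longrightarrow> - s \<le> u \<Longrightarrow> u \<le> b + s \<Longrightarrow> (0 = (0::nat) \<Longrightarrow> s = 0) \<Longrightarrow>
      0 \<le> 4 * (clip b t - t) * (u - clip b t) + 2 * of_rat 1 * 0 * (s - 0)"
    using proj_le[of u b t] by (simp only: mult.assoc) simp
qed (use assms abs_clip_le in auto)

text \<open>The minimizer of \<open>2 (u - t)\<^sup>2 + r s\<^sup>2\<close> subject to \<open>- s \<le> u \<le> b + s\<close> and \<open>s \<ge> 0\<close>.\<close>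

definition soft_clip :: "real \<Rightarrow> real \<Rightarrow> real \<Rightarrow> real" where
  "soft_clip r b t = (if t < 0 then 2 * t / (2 + r) else if t > b then (2 * t + r * b) / (2 + r) else t)"

definition soft_slack :: "real \<Rightarrow> real \<Rightarrow> real \<Rightarrow> real" where
  "soft_slack r b t = (if t < 0 then - 2 * t / (2 + r) else if t > b then 2 * (t - b) / (2 + r) else 0)"

text \<open>The excess over the violated bound is \<open>2 * m\<close>. Expressing \<open>t\<close>
  through \<open>m\<close> removes all quotients from the later computations.\<close>

lemma soft_cases:
  assumes "r > 0" "0 \<le> b"
  obtains (low) m where "m > 0" "t = - (2 + r) * m" "soft_clip r b t = - 2 * m" "soft_slack r b t = 2 * m" "clip b t = 0"
  | (mid) "0 \<le> t" "t \<le> b" "soft_clip r b t = t" "soft_slack r b t = 0" "clip b t = t"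
  | (high) m where "m > 0" "t = b + (2 + r) * m" "soft_clip r b t = b + 2 * m" "soft_slack r b t = 2 * m" "clip b t = b"
proof -
  consider "t < 0" | "0 \<le> t" "t \<le> b" | "t > b" by linarith
  then show ?thesis
  proof cases
    case 1
    show ?thesis
      using 1 assms by (intro low[of "- t / (2 + r)"]) (simp_all add: soft_clip_def soft_slack_def clip_def field_simps)
  next
    case 2
    then show ?thesis by (intro mid) (simp_all add: soft_clip_def soft_slack_def clip_def)
  next
    case 3
    show ?thesis
      using 3 assms by (intro high[of "(t - b) / (2 + r)"]) (simp_all add: soft_clip_def soft_slack_def clip_def field_simps)
  qed
qed

text \<open>Outside the box the expression is \<open>4 * r * m\<close> times the slackness at
  \<open>(u, s)\<close> of the constraint that is active at the optimum.\<close>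

lemma soft_variational:
  assumes r: "r > 0" and b: "0 \<le> b" and s: "0 \<le> s" "- s \<le> u" "u \<le> b + s"
  shows "0 \<le> 4 * (soft_clip r b t - t) * (u - soft_clip r b t) + 2 * r * soft_slack r b t * (s - soft_slack r b t)"
proof (cases rule: soft_cases[of r b t, OF r b, case_names low mid high])
  case (low m)
  have "4 * (soft_clip r b t - t) * (u - soft_clip r b t) + 2 * r * soft_slack r b t * (s - soft_slack r b t) = 4 * r * m * (u + s)"
    unfolding low(3,4) by (simp add: low(2) algebra_simps)
  also have "\<dots> \<ge> 0" using r low(1) s by simp
  finally show ?thesis .
next
  case (high m)
  have "4 * (soft_clip r b t - t) * (u - soft_clip r b t) + 2 * r * soft_slack r b t * (s - soft_slack r b t) = 4 * r * m * (b + s - u)"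
    unfolding high(3,4) by (simp add: high(2) algebra_simps)
  also have "\<dots> \<ge> 0" using r high(1) s by simp
  finally show ?thesis .
qed simp

text \<open>\<open>soft_clip r b\<close> has slope \<open>1\<close> inside the box and
  \<open>2 / (2 + r)\<close> outside. The readout must have slope \<open>1\<close> inside, so
  \<open>2 * q - p = 1\<close>, and slope \<open>0\<close> outside, so
  \<open>2 * p / (2 + r) = 2 * (p - q)\<close>. These equations determine \<open>p\<close> and
  \<open>q\<close>.\<close>

lemma soft_input_box:
  assumes k: "k \<ge> 1" and h: "\<And>i. i < k \<Longrightarrow> 0 \<le> h i" and \<rho>: "\<rho> > 0"
  shows "input_box k h ((2 + \<rho>) / \<rho>) ((1 + \<rho>) / \<rho>) k \<rho> (soft_clip (of_rat \<rho>)) (soft_slack (of_rat \<rho>))"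
proof
  let ?r = "of_rat \<rho> :: real"
  have r: "?r > 0" using \<rho> by simp
  fix b t u s :: real
  show "0 < (2 + \<rho>) / \<rho>" using \<rho> by simp
  assume b: "0 \<le> b"
  show "0 \<le> soft_slack ?r b t \<and> - soft_slack ?r b t \<le> soft_clip ?r b t \<and> soft_clip ?r b t \<le> b + soft_slack ?r b t"
    by (cases rule: soft_cases[of ?r b t, OF r b, case_names low mid high]) (use b in simp_all)
  show "0 \<le> 4 * (soft_clip ?r b t - t) * (u - soft_clip ?r b t) + 2 * ?r * soft_slack ?r b t * (s - soft_slack ?r b t)"
    if "0 \<le> s" "- s \<le> u" "u \<le> b + s" using soft_variational[OF r b that] .
  show "\<bar>soft_clip ?r b t\<bar> \<le> \<bar>t\<bar>"
  proof (cases rule: soft_cases[of ?r b t, OF r b, case_names low mid high])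
    case (low m)
    have "0 \<le> ?r * m" "t = - (2 * m) - ?r * m" using r low(1,2) by (simp_all add: algebra_simps)
    then show ?thesis unfolding low(3) using low(1) by linarith
  next
    case (high m)
    have "0 \<le> ?r * m" "t = b + 2 * m + ?r * m" using r high(1,2) by (simp_all add: algebra_simps)
    then show ?thesis unfolding high(3) using high(1) b by linarith
  qed simp
  have pq: "of_rat ((2 + \<rho>) / \<rho>) = (2 + ?r) / ?r" "of_rat ((1 + \<rho>) / \<rho>) = (1 + ?r) / ?r"
    by (simp_all add: of_rat_divide of_rat_add)
  show "of_rat ((2 + \<rho>) / \<rho>) * (soft_clip ?r b t - 2 * t) + 2 * of_rat ((1 + \<rho>) / \<rho>) * t = clip b t"
    unfolding pq
  proof (cases rule: soft_cases[of ?r b t, OF r b, case_names low mid high])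
    case (low m)
    show "(2 + ?r) / ?r * (soft_clip ?r b t - 2 * t) + 2 * ((1 + ?r) / ?r) * t = clip b t"
      unfolding low(3,5) unfolding low(2) using r by (simp add: field_simps)
  next
    case mid
    show "(2 + ?r) / ?r * (soft_clip ?r b t - 2 * t) + 2 * ((1 + ?r) / ?r) * t = clip b t"
      unfolding mid(3,5) using r by (simp add: field_simps)
  next
    case (high m)
    show "(2 + ?r) / ?r * (soft_clip ?r b t - 2 * t) + 2 * ((1 + ?r) / ?r) * t = clip b t"
      unfolding high(3,5) unfolding high(2) using r by (simp add: field_simps)
  qed
qed (use k h \<rho> in auto)

section \<open>Instance codes as recursive functions\<close>

definition recursive :: "nat \<Rightarrow> (nat list \<Rightarrow> nat) \<Rightarrow> bool" where
  "recursive k F \<longleftrightarrow> (\<exists>f. \<forall>xs. length xs = k \<longrightarrow> rec_eval f xs (F xs))"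

definition recursive1 :: "(nat \<Rightarrow> nat) \<Rightarrow> bool" where
  "recursive1 h \<longleftrightarrow> (\<exists>f. \<forall>x. rec_eval f [x] (h x))"

definition recursive2 :: "(nat \<Rightarrow> nat \<Rightarrow> nat) \<Rightarrow> bool" where
  "recursive2 h \<longleftrightarrow> (\<exists>f. \<forall>x y. rec_eval f [x, y] (h x y))"

lemma recursive_proj: "i < k \<Longrightarrow> recursive k (\<lambda>xs. xs ! i)"
  unfolding recursive_def by (intro exI[of _ "Proj i"]) (auto intro: rec_eval.intros)

lemma recursive_comp1: "recursive1 h \<Longrightarrow> recursive k a \<Longrightarrow> recursive k (\<lambda>xs. h (a xs))"
proof -
  assume "recursive1 h" "recursive k a"
  then obtain f g where f: "\<And>x. rec_eval f [x] (h x)" and g: "\<And>xs. length xs = k \<Longrightarrow> rec_eval g xs (a xs)"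
    unfolding recursive1_def recursive_def by blast
  have "rec_eval (Comp f [g]) xs (h (a xs))" if "length xs = k" for xs
    by (rule rec_eval.intros(4)[of _ _ "[a xs]"]) (use f g that in auto)
  then show ?thesis unfolding recursive_def by blast
qed

lemma recursive_comp2: "recursive2 h \<Longrightarrow> recursive k a \<Longrightarrow> recursive k b \<Longrightarrow> recursive k (\<lambda>xs. h (a xs) (b xs))"
proof -
  assume "recursive2 h" "recursive k a" "recursive k b"
  then obtain f g g' where f: "\<And>x y. rec_eval f [x, y] (h x y)" and g: "\<And>xs. length xs = k \<Longrightarrow> rec_eval g xs (a xs)"
    "\<And>xs. length xs = k \<Longrightarrow> rec_eval g' xs (b xs)"
    unfolding recursive2_def recursive_def by metis
  have "rec_eval (Comp f [g, g']) xs (h (a xs) (b xs))" if "length xs = k" for xs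
    by (rule rec_eval.intros(4)[of _ _ "[a xs, b xs]"]) (use f g that in auto)
  then show ?thesis unfolding recursive_def by blast
qed

lemma recursive1_Suc: "recursive1 Suc"
  unfolding recursive1_def by (auto intro: rec_eval.intros)

lemma recursive_const: "recursive k (\<lambda>_. c)"
proof (induction c)
  case 0
  show ?case unfolding recursive_def by (intro exI[of _ Zero]) (auto intro: rec_eval.intros)
next
  case (Suc c)
  show ?case using recursive_comp1[OF recursive1_Suc Suc] .
qed

lemma recursive1I: "recursive 1 (\<lambda>xs. h (xs ! 0)) \<Longrightarrow> recursive1 h"
  unfolding recursive_def recursive1_def
proof (elim exE)
  fix f assume f: "\<forall>xs. length xs = 1 \<longrightarrow> rec_eval f xs (h (xs ! 0))"
  have "rec_eval f [x] (h x)" for x using f[rule_format, of "[x]"] by simp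
  then show "\<exists>f. \<forall>x. rec_eval f [x] (h x)" by blast
qed

lemma recursive2I: "recursive 2 (\<lambda>xs. h (xs ! 0) (xs ! 1)) \<Longrightarrow> recursive2 h"
  unfolding recursive_def recursive2_def
proof (elim exE)
  fix f assume f: "\<forall>xs. length xs = 2 \<longrightarrow> rec_eval f xs (h (xs ! 0) (xs ! 1))"
  have "rec_eval f [x, y] (h x y)" for x y using f[rule_format, of "[x, y]"] by simp
  then show "\<exists>f. \<forall>x y. rec_eval f [x, y] (h x y)" by blast
qed

lemma recursive1_prim:
  assumes "recursive 2 (\<lambda>xs. g (xs ! 0) (xs ! 1))" "\<And>n. h (Suc n) = g n (h n)"
  shows "recursive1 h"
proof -
  obtain p where p: "\<And>xs. length xs = 2 \<Longrightarrow> rec_eval p xs (g (xs ! 0) (xs ! 1))"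
    using assms(1) unfolding recursive_def by blast
  obtain q where q: "rec_eval q [] (h 0)"
    using recursive_const[of 0 "h 0"] unfolding recursive_def by auto
  have "rec_eval (Prim q p) [n] (h n)" for n
  proof (induction n)
    case 0
    show ?case using q by (rule rec_eval.intros)
  next
    case (Suc n)
    have "rec_eval p [n, h n] (h (Suc n))" using p[of "[n, h n]"] assms(2) by simp
    with Suc show ?case by (rule rec_eval.intros)
  qed
  then show ?thesis unfolding recursive1_def by blast
qed

lemma recursive2_prim:
  assumes "recursive1 (h 0)" "recursive 3 (\<lambda>xs. g (xs ! 0) (xs ! 1) (xs ! 2))" "\<And>n y. h (Suc n) y = g n (h n y) y"
  shows "recursive2 h"
proof -
  obtain p where p: "\<And>xs. length xs = 3 \<Longrightarrow> rec_eval p xs (g (xs ! 0) (xs ! 1) (xs ! 2))"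
    using assms(2) unfolding recursive_def by blast
  obtain q where q: "\<And>y. rec_eval q [y] (h 0 y)"
    using assms(1) unfolding recursive1_def by blast
  have "rec_eval (Prim q p) [n, y] (h n y)" for n y
  proof (induction n)
    case 0
    show ?case using q by (rule rec_eval.intros)
  next
    case (Suc n)
    have "rec_eval p [n, h n y, y] (h (Suc n) y)" using p[of "[n, h n y, y]"] assms(3) by simp
    with Suc show ?case by (rule rec_eval.intros)
  qed
  then show ?thesis unfolding recursive2_def by blast
qed

lemma recursive2_add: "recursive2 (+)"
proof (rule recursive2_prim[where g = "\<lambda>n z y. Suc z"])
  show "recursive1 ((+) 0)" by (rule recursive1I) (simp add: recursive_proj)
  show "recursive 3 (\<lambda>xs. Suc (xs ! 1))" by (intro recursive_comp1[OF recursive1_Suc] recursive_proj) simp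
qed simp

lemma recursive1_pred: "recursive1 (\<lambda>n. n - 1)"
  by (rule recursive1_prim[where g = "\<lambda>n y. n"]) (simp_all add: recursive_proj)

lemma recursive2_diff: "recursive2 (-)"
proof -
  \<comment> \<open>The recursion runs over the first argument, so the subtrahend comes first; the
    arguments are exchanged afterwards.\<close>
  have "recursive2 (\<lambda>n y. y - n)"
  proof (rule recursive2_prim[where g = "\<lambda>n z y. z - 1"])
    show "recursive1 (\<lambda>y. y - 0)" by (rule recursive1I) (simp add: recursive_proj)
    show "recursive 3 (\<lambda>xs. xs ! 1 - 1)" using recursive_comp1[OF recursive1_pred, of 3 "\<lambda>xs. xs ! 1"] by (simp add: recursive_proj)
  qed simp
  from recursive_comp2[OF this, of 2 "\<lambda>xs. xs ! 1" "\<lambda>xs. xs ! 0"] show ?thesis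
    by (intro recursive2I) (simp add: recursive_proj)
qed

lemma recursive1_triangle: "recursive1 triangle"
proof (rule recursive1_prim[where g = "\<lambda>n z. z + Suc n"])
  show "recursive 2 (\<lambda>xs. xs ! 1 + Suc (xs ! 0))"
    by (intro recursive_comp2[OF recursive2_add] recursive_comp1[OF recursive1_Suc] recursive_proj) simp_all
qed simp

lemma recursive1_power2: "recursive1 (\<lambda>m. 2 ^ m)"
proof (rule recursive1_prim[where g = "\<lambda>n z. z + z"])
  show "recursive 2 (\<lambda>xs. xs ! 1 + xs ! 1)"
    by (intro recursive_comp2[OF recursive2_add] recursive_proj) simp_all
qed simp

lemma recursive2_prod_encode: "recursive2 (\<lambda>a b. prod_encode (a, b))"
  unfolding prod_encode_def prod.case
  by (intro recursive2I recursive_comp2[OF recursive2_add] recursive_comp1[OF recursive1_triangle] recursive_proj) simp_all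

lemma triangle_mono: "a \<le> b \<Longrightarrow> triangle a \<le> triangle b"
  by (induction rule: dec_induct) auto

text \<open>The sum of the components is the number of the diagonal of \<open>z\<close>, the least
  \<open>s\<close> with \<open>z < triangle (Suc s)\<close>. Minimization finds it, and both
  components follow by subtraction.\<close>

lemma recursive1_decode_sum: "recursive1 (\<lambda>z. fst (prod_decode z) + snd (prod_decode z))"
proof -
  let ?h = "\<lambda>xs. Suc (xs ! 1) - triangle (Suc (xs ! 0))"
  have "recursive 2 ?h"
    by (intro recursive_comp2[OF recursive2_diff] recursive_comp1[OF recursive1_triangle] recursive_comp1[OF recursive1_Suc] recursive_proj) simp_all
  then obtain f where f: "\<forall>xs. length xs = 2 \<longrightarrow> rec_eval f xs (?h xs)" unfolding recursive_def ..
  have "rec_eval (Mu f) [z] (fst (prod_decode z) + snd (prod_decode z))" for z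
  proof -
    obtain a b where ab: "prod_decode z = (a, b)" by fastforce
    then have "z = prod_encode (a, b)" using prod_decode_inverse[of z] by simp
    then have z: "z = triangle (a + b) + a" by (simp add: prod_encode_def)
    have f': "rec_eval f [s, z] (Suc z - triangle (Suc s))" for s
      using f[THEN spec, of "[s, z]"] by (simp del: triangle_Suc)
    have "rec_eval (Mu f) [z] (a + b)"
    proof (rule rec_eval.intros(7))
      have "Suc z - triangle (Suc (a + b)) = 0" unfolding z by simp
      with f'[of "a + b"] show "rec_eval f [a + b, z] 0" by (simp only:)
    next
      fix s assume "s < a + b"
      then have "triangle (Suc s) \<le> triangle (a + b)" by (intro triangle_mono) simp
      then have "triangle (Suc s) \<le> z" unfolding z by (rule trans_le_add1)
      then have "Suc z - triangle (Suc s) = Suc (z - triangle (Suc s))" by (rule Suc_diff_le)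
      with f'[of s] show "\<exists>y. rec_eval f [s, z] (Suc y)" by metis
    qed
    then show ?thesis by (simp add: ab)
  qed
  then show ?thesis unfolding recursive1_def by blast
qed

lemma decode_eq:
  "fst (prod_decode z) = z - triangle (fst (prod_decode z) + snd (prod_decode z))"
proof -
  obtain a b where ab: "prod_decode z = (a, b)" by fastforce
  then have "z = prod_encode (a, b)" using prod_decode_inverse[of z] by simp
  then have "z - triangle (a + b) = a" by (simp add: prod_encode_def)
  then show ?thesis by (simp add: ab)
qed

lemma recursive1_fst: "recursive1 (\<lambda>z. fst (prod_decode z))"
proof -
  have "recursive 1 (\<lambda>xs. xs ! 0 - triangle (fst (prod_decode (xs ! 0)) + snd (prod_decode (xs ! 0))))"
    by (intro recursive_comp2[OF recursive2_diff] recursive_comp1[OF recursive1_triangle]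
        recursive_comp1[OF recursive1_decode_sum] recursive_proj) simp_all
  then show ?thesis unfolding decode_eq[symmetric] by (rule recursive1I)
qed

lemma recursive1_snd: "recursive1 (\<lambda>z. snd (prod_decode z))"
proof -
  have "recursive 1 (\<lambda>xs. (fst (prod_decode (xs ! 0)) + snd (prod_decode (xs ! 0))) - fst (prod_decode (xs ! 0)))"
    by (intro recursive_comp2[OF recursive2_diff] recursive_comp1[OF recursive1_decode_sum]
        recursive_comp1[OF recursive1_fst] recursive_proj) simp_all
  then show ?thesis unfolding add_diff_cancel_left' by (rule recursive1I)
qed

text \<open>\<open>int_encode 1\<close> is \<open>2\<close>. The fraction is in lowest terms, so its
  code is computed without a gcd.\<close>

lemma rat_code_power: "rat_code (1 / 2 ^ m) = prod_encode (2, 2 ^ m)"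
proof -
  have "(1 / 2 ^ m :: rat) = Fract 1 (2 ^ m)" by (simp add: Fract_of_int_quotient)
  then have "quotient_of (1 / 2 ^ m) = (1, 2 ^ m)" by (simp add: quotient_of_Fract normalize_stable)
  then show ?thesis by (simp add: rat_code_def int_encode_def sum_encode_def nat_power_eq)
qed

text \<open>An instance code with an entry \<open>1 / 2 ^ m\<close> as head of its \<open>p\<close>-th component; all the other
  entries are packed into the first argument.\<close>

fun template :: "nat \<Rightarrow> nat \<Rightarrow> nat \<Rightarrow> nat" where
  "template 0 z m = Suc (prod_encode (Suc (prod_encode (rat_code (1 / 2 ^ m), fst (prod_decode z))), snd (prod_decode z)))"
| "template (Suc p) z m = Suc (prod_encode (fst (prod_decode z), template p (snd (prod_decode z)) m))"

fun pack :: "nat list \<Rightarrow> nat list \<Rightarrow> nat list \<Rightarrow> nat" where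
  "pack [] ts post = prod_encode (list_encode ts, list_encode post)"
| "pack (c # pre) ts post = prod_encode (c, pack pre ts post)"

lemma recursive2_template: "recursive2 (template p)"
proof (induction p)
  case 0
  show ?case unfolding template.simps rat_code_power
    by (intro recursive2I recursive_comp1[OF recursive1_Suc] recursive_comp2[OF recursive2_prod_encode]
        recursive_comp1[OF recursive1_fst] recursive_comp1[OF recursive1_snd] recursive_comp1[OF recursive1_power2]
        recursive_const recursive_proj) simp_all
next
  case (Suc p)
  show ?case unfolding template.simps
    by (intro recursive2I recursive_comp1[OF recursive1_Suc] recursive_comp2[OF recursive2_prod_encode]
        recursive_comp2[OF Suc] recursive_comp1[OF recursive1_fst] recursive_comp1[OF recursive1_snd] recursive_proj) simp_all
qed

lemma template_pack:
  "template (length pre) (pack pre ts post) m = list_encode (pre @ list_encode (rat_code (1 / 2 ^ m) # ts) # post)"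
  by (induction pre) simp_all

text \<open>Supplies \<open>m \<ge> 2\<close> in the diagonalization, where the first packed
  component is the state dimension.\<close>

lemma pack_ge: "c \<le> pack (c # pre) ts post"
  by (simp add: le_prod_encode_1)

theorem recursive1_template: "recursive1 (\<lambda>m. template p m m)"
  by (intro recursive1I recursive_comp2[OF recursive2_template] recursive_proj) simp_all

section \<open>A nested reversible stack machine\<close>

datatype op = Inc nat | Dec nat | Pos nat | Zer nat

fun enabled :: "op \<Rightarrow> (nat \<Rightarrow> nat) \<Rightarrow> bool" where
  "enabled (Inc i) s \<longleftrightarrow> True"
| "enabled (Dec i) s \<longleftrightarrow> s i > 0"
| "enabled (Pos i) s \<longleftrightarrow> s i > 0"
| "enabled (Zer i) s \<longleftrightarrow> s i = 0"

fun effect :: "op \<Rightarrow> (nat \<Rightarrow> nat) \<Rightarrow> nat \<Rightarrow> nat" where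
  "effect (Inc i) s = s(i := Suc (s i))"
| "effect (Dec i) s = s(i := s i - 1)"
| "effect (Pos i) s = s"
| "effect (Zer i) s = s"

fun exclusive :: "op \<Rightarrow> op \<Rightarrow> bool" where
  "exclusive (Zer i) (Dec j) \<longleftrightarrow> i = j"
| "exclusive (Zer i) (Pos j) \<longleftrightarrow> i = j"
| "exclusive (Dec i) (Zer j) \<longleftrightarrow> i = j"
| "exclusive (Pos i) (Zer j) \<longleftrightarrow> i = j"
| "exclusive _ _ \<longleftrightarrow> False"

datatype ctl = L | U | V | C | D | X | W

text \<open>
  The stacks of a configuration are \<open>S\<close>, counting in unary the steps done by the current run, \<open>F\<close>, its
  remaining fuel, \<open>H\<close>, the transitions taken and the return marks, and the counters; the number \<open>b\<close>
  controls the loop that loads the input. A run loads (\<open>L\<close>), steps forward until its fuel is used up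
  (\<open>U\<close> before and \<open>V\<close> after a nested call), steps backward (\<open>D\<close>, with nested calls between \<open>C\<close> and \<open>X\<close>),
  and unloads (\<open>W\<close>). A nested call uses \<open>S\<close> as fuel.
\<close>

datatype conf = Conf ctl real real real real "nat \<Rightarrow> real"

definition unit :: "real \<Rightarrow> bool" where "unit x \<longleftrightarrow> 0 \<le> x \<and> x \<le> 1"

fun unit_conf :: "conf \<Rightarrow> bool" where
  "unit_conf (Conf c S F H b \<alpha>) \<longleftrightarrow> unit S \<and> unit F \<and> unit H \<and> unit b \<and> (\<forall>i. unit (\<alpha> i))"

text \<open>The alphabet of \<open>J\<close> symbols must contain the history symbols
  \<open>k + 2\<close> and, in the control register of the encoding by rules, seven control symbols.
  \<open>m \<ge> 2\<close> makes \<open>\<eta> \<le> 1/4\<close>.\<close>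

locale stack_machine =
  fixes trs :: "('q \<times> op \<times> 'q) list" and q0 :: 'q and J :: nat and m :: nat
  assumes J_ge: "J \<ge> length trs + 7" and m_ge: "m \<ge> 2"
    and exclusive: "\<And>k l. k < length trs \<Longrightarrow> l < length trs \<Longrightarrow> k \<noteq> l \<Longrightarrow>
      fst (trs ! k) = fst (trs ! l) \<Longrightarrow> exclusive (fst (snd (trs ! k))) (fst (snd (trs ! l)))"
begin

declare One_nat_def [simp del]

definition \<eta> :: real where "\<eta> = 1 / 2 ^ m"

abbreviation src :: "nat \<Rightarrow> 'q" where "src k \<equiv> fst (trs ! k)"
abbreviation opr :: "nat \<Rightarrow> op" where "opr k \<equiv> fst (snd (trs ! k))"
abbreviation tgt :: "nat \<Rightarrow> 'q" where "tgt k \<equiv> snd (snd (trs ! k))"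

text \<open>No stack stores the program state: it is read off the top of the history. The return
  marks \<open>0\<close> and \<open>1\<close> lie on top at the beginning of a run.\<close>

definition state :: "nat \<Rightarrow> 'q" where "state h = (if h < 2 then q0 else tgt (h - 2))"

text \<open>
  A stack is a number in base \<open>2 * J\<close> whose digits are even; stacks with different top symbols then
  lie in disjoint compact intervals.
\<close>

definition push :: "nat \<Rightarrow> real \<Rightarrow> real" where "push j x = (2 * real j + x) / (2 * real J)"
definition pop :: "nat \<Rightarrow> real \<Rightarrow> real" where "pop j x = 2 * real J * x - 2 * real j"
definition top :: "nat \<Rightarrow> real \<Rightarrow> bool" where
  "top j x \<longleftrightarrow> 2 * real j \<le> 2 * real J * x \<and> 2 * real J * x \<le> 2 * real j + 1"

fun guard :: "op \<Rightarrow> (nat \<Rightarrow> real) \<Rightarrow> bool" where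
  "guard (Inc i) \<alpha> \<longleftrightarrow> True"
| "guard (Dec i) \<alpha> \<longleftrightarrow> top 1 (\<alpha> i)"
| "guard (Pos i) \<alpha> \<longleftrightarrow> top 1 (\<alpha> i)"
| "guard (Zer i) \<alpha> \<longleftrightarrow> top 0 (\<alpha> i)"

fun act :: "op \<Rightarrow> (nat \<Rightarrow> real) \<Rightarrow> nat \<Rightarrow> real" where
  "act (Inc i) \<alpha> = \<alpha>(i := push 1 (\<alpha> i))"
| "act (Dec i) \<alpha> = \<alpha>(i := pop 1 (\<alpha> i))"
| "act (Pos i) \<alpha> = \<alpha>"
| "act (Zer i) \<alpha> = \<alpha>"

fun undo_guard :: "op \<Rightarrow> (nat \<Rightarrow> real) \<Rightarrow> bool" where
  "undo_guard (Inc i) \<alpha> \<longleftrightarrow> top 1 (\<alpha> i)"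
| "undo_guard (Dec i) \<alpha> \<longleftrightarrow> True"
| "undo_guard (Pos i) \<alpha> \<longleftrightarrow> top 1 (\<alpha> i)"
| "undo_guard (Zer i) \<alpha> \<longleftrightarrow> top 0 (\<alpha> i)"

fun undo :: "op \<Rightarrow> (nat \<Rightarrow> real) \<Rightarrow> nat \<Rightarrow> real" where
  "undo (Inc i) \<alpha> = \<alpha>(i := pop 1 (\<alpha> i))"
| "undo (Dec i) \<alpha> = \<alpha>(i := push 1 (\<alpha> i))"
| "undo (Pos i) \<alpha> = \<alpha>"
| "undo (Zer i) \<alpha> = \<alpha>"

text \<open>
  Starting from \<open>b = 0\<close>, the loop \<open>b \<mapsto> 2 * b + \<eta> / 2\<close> passes \<open>1/4\<close> after exactly \<open>m\<close> iterations, and then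
  \<open>b \<ge> 3/8\<close>. From other values of \<open>b\<close> it may stop earlier or get stuck in between.
\<close>

inductive hstep :: "conf \<Rightarrow> conf \<Rightarrow> bool" where
  load: "b \<le> 1/4 \<Longrightarrow>
    hstep (Conf L S F H b \<alpha>) (Conf L S F H (2 * b + \<eta> / 2) (\<alpha>(0 := push 1 (\<alpha> 0))))"
| loaded: "3/8 \<le> b \<Longrightarrow> hstep (Conf L S F H b \<alpha>) (Conf U S F H b \<alpha>)"
| call_up: "top 1 F \<Longrightarrow>
    hstep (Conf U S F H b \<alpha>) (Conf L (push 0 F) S (push 0 H) 0 (\<lambda>i. push 0 (\<alpha> i)))"
| turn: "top 0 F \<Longrightarrow> hstep (Conf U S F H b \<alpha>) (Conf D S F H b \<alpha>)"
| up: "top 1 F \<Longrightarrow> h < length trs + 2 \<Longrightarrow> top h H \<Longrightarrow> k < length trs \<Longrightarrow> src k = state h \<Longrightarrow>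
    guard (opr k) \<alpha> \<Longrightarrow>
    hstep (Conf V S F H b \<alpha>) (Conf U (push 1 S) (pop 1 F) (push (k + 2) H) b (act (opr k) \<alpha>))"
| down: "top 1 S \<Longrightarrow> k < length trs \<Longrightarrow> top (k + 2) H \<Longrightarrow> undo_guard (opr k) \<alpha> \<Longrightarrow>
    hstep (Conf D S F H b \<alpha>) (Conf C (pop 1 S) (push 1 F) (pop (k + 2) H) b (undo (opr k) \<alpha>))"
| call_down: "hstep (Conf C S F H b \<alpha>) (Conf L (push 0 F) S (push 1 H) 0 (\<lambda>i. push 0 (\<alpha> i)))"
| finish: "top 0 S \<Longrightarrow> hstep (Conf D S F H b \<alpha>) (Conf W S F H 0 \<alpha>)"
| unload: "b \<le> 1/4 \<Longrightarrow> top 1 (\<alpha> 0) \<Longrightarrow>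
    hstep (Conf W S F H b \<alpha>) (Conf W S F H (2 * b + \<eta> / 2) (\<alpha>(0 := pop 1 (\<alpha> 0))))"
| return: "3/8 \<le> b \<Longrightarrow> top 0 S \<Longrightarrow> h < 2 \<Longrightarrow> top h H \<Longrightarrow> (\<And>i. top 0 (\<alpha> i)) \<Longrightarrow>
    hstep (Conf W S F H b \<alpha>)
      (Conf (if h = 0 then V else X) F (pop 0 S) (pop h H) b (\<lambda>i. pop 0 (\<alpha> i)))"
| check: "top 1 F \<Longrightarrow> hstep (Conf X S F H b \<alpha>) (Conf D S F H b \<alpha>)"

section \<open>Stacks, determinism and infinite orbits\<close>

lemma J_pos: "J \<ge> 2" using J_ge by simp

lemma eta_pos: "\<eta> > 0" and eta_le: "\<eta> \<le> 1/4"
proof -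
  show "\<eta> > 0" by (simp add: \<eta>_def)
  have "(2::real) ^ 2 \<le> 2 ^ m" by (rule power_increasing) (use m_ge in auto)
  then show "\<eta> \<le> 1/4" by (simp add: \<eta>_def divide_simps)
qed

lemma pop_push [simp]: "pop j (push j x) = x"
  using J_pos by (simp add: pop_def push_def)

lemma push_pop [simp]: "push j (pop j x) = x"
  using J_pos by (simp add: pop_def push_def)

lemma top_push [simp]: "unit x \<Longrightarrow> top j (push j x)"
  using J_pos by (simp add: top_def push_def unit_def)

lemma unit_pop [simp]: "top j x \<Longrightarrow> unit (pop j x)"
  by (simp add: top_def pop_def unit_def)

lemma unit_push [simp]: "unit x \<Longrightarrow> j < J \<Longrightarrow> unit (push j x)"
proof -
  assume "unit x" "j < J"
  then have "real j + 1 \<le> real J" by linarith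
  with \<open>unit x\<close> show ?thesis using J_pos by (simp add: push_def unit_def divide_simps)
qed

lemma top_unique: "top j x \<Longrightarrow> top k x \<Longrightarrow> j = k"
  unfolding top_def by linarith

lemma small_symbols [simp]: "0 < J" "1 < J" "h < 2 \<Longrightarrow> h < J" "k < length trs \<Longrightarrow> Suc (Suc k) < J"
  using J_ge by auto

lemma top_unit: "top j x \<Longrightarrow> j < J \<Longrightarrow> unit x"
  by (metis push_pop unit_pop unit_push)

lemma unit_act: "(\<And>i. unit (\<alpha> i)) \<Longrightarrow> guard f \<alpha> \<Longrightarrow> unit (act f \<alpha> i)"
  by (cases f) auto

lemma unit_undo: "(\<And>i. unit (\<alpha> i)) \<Longrightarrow> undo_guard f \<alpha> \<Longrightarrow> unit (undo f \<alpha> i)"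
  by (cases f) auto

lemma unit_load: "unit b \<Longrightarrow> b \<le> 1/4 \<Longrightarrow> unit (2 * b + \<eta> / 2)"
  using eta_pos eta_le by (simp add: unit_def)

text \<open>Because of this invariance the clipping in \<open>rule_step\<close> never alters a
  machine step.\<close>

lemma hstep_unit: "hstep c c' \<Longrightarrow> unit_conf c \<Longrightarrow> unit_conf c'"
proof (induction rule: hstep.induct)
  case (load b S F H \<alpha>)
  then show ?case using unit_load[of b] by (simp)
next
  case (unload b \<alpha> S F H)
  then show ?case using unit_load[of b] by (simp)
qed (auto simp: unit_act unit_undo, auto simp: unit_def)

lemma exclusive_guard: "exclusive f g \<Longrightarrow> guard f \<alpha> \<Longrightarrow> \<not> guard g \<alpha>"
  by (cases f; cases g) (auto dest: top_unique)

text \<open>Different symbols and the two ranges of \<open>b\<close> are disjoint, and transitions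
  from one program state exclude each other. Determinism allows following a known finite computation
  inside any infinite orbit.\<close>

lemma hstep_deterministic: "hstep c d \<Longrightarrow> hstep c e \<Longrightarrow> d = e"
proof (induction rule: hstep.induct)
  case (up F h H k \<alpha> S b)
  from up(7) show ?case
  proof cases
    case (up h' k')
    with \<open>top h H\<close> have "h' = h" by (metis top_unique)
    with up \<open>src k = state h\<close> have "src k' = src k" by simp
    with up \<open>guard (opr k) \<alpha>\<close> \<open>k < length trs\<close> have "k' = k"
      by (metis exclusive exclusive_guard)
    with up show ?thesis by simp
  qed
next
  case (down S k H \<alpha> F b)
  from down(5) show ?case
  proof cases
    case (down k')
    with \<open>top (k + 2) H\<close> have "k' = k" by (metis top_unique add_right_cancel)
    with down show ?thesis by simp
  next
    case finish
    with \<open>top 1 S\<close> show ?thesis by (metis top_unique zero_neq_one)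
  qed
next
  case (return b S h H \<alpha> F)
  from return(6) show ?case
  proof cases
    case unload with return show ?thesis by simp
  next
    case (return h')
    with \<open>top h H\<close> have "h' = h" by (metis top_unique)
    with return show ?thesis by simp
  qed
qed (erule hstep.cases; auto dest: top_unique)+

definition immortal :: "conf \<Rightarrow> bool" where
  "immortal c \<longleftrightarrow> (\<exists>x. x 0 = c \<and> unit_conf c \<and> (\<forall>k::nat. hstep (x k) (x (Suc k))))"

lemma immortal_unit: "immortal c \<Longrightarrow> unit_conf c"
  by (auto simp: immortal_def)

lemma immortal_step: "immortal c \<Longrightarrow> hstep c d \<Longrightarrow> immortal d"
proof -
  assume "immortal c" and d: "hstep c d"
  then obtain x where x: "x 0 = c" "unit_conf c" "\<And>k. hstep (x k) (x (Suc k))"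
    by (auto simp: immortal_def)
  have "x (Suc 0) = d" using x(1) x(3)[of 0] d by (metis hstep_deterministic)
  moreover have "unit_conf d" using d x(2) by (rule hstep_unit)
  ultimately show ?thesis using x(3) unfolding immortal_def
    by (intro exI[of _ "\<lambda>k. x (Suc k)"]) auto
qed

lemma immortal_next: "immortal c \<Longrightarrow> \<exists>d. hstep c d \<and> immortal d"
  by (metis immortal_def immortal_step)

lemma immortal_steps: "hstep\<^sup>*\<^sup>* c d \<Longrightarrow> immortal c \<Longrightarrow> immortal d"
  by (induction rule: rtranclp_induct) (auto intro: immortal_step)

abbreviation ones :: "nat \<Rightarrow> real \<Rightarrow> real" where "ones k \<equiv> push 1 ^^ k"

lemma unit_ones [simp]: "unit x \<Longrightarrow> unit (ones k x)"
  by (induction k) auto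

lemma ones_shift: "ones k (push 1 x) = push 1 (ones k x)"
  by (induction k) auto

text \<open>A counter of the current run is a block of ones above a mark \<open>0\<close>, which is
  what \<open>Zer\<close> tests for; \<open>\<alpha>\<close> is whatever the frames below have left
  on the stacks.\<close>

definition counters :: "(nat \<Rightarrow> nat) \<Rightarrow> (nat \<Rightarrow> real) \<Rightarrow> nat \<Rightarrow> real" where
  "counters s \<alpha> i = ones (s i) (push 0 (\<alpha> i))"

lemma unit_counters: "(\<And>i. unit (\<alpha> i)) \<Longrightarrow> unit (counters s \<alpha> i)"
  by (simp add: counters_def)

lemma counters_upd: "(counters s \<alpha>)(i := ones n (push 0 (\<alpha> i))) = counters (s(i := n)) \<alpha>"
  by (auto simp: counters_def)

lemma top_counters_pos: "(\<And>i. unit (\<alpha> i)) \<Longrightarrow> s i > 0 \<Longrightarrow> top 1 (counters s \<alpha> i)"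
  by (cases "s i") (auto simp: counters_def)

lemma top_counters_zero: "(\<And>i. unit (\<alpha> i)) \<Longrightarrow> s i = 0 \<Longrightarrow> top 0 (counters s \<alpha> i)"
  by (auto simp: counters_def)

lemma push_counters: "push 1 (counters s \<alpha> i) = ones (Suc (s i)) (push 0 (\<alpha> i))"
  by (simp add: counters_def)

lemma pop_counters: "s i > 0 \<Longrightarrow> pop 1 (counters s \<alpha> i) = ones (s i - 1) (push 0 (\<alpha> i))"
  by (cases "s i") (auto simp: counters_def)

lemmas counters_simps = push_counters pop_counters counters_upd top_counters_pos top_counters_zero

lemma guard_counters: "(\<And>i. unit (\<alpha> i)) \<Longrightarrow> enabled f s \<Longrightarrow> guard f (counters s \<alpha>)"
  by (cases f) (auto simp: counters_simps)

lemma act_counters: "enabled f s \<Longrightarrow> act f (counters s \<alpha>) = counters (effect f s) \<alpha>"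
  by (cases f) (auto simp: counters_simps simp del: funpow.simps)

lemma undo_guard_counters:
  "(\<And>i. unit (\<alpha> i)) \<Longrightarrow> enabled f s \<Longrightarrow> undo_guard f (counters (effect f s) \<alpha>)"
  by (cases f) (auto simp: counters_simps)

lemma undo_counters: "enabled f s \<Longrightarrow> undo f (counters (effect f s) \<alpha>) = counters s \<alpha>"
  by (cases f) (auto simp: counters_simps simp del: funpow.simps)

section \<open>Nested calls that return\<close>

lemma loop_bound: "k < m \<Longrightarrow> \<eta> / 2 * (2 ^ k - 1) \<le> 1 / 4"
proof -
  assume "k < m"
  then have "(2::real) ^ Suc k \<le> 2 ^ m" by (intro power_increasing) auto
  then show ?thesis by (simp add: \<eta>_def divide_simps)
qed

lemma loop_end: "3 / 8 \<le> \<eta> / 2 * (2 ^ m - 1)"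
proof -
  have "\<eta> * 2 ^ m = 1" by (simp add: \<eta>_def)
  then show ?thesis using eta_le by (simp add: algebra_simps)
qed

lemma load_loop:
  "k \<le> m \<Longrightarrow> hstep\<^sup>*\<^sup>* (Conf L S F H 0 \<alpha>) (Conf L S F H (\<eta> / 2 * (2 ^ k - 1)) (\<alpha>(0 := ones k (\<alpha> 0))))"
proof (induction k)
  case (Suc k)
  have "hstep (Conf L S F H (\<eta> / 2 * (2 ^ k - 1)) (\<alpha>(0 := ones k (\<alpha> 0))))
     (Conf L S F H (2 * (\<eta> / 2 * (2 ^ k - 1)) + \<eta> / 2)
       ((\<alpha>(0 := ones k (\<alpha> 0)))(0 := push 1 ((\<alpha>(0 := ones k (\<alpha> 0))) 0))))"
    using loop_bound[of k] Suc.prems by (intro load) simp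
  also have "2 * (\<eta> / 2 * (2 ^ k - 1)) + \<eta> / 2 = \<eta> / 2 * (2 ^ Suc k - 1)"
    by (simp add: algebra_simps)
  finally have "hstep (Conf L S F H (\<eta> / 2 * (2 ^ k - 1)) (\<alpha>(0 := ones k (\<alpha> 0))))
     (Conf L S F H (\<eta> / 2 * (2 ^ Suc k - 1)) (\<alpha>(0 := ones (Suc k) (\<alpha> 0))))"
    by (simp only: fun_upd_upd fun_upd_same funpow.simps o_apply)
  with Suc show ?case by (meson Suc_leD rtranclp.rtrancl_into_rtrancl)
qed simp

lemma unload_loop:
  assumes "unit z"
  shows "k \<le> m \<Longrightarrow> hstep\<^sup>*\<^sup>* (Conf W S F H 0 (\<alpha>(0 := ones m z)))
    (Conf W S F H (\<eta> / 2 * (2 ^ k - 1)) (\<alpha>(0 := ones (m - k) z)))"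
proof (induction k)
  case (Suc k)
  have m: "ones (m - k) z = push 1 (ones (m - Suc k) z)"
    using Suc.prems by (metis Suc_diff_Suc Suc_le_lessD comp_apply funpow.simps(2))
  have "hstep (Conf W S F H (\<eta> / 2 * (2 ^ k - 1)) (\<alpha>(0 := ones (m - k) z)))
     (Conf W S F H (2 * (\<eta> / 2 * (2 ^ k - 1)) + \<eta> / 2)
       ((\<alpha>(0 := ones (m - k) z))(0 := pop 1 ((\<alpha>(0 := ones (m - k) z)) 0))))"
    using loop_bound[of k] Suc.prems assms by (intro unload) (auto simp: m)
  also have "2 * (\<eta> / 2 * (2 ^ k - 1)) + \<eta> / 2 = \<eta> / 2 * (2 ^ Suc k - 1)"
    by (simp add: algebra_simps)
  finally have "hstep (Conf W S F H (\<eta> / 2 * (2 ^ k - 1)) (\<alpha>(0 := ones (m - k) z)))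
     (Conf W S F H (\<eta> / 2 * (2 ^ Suc k - 1)) (\<alpha>(0 := ones (m - Suc k) z)))"
    by (simp only: fun_upd_upd fun_upd_same pop_push m)
  with Suc show ?case by (meson Suc_leD rtranclp.rtrancl_into_rtrancl)
qed simp

fun history :: "(nat \<Rightarrow> nat) \<Rightarrow> nat \<Rightarrow> real \<Rightarrow> real" where
  "history \<kappa> 0 H = H"
| "history \<kappa> (Suc j) H = push (\<kappa> j + 2) (history \<kappa> j H)"

definition "init = (\<lambda>i. if i = 0 then m else 0 :: nat)"

definition is_run :: "(nat \<Rightarrow> nat) \<Rightarrow> (nat \<Rightarrow> nat \<Rightarrow> nat) \<Rightarrow> nat \<Rightarrow> bool" where
  "is_run \<kappa> a n \<longleftrightarrow> a 0 = init \<and> (\<forall>j<n. \<kappa> j < length trs \<and>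
     src (\<kappa> j) = (if j = 0 then q0 else tgt (\<kappa> (j - 1))) \<and>
     enabled (opr (\<kappa> j)) (a j) \<and> a (Suc j) = effect (opr (\<kappa> j)) (a j))"

lemma is_run_mono: "is_run \<kappa> a n \<Longrightarrow> k \<le> n \<Longrightarrow> is_run \<kappa> a k"
  by (auto simp: is_run_def)

lemma unit_history: "is_run \<kappa> a n \<Longrightarrow> unit H \<Longrightarrow> unit (history \<kappa> n H)"
  by (induction n) (auto simp: is_run_def)

text \<open>\<open>F\<close> is the fuel of the callee and \<open>S\<close> is saved beneath its
  step stack. For the caller the two have the opposite roles, and \<open>leave\<close> exchanges
  them back.\<close>

definition enter :: "nat \<Rightarrow> real \<Rightarrow> real \<Rightarrow> real \<Rightarrow> (nat \<Rightarrow> real) \<Rightarrow> conf" where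
  "enter h S F H \<alpha> = Conf L (push 0 S) F (push h H) 0 (\<lambda>i. push 0 (\<alpha> i))"

definition leave :: "nat \<Rightarrow> real \<Rightarrow> real \<Rightarrow> real \<Rightarrow> (nat \<Rightarrow> real) \<Rightarrow> real \<Rightarrow> conf" where
  "leave h S F H \<alpha> b = Conf (if h = 0 then V else X) F S H b \<alpha>"

text \<open>A call with fuel exactly \<open>f\<close> restores everything except \<open>b\<close>,
  and \<open>b\<close> is reset to \<open>0\<close> before it is read again.\<close>

definition returns :: "nat \<Rightarrow> bool" where
  "returns f \<longleftrightarrow> (\<forall>h S y H \<alpha>. h < 2 \<longrightarrow> unit S \<longrightarrow> unit y \<longrightarrow> top 0 y \<longrightarrow> unit H \<longrightarrow> (\<forall>i. unit (\<alpha> i)) \<longrightarrow>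
     (\<exists>b. hstep\<^sup>*\<^sup>* (enter h S (ones f y) H \<alpha>) (leave h S (ones f y) H \<alpha> b)))"

lemma load_enter:
  "hstep\<^sup>*\<^sup>* (enter h S F H \<alpha>)
    (Conf U (push 0 S) F (push h H) (\<eta> / 2 * (2 ^ m - 1)) (counters init \<alpha>))"
proof -
  have "(\<lambda>i. push 0 (\<alpha> i))(0 := ones m (push 0 (\<alpha> 0))) = counters init \<alpha>"
    by (auto simp: counters_def init_def)
  then show ?thesis
    using load_loop[of m "push 0 S" F "push h H" "\<lambda>i. push 0 (\<alpha> i)"] loaded loop_end
    unfolding enter_def by (metis order_refl rtranclp.rtrancl_into_rtrancl)
qed

lemma up_loop:
  assumes run: "is_run \<kappa> a f" and ret: "\<And>j. j < f \<Longrightarrow> returns j"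
    and unit: "h < 2" "unit S" "unit y" "unit H" "\<And>i. unit (\<alpha> i)"
  shows "k \<le> f \<Longrightarrow> \<exists>b. hstep\<^sup>*\<^sup>* (enter h S (ones f y) H \<alpha>)
    (Conf U (ones k (push 0 S)) (ones (f - k) y) (history \<kappa> k (push h H)) b (counters (a k) \<alpha>))"
proof (induction k)
  case 0
  have "a 0 = init" using run by (simp add: is_run_def)
  then show ?case using load_enter[of h S "ones f y" H \<alpha>] by auto
next
  case (Suc k)
  then obtain b where b: "hstep\<^sup>*\<^sup>* (enter h S (ones f y) H \<alpha>) (Conf U (ones k (push 0 S)) (ones (f - k) y)
     (history \<kappa> k (push h H)) b (counters (a k) \<alpha>))" by auto
  have F: "ones (f - k) y = push 1 (ones (f - Suc k) y)"
    using Suc.prems by (metis Suc_diff_Suc Suc_le_lessD comp_apply funpow.simps(2))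
  have hist: "unit (history \<kappa> k (push h H))"
    using Suc.prems unit by (intro unit_history[OF is_run_mono[OF run]]) (auto intro!: unit_push)
  have "hstep (Conf U (ones k (push 0 S)) (ones (f - k) y) (history \<kappa> k (push h H)) b (counters (a k) \<alpha>))
    (enter 0 (ones (f - k) y) (ones k (push 0 S)) (history \<kappa> k (push h H)) (counters (a k) \<alpha>))"
    unfolding enter_def by (intro call_up) (use unit in \<open>auto simp: F\<close>)
  moreover obtain b' where "hstep\<^sup>*\<^sup>*
     (enter 0 (ones (f - k) y) (ones k (push 0 S)) (history \<kappa> k (push h H)) (counters (a k) \<alpha>))
     (leave 0 (ones (f - k) y) (ones k (push 0 S)) (history \<kappa> k (push h H)) (counters (a k) \<alpha>) b')"
    using ret[of k] Suc.prems unit hist unfolding returns_def by (metis Suc_le_lessD pos2 small_symbols(1) top_push unit_counters unit_ones unit_push)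
  moreover have "hstep (leave 0 (ones (f - k) y) (ones k (push 0 S)) (history \<kappa> k (push h H)) (counters (a k) \<alpha>) b')
    (Conf U (push 1 (ones k (push 0 S))) (pop 1 (ones (f - k) y)) (push (\<kappa> k + 2) (history \<kappa> k (push h H))) b'
      (act (opr (\<kappa> k)) (counters (a k) \<alpha>)))"
    unfolding leave_def if_P[OF refl]
  proof (rule up)
    \<comment> \<open>The top of the history: the return mark before the first step, afterwards the
      last transition.\<close>
    let ?s = "if k = 0 then h else \<kappa> (k - 1) + 2"
    show "top 1 (ones (f - k) y)" using unit by (simp add: F)
    show "?s < length trs + 2" "\<kappa> k < length trs" "src (\<kappa> k) = state ?s"
      using run Suc.prems unit by (auto simp: is_run_def state_def)
    show "top ?s (history \<kappa> k (push h H))"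
    proof (cases k)
      case (Suc l)
      have "unit (history \<kappa> l (push h H))"
        using Suc.prems Suc unit by (intro unit_history[OF is_run_mono[OF run]]) (auto intro!: unit_push)
      with Suc show ?thesis by (auto intro!: top_push)
    qed (use unit in auto)
    show "guard (opr (\<kappa> k)) (counters (a k) \<alpha>)"
      using run Suc.prems by (intro guard_counters unit) (auto simp: is_run_def)
  qed
  moreover have "act (opr (\<kappa> k)) (counters (a k) \<alpha>) = counters (a (Suc k)) \<alpha>"
    using run Suc.prems by (auto simp: is_run_def act_counters)
  ultimately have "hstep\<^sup>*\<^sup>* (enter h S (ones f y) H \<alpha>) (Conf U (ones (Suc k) (push 0 S)) (ones (f - Suc k) y)
      (history \<kappa> (Suc k) (push h H)) b' (counters (a (Suc k)) \<alpha>))"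
    using b by (simp add: F)
  then show ?case by blast
qed

lemma down_loop:
  assumes "is_run \<kappa> a k" and "\<And>j. j < k \<Longrightarrow> returns j"
    and unit: "h < 2" "unit S" "unit y" "unit H" "\<And>i. unit (\<alpha> i)"
  shows "\<exists>b'. hstep\<^sup>*\<^sup>*
    (Conf D (ones k (push 0 S)) (ones f y) (history \<kappa> k (push h H)) b (counters (a k) \<alpha>))
    (Conf D (push 0 S) (ones (f + k) y) (push h H) b' (counters init \<alpha>))"
  using assms(1,2)
proof (induction k arbitrary: f b)
  case 0
  then show ?case by (auto simp: is_run_def)
next
  case (Suc k)
  note run = Suc.prems(1)
  have k: "\<kappa> k < length trs" "enabled (opr (\<kappa> k)) (a k)" "a (Suc k) = effect (opr (\<kappa> k)) (a k)"
    using run by (auto simp: is_run_def)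
  have hist: "unit (history \<kappa> k (push h H))"
    using unit by (intro unit_history[OF is_run_mono[OF run]]) (auto intro!: unit_push)
  let ?H = "history \<kappa> k (push h H)" and ?\<alpha> = "counters (a k) \<alpha>" and ?S = "ones k (push 0 S)" and ?F = "ones (Suc f) y"
  have "hstep (Conf D (ones (Suc k) (push 0 S)) (ones f y) (push (\<kappa> k + 2) ?H) b (counters (a (Suc k)) \<alpha>))
    (Conf C (pop 1 (ones (Suc k) (push 0 S))) (push 1 (ones f y)) (pop (\<kappa> k + 2) (push (\<kappa> k + 2) ?H)) b
      (undo (opr (\<kappa> k)) (counters (a (Suc k)) \<alpha>)))"
    using hist k unit by (intro down) (auto intro: undo_guard_counters)
  then have "hstep (Conf D (ones (Suc k) (push 0 S)) (ones f y) (push (\<kappa> k + 2) ?H) b (counters (a (Suc k)) \<alpha>))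
    (Conf C ?S ?F ?H b ?\<alpha>)"
    using k by (simp add: undo_counters)
  moreover have "hstep (Conf C ?S ?F ?H b ?\<alpha>) (enter 1 ?F ?S ?H ?\<alpha>)"
    unfolding enter_def by (rule call_down)
  moreover obtain b' where "hstep\<^sup>*\<^sup>* (enter 1 ?F ?S ?H ?\<alpha>) (leave 1 ?F ?S ?H ?\<alpha> b')"
    using Suc.prems(2)[of k] unit hist unfolding returns_def
    by (metis one_less_numeral_iff semiring_norm(76) lessI small_symbols(1) top_push unit_counters unit_ones unit_push)
  moreover have "hstep (leave 1 ?F ?S ?H ?\<alpha> b') (Conf D ?S ?F ?H b' ?\<alpha>)"
    using unit by (auto simp: leave_def intro!: check)
  moreover obtain b'' where "hstep\<^sup>*\<^sup>* (Conf D ?S ?F ?H b' ?\<alpha>)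
      (Conf D (push 0 S) (ones (Suc f + k) y) (push h H) b'' (counters init \<alpha>))"
    using Suc.IH[of "Suc f" b'] is_run_mono[OF run] Suc.prems(2) by (auto simp: less_Suc_eq)
  ultimately have "hstep\<^sup>*\<^sup>* (Conf D (ones (Suc k) (push 0 S)) (ones f y) (push (\<kappa> k + 2) ?H) b (counters (a (Suc k)) \<alpha>))
     (Conf D (push 0 S) (ones (Suc f + k) y) (push h H) b'' (counters init \<alpha>))"
    by (meson converse_rtranclp_into_rtranclp rtranclp_trans)
  then show ?case by auto
qed

lemma unload_leave:
  fixes h :: nat
  assumes "h < 2" "unit S" "unit H" "\<And>i. unit (\<alpha> i)"
  shows "\<exists>b'. hstep\<^sup>*\<^sup>* (Conf D (push 0 S) F (push h H) b (counters init \<alpha>)) (leave h S F H \<alpha> b')"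
proof -
  have c: "counters init \<alpha> = (\<lambda>i. push 0 (\<alpha> i))(0 := ones m (push 0 (\<alpha> 0)))"
    by (auto simp: counters_def init_def)
  have "hstep (Conf D (push 0 S) F (push h H) b (counters init \<alpha>)) (Conf W (push 0 S) F (push h H) 0 (counters init \<alpha>))"
    using assms by (intro finish) auto
  also have "hstep\<^sup>*\<^sup>* \<dots> (Conf W (push 0 S) F (push h H) (\<eta> / 2 * (2 ^ m - 1)) ((\<lambda>i. push 0 (\<alpha> i))(0 := push 0 (\<alpha> 0))))"
    unfolding c using unload_loop[of "push 0 (\<alpha> 0)" m] assms by auto
  also have "(\<lambda>i. push 0 (\<alpha> i))(0 := push 0 (\<alpha> 0)) = (\<lambda>i. push 0 (\<alpha> i))" by auto
  also have "hstep (Conf W (push 0 S) F (push h H) (\<eta> / 2 * (2 ^ m - 1)) \<dots>)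
     (Conf (if h = 0 then V else X) F (pop 0 (push 0 S)) (pop h (push h H)) (\<eta> / 2 * (2 ^ m - 1)) (\<lambda>i. pop 0 (push 0 (\<alpha> i))))"
    using loop_end assms by (intro return) auto
  finally show ?thesis unfolding leave_def by auto
qed

text \<open>A nested call gets as fuel the current number of steps, which is below \<open>f\<close>
  whenever the run calls, both on the way up and on the way down. Hence strong induction on the fuel
  works.\<close>

lemma run_returns: "is_run \<kappa> a f \<Longrightarrow> returns f"
proof (induction f rule: less_induct)
  case (less f)
  have ret: "returns j" if "j < f" for j
    using less that by (meson is_run_mono less_imp_le)
  show ?case unfolding returns_def
  proof (intro allI impI)
    fix h :: nat and S y H and \<alpha> :: "nat \<Rightarrow> real"
    assume unit: "h < 2" "unit S" "unit y" "top 0 y" "unit H" "\<forall>i. unit (\<alpha> i)"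
    obtain b where "hstep\<^sup>*\<^sup>* (enter h S (ones f y) H \<alpha>)
       (Conf U (ones f (push 0 S)) (ones (f - f) y) (history \<kappa> f (push h H)) b (counters (a f) \<alpha>))"
      using up_loop[OF less.prems ret, of h S y H \<alpha> f] unit by blast
    moreover have "hstep (Conf U (ones f (push 0 S)) (ones (f - f) y) (history \<kappa> f (push h H)) b (counters (a f) \<alpha>))
      (Conf D (ones f (push 0 S)) (ones 0 y) (history \<kappa> f (push h H)) b (counters (a f) \<alpha>))"
      using unit by (auto intro: turn)
    moreover obtain b' where "hstep\<^sup>*\<^sup>* (Conf D (ones f (push 0 S)) (ones 0 y) (history \<kappa> f (push h H)) b (counters (a f) \<alpha>))
      (Conf D (push 0 S) (ones (0 + f) y) (push h H) b' (counters init \<alpha>))"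
      using down_loop[OF less.prems ret, of h S y H \<alpha> 0 b] unit by blast
    moreover obtain b'' where "hstep\<^sup>*\<^sup>* (Conf D (push 0 S) (ones (0 + f) y) (push h H) b' (counters init \<alpha>))
      (leave h S (ones f y) H \<alpha> b'')"
      using unload_leave[of h S H \<alpha> "ones f y" b'] unit by auto
    ultimately show "\<exists>b. hstep\<^sup>*\<^sup>* (enter h S (ones f y) H \<alpha>) (leave h S (ones f y) H \<alpha> b)"
      by (meson converse_rtranclp_into_rtranclp rtranclp_trans)
  qed
qed

text \<open>A real stack may hold infinitely many ones, or no valid symbol at all, so its leading
  ones are counted only up to \<open>n\<close>.\<close>

lemma ones_cases:
  assumes "unit x"
  obtains (exact) f y where "f < n" "x = ones f y" "\<not> top 1 y" "unit y" | (more) y where "x = ones n y" "unit y"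
proof -
  have "(\<exists>f y. f < n \<and> x = ones f y \<and> \<not> top 1 y \<and> unit y) \<or> (\<exists>y. x = ones n y \<and> unit y)"
  proof (induction n)
    case (Suc n)
    show ?case
    proof (cases "\<exists>y. x = ones n y \<and> unit y \<and> top 1 y")
      case True
      then obtain y where "x = ones n y" "top 1 y" by blast
      then have "x = ones (Suc n) (pop 1 y)" "unit (pop 1 y)"
        using ones_shift[of n "pop 1 y"] by simp_all
      then show ?thesis by blast
    next
      case False
      show ?thesis using Suc
      proof (elim disjE exE conjE)
        fix f y assume "f < n" "x = ones f y" "\<not> top 1 y" "unit y"
        then show ?thesis by (intro disjI1 exI[of _ f] exI[of _ y]) auto
      next
        fix y assume "x = ones n y" "unit y"
        then show ?thesis using False by blast
      qed
    qed
  qed (use assms in auto)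
  then show ?thesis using that by blast
qed

lemma ones_le:
  assumes "ones i z = ones f y" "top 0 y" "unit z"
  shows "i \<le> f"
  using assms(1)
proof (induction i arbitrary: f)
  case (Suc i)
  then show ?case
  proof (cases f)
    case 0
    then have "top 1 y" using Suc.prems assms(3) by (metis comp_apply funpow.simps(1) funpow.simps(2) id_apply top_push unit_ones)
    then show ?thesis using assms(2) by (metis top_unique zero_neq_one)
  next
    case (Suc g)
    then have "ones i z = ones g y" using Suc.prems by (metis comp_apply funpow.simps(2) pop_push)
    then show ?thesis using Suc Suc.IH by simp
  qed
qed simp

text \<open>By determinism the reachable configurations form a single chain; if it got stuck, it
  would be finite.\<close>

lemma infinite_reachable_immortal:
  assumes inf: "infinite {d. hstep\<^sup>*\<^sup>* c d}" and unit: "unit_conf c"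
  shows "immortal c"
proof -
  define x where "x k = ((\<lambda>c. SOME d. hstep c d) ^^ k) c" for k
  have step: "hstep (x k) (x (Suc k))" if "hstep (x k) d" for k d
    using that unfolding x_def by (auto intro: someI)
  have "\<exists>d. hstep (x k) d" for k
  proof (rule ccontr)
    assume stuck: "\<nexists>d. hstep (x k) d"
    have "\<exists>i\<le>k. d = x i" if "hstep\<^sup>*\<^sup>* c d" for d
      using that
    proof (induction rule: rtranclp_induct)
      case base
      then show ?case by (auto simp: x_def intro!: exI[of _ 0])
    next
      case (step d e)
      then obtain i where i: "i \<le> k" "d = x i" by blast
      then have "i < k" using stuck step(2) by (metis le_neq_implies_less)
      moreover have "e = x (Suc i)" using i step(2) \<open>\<And>k d. hstep (x k) d \<Longrightarrow> _\<close> hstep_deterministic by blast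
      ultimately show ?case by (metis Suc_leI)
    qed
    then have "{d. hstep\<^sup>*\<^sup>* c d} \<subseteq> x ` {..k}" by auto
    then show False using inf by (meson finite_atMost finite_imageI finite_subset)
  qed
  with step have "hstep (x k) (x (Suc k))" for k by blast
  then show ?thesis using unit unfolding immortal_def by (intro exI[of _ x]) (auto simp: x_def)
qed

text \<open>With unlimited fuel the outermost run never turns. All its nested calls return, so its
  step stack \<open>S\<close> takes infinitely many values.\<close>

lemma infinite_run_immortal:
  assumes run: "\<And>n. is_run \<kappa> a n"
  shows "\<exists>c. immortal c"
proof -
  \<comment> \<open>The fixed point of \<open>push 1\<close>, that is, an infinite stack of
    ones.\<close>
  define y where "y = 2 / (2 * real J - 1)"
  have J: "real J \<ge> 2" using J_pos by simp
  have y: "ones n y = y" for n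
  proof (induction n)
    case (Suc n)
    then show ?case using J by (simp add: y_def push_def divide_simps) (simp add: algebra_simps)
  qed simp
  have unit: "unit y" "unit 0" using J by (auto simp: unit_def y_def)
  let ?c = "enter 0 0 y 0 (\<lambda>i. 0)" and ?S = "\<lambda>n. ones n (push 0 0)"
  let ?stack = "\<lambda>c. case c of Conf e S F H b \<alpha> \<Rightarrow> S"
  have "inj ?S"
  proof (rule injI)
    fix i j assume "?S i = ?S j"
    moreover have "top 0 (push 0 0)" "unit (push 0 0)" using unit by auto
    ultimately show "i = j" by (metis le_antisym ones_le)
  qed
  then have "infinite (range ?S)" using finite_imageD[of ?S UNIV] by auto
  moreover have "range ?S \<subseteq> ?stack ` {d. hstep\<^sup>*\<^sup>* ?c d}"
  proof (rule image_subsetI)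
    fix n
    obtain b where "hstep\<^sup>*\<^sup>* ?c (Conf U (?S n) (ones (n - n) y) (history \<kappa> n (push 0 0)) b (counters (a n) (\<lambda>i. 0)))"
      using up_loop[OF run[of n] run_returns[OF run], of 0 0 y 0 "\<lambda>i. 0" n] unit y by auto
    then show "?S n \<in> ?stack ` {d. hstep\<^sup>*\<^sup>* ?c d}" by force
  qed
  ultimately have "infinite {d. hstep\<^sup>*\<^sup>* ?c d}" by (meson finite_imageI finite_subset)
  moreover have "unit_conf ?c" using unit by (simp add: enter_def)
  ultimately show ?thesis using infinite_reachable_immortal by blast
qed

end

section \<open>Halting excludes every infinite orbit\<close>

locale halting_stack_machine = stack_machine +
  fixes \<kappa> :: "nat \<Rightarrow> nat" and a :: "nat \<Rightarrow> nat \<Rightarrow> nat" and t :: nat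
  assumes run: "is_run \<kappa> a t"
    and halt: "\<And>k. k < length trs \<Longrightarrow> src k \<noteq> (if t = 0 then q0 else tgt (\<kappa> (t - 1)))"
begin

text \<open>With more than \<open>t\<close> units of fuel the run reaches the halting state with a
  one still on top of \<open>F\<close>, so it cannot turn. It makes one more nested call, which
  returns, and then has no transition.\<close>

lemma long_run_dies:
  fixes h :: nat
  assumes unit: "h < 2" "unit S" "unit y" "unit H" "\<And>i. unit (\<alpha> i)"
  shows "\<not> immortal (enter h S (ones (Suc t) y) H \<alpha>)"
proof
  assume "immortal (enter h S (ones (Suc t) y) H \<alpha>)"
  moreover have "ones (Suc t) y = ones t (push 1 y)" by (simp add: ones_shift)
  moreover have ret: "returns j" if "j \<le> t" for j using is_run_mono[OF run that] by (rule run_returns)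
  moreover obtain b where "hstep\<^sup>*\<^sup>* (enter h S (ones t (push 1 y)) H \<alpha>)
    (Conf U (ones t (push 0 S)) (ones (t - t) (push 1 y)) (history \<kappa> t (push h H)) b (counters (a t) \<alpha>))"
    using up_loop[OF run ret, of h S "push 1 y" H \<alpha> t] unit by auto
  ultimately have "immortal (Conf U (ones t (push 0 S)) (push 1 y) (history \<kappa> t (push h H)) b (counters (a t) \<alpha>))"
    by (auto dest: immortal_steps)
  then have "immortal (enter 0 (push 1 y) (ones t (push 0 S)) (history \<kappa> t (push h H)) (counters (a t) \<alpha>))"
    by (rule immortal_step) (use unit in \<open>auto simp: enter_def intro: call_up\<close>)
  moreover have hist: "unit (history \<kappa> t (push h H))"
    using unit by (intro unit_history[OF run]) auto
  obtain b' where "hstep\<^sup>*\<^sup>*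
     (enter 0 (push 1 y) (ones t (push 0 S)) (history \<kappa> t (push h H)) (counters (a t) \<alpha>))
     (leave 0 (push 1 y) (ones t (push 0 S)) (history \<kappa> t (push h H)) (counters (a t) \<alpha>) b')"
    using ret[of t] unit hist unfolding returns_def
    by (metis order_refl pos2 small_symbols(1,2) top_push unit_counters unit_push)
  ultimately have "immortal (leave 0 (push 1 y) (ones t (push 0 S)) (history \<kappa> t (push h H)) (counters (a t) \<alpha>) b')"
    by (auto dest: immortal_steps)
  then obtain d where d: "hstep (Conf V (ones t (push 0 S)) (push 1 y) (history \<kappa> t (push h H)) b' (counters (a t) \<alpha>)) d"
    by (auto simp: leave_def dest: immortal_next)
  let ?s = "if t = 0 then h else \<kappa> (t - 1) + 2"
  have "top ?s (history \<kappa> t (push h H))"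
  proof (cases t)
    case (Suc l)
    have "unit (history \<kappa> l (push h H))"
      using Suc unit by (intro unit_history[OF is_run_mono[OF run]]) auto
    with Suc show ?thesis by (auto intro!: top_push)
  qed (use unit in auto)
  from d show False
  proof cases
    case (up g k)
    have "g = ?s" using up \<open>top ?s _\<close> top_unique by blast
    then have "src k = (if t = 0 then q0 else tgt (\<kappa> (t - 1)))"
      using up unit by (auto simp: state_def)
    then show False using halt up by blast
  qed
qed

text \<open>The fuel of a fresh call is an arbitrary number. More than \<open>t\<close> leading ones
  kill the orbit; otherwise the run uses them up, and then only a mark \<open>0\<close> lets it turn
  and return.\<close>

lemma immortal_enter:
  fixes h :: nat
  assumes imm: "immortal (enter h S F H \<alpha>)"
    and unit: "h < 2" "unit S" "unit F" "unit H" "\<And>i. unit (\<alpha> i)"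
  obtains f y b where "f \<le> t" "F = ones f y" "top 0 y" "unit y" "immortal (leave h S F H \<alpha> b)"
  using \<open>unit F\<close>
proof (cases rule: ones_cases[where n = "Suc t"])
  case (exact f y)
  have f: "f \<le> t" using exact by simp
  note run' = is_run_mono[OF run f]
  have ret: "returns j" if "j \<le> t" for j using is_run_mono[OF run that] by (rule run_returns)
  obtain b where "hstep\<^sup>*\<^sup>* (enter h S (ones f y) H \<alpha>)
    (Conf U (ones f (push 0 S)) (ones (f - f) y) (history \<kappa> f (push h H)) b (counters (a f) \<alpha>))"
    using up_loop[OF run' ret, of h S y H \<alpha> f] unit f exact by auto
  then have "immortal (Conf U (ones f (push 0 S)) y (history \<kappa> f (push h H)) b (counters (a f) \<alpha>))"
    using imm exact by (auto dest: immortal_steps)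
  then obtain d where "hstep (Conf U (ones f (push 0 S)) y (history \<kappa> f (push h H)) b (counters (a f) \<alpha>)) d"
    by (auto dest: immortal_next)
  then have top: "top 0 y" by cases (use exact in auto)
  obtain b' where "hstep\<^sup>*\<^sup>* (enter h S F H \<alpha>) (leave h S F H \<alpha> b')"
    using ret[OF f] unit exact top unfolding returns_def by blast
  then show ?thesis using that exact f top imm immortal_steps by blast
next
  case (more y)
  then show ?thesis using long_run_dies[of h S y H \<alpha>] unit imm by simp
qed

text \<open>As \<open>b \<ge> 0\<close>, doubling does not decrease it and each round gains at least
  \<open>\<eta> / 2\<close>. So the loops end from every value of \<open>b\<close>, also from one
  they would not have in a regular run.\<close>

lemma loop_increases: "unit b \<Longrightarrow> b + real (Suc n) * (\<eta> / 2) > 1/4 \<Longrightarrow> (2 * b + \<eta> / 2) + real n * (\<eta> / 2) > 1/4"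
  by (simp add: unit_def algebra_simps add_divide_distrib)

lemma loop_terminates: "\<exists>n. b + real n * (\<eta> / 2) > 1/4"
proof -
  obtain n where "real n * (\<eta> / 2) > 1/4 - b" using eta_pos reals_Archimedean3[of "\<eta> / 2"] by (meson half_gt_zero)
  then show ?thesis by (auto simp: algebra_simps intro!: exI[of _ n])
qed

lemma immortal_L:
  assumes "immortal (Conf L S F H b \<alpha>)"
  shows "\<exists>b' \<alpha>'. immortal (Conf U S F H b' \<alpha>')"
proof -
  obtain n where "b + real n * (\<eta> / 2) > 1/4" using loop_terminates by blast
  then show ?thesis using assms
  proof (induction n arbitrary: b \<alpha>)
    case 0
    from immortal_next[OF 0(2)] obtain d where "hstep (Conf L S F H b \<alpha>) d" "immortal d" by blast
    then show ?case by cases (use 0 in auto)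
  next
    case (Suc n)
    from immortal_next[OF Suc(3)] obtain d where "hstep (Conf L S F H b \<alpha>) d" "immortal d" by blast
    then show ?case
    proof cases
      case load
      then show ?thesis using Suc.IH \<open>immortal d\<close> loop_increases[of b n] Suc.prems immortal_unit by force
    qed auto
  qed
qed

text \<open>The frame returned to may be fabricated; all that is known of it is its step stack,
  which is the \<open>F\<close> of the finished run.\<close>

lemma immortal_W:
  assumes "immortal (Conf W S F H b \<alpha>)"
  shows "\<exists>c S' H' b' \<alpha>'. immortal (Conf c F S' H' b' \<alpha>') \<and> (c = V \<or> c = X)"
proof -
  obtain n where "b + real n * (\<eta> / 2) > 1/4" using loop_terminates by blast
  then show ?thesis using assms
  proof (induction n arbitrary: b \<alpha>)
    case 0
    from immortal_next[OF 0(2)] obtain d where "hstep (Conf W S F H b \<alpha>) d" "immortal d" by blast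
    then show ?case
    proof cases
      case (return h)
      then show ?thesis using \<open>immortal d\<close> by (cases "h = 0") (simp_all, blast+)
    qed (use 0 in auto)
  next
    case (Suc n)
    from immortal_next[OF Suc(3)] obtain d where "hstep (Conf W S F H b \<alpha>) d" "immortal d" by blast
    then show ?case
    proof cases
      case unload
      then show ?thesis using Suc.IH \<open>immortal d\<close> loop_increases[of b n] Suc.prems immortal_unit by force
    next
      case (return h)
      then show ?thesis using \<open>immortal d\<close> by (cases "h = 0") (simp_all, blast+)
    qed
  qed
qed

text \<open>In the second case \<open>S\<close> has served as the fuel of a fresh call. Surviving it
  shows that \<open>S\<close> has at most \<open>t\<close> ones above a mark
  \<open>0\<close>.\<close>

lemma immortal_U:
  assumes imm: "immortal (Conf U S F H b \<alpha>)"
  shows "immortal (Conf D S F H b \<alpha>) \<or>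
    (\<exists>f y F' H' b' \<alpha>'. f \<le> t \<and> S = ones f y \<and> top 0 y \<and> immortal (Conf V S F' H' b' \<alpha>'))"
proof -
  have unit: "unit S" "unit F" "unit H" "\<And>i. unit (\<alpha> i)" using immortal_unit[OF imm] by auto
  obtain d where "hstep (Conf U S F H b \<alpha>) d" "immortal d" using immortal_next[OF imm] by blast
  then show ?thesis
  proof cases
    case call_up
    then have "immortal (enter 0 F S H \<alpha>)" using \<open>immortal d\<close> by (simp add: enter_def)
    then obtain f y b where "f \<le> t" "S = ones f y" "top 0 y" "immortal (leave 0 F S H \<alpha> b)"
      using unit by (elim immortal_enter) auto
    then show ?thesis unfolding leave_def if_P[OF refl] by blast
  qed (use \<open>immortal d\<close> in auto)
qed

lemma immortal_D:
  assumes imm: "immortal (Conf D S F H b \<alpha>)"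
  obtains (down) f y H' b' \<alpha>' where "f \<le> t" "S = ones (Suc f) y" "top 0 y"
      "immortal (Conf X (ones f y) (push 1 F) H' b' \<alpha>')"
  | (finish) c S' H' b' \<alpha>' where "top 0 S" "immortal (Conf c F S' H' b' \<alpha>')" "c = V \<or> c = X"
proof -
  obtain d where "hstep (Conf D S F H b \<alpha>) d" "immortal d" using immortal_next[OF imm] by blast
  then show ?thesis
  proof cases
    case (down k)
    let ?S = "pop 1 S" and ?F = "push 1 F" and ?H = "pop (k + 2) H" and ?\<alpha> = "undo (opr k) \<alpha>"
    have "unit_conf d" using \<open>immortal d\<close> by (rule immortal_unit)
    then have unit: "unit ?S" "unit ?F" "unit ?H" "\<And>i. unit (?\<alpha> i)" using down by auto
    have "immortal (enter 1 ?F ?S ?H ?\<alpha>)"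
      using immortal_step[OF \<open>immortal d\<close>] down(1) call_down unfolding enter_def by blast
    then obtain f y b' where *: "f \<le> t" "?S = ones f y" "top 0 y" "immortal (leave 1 ?F ?S ?H ?\<alpha> b')"
      using unit by (elim immortal_enter) auto
    have "S = ones (Suc f) y" using * by (metis comp_apply funpow.simps(2) push_pop)
    then show ?thesis using * that(1) by (simp add: leave_def)
  next
    case finish
    then have "immortal (Conf W S F H 0 \<alpha>)" using \<open>immortal d\<close> by simp
    from immortal_W[OF this] show ?thesis using finish that(2) by blast
  qed
qed

text \<open>\<open>V\<close> and \<open>X\<close> are the controls to which nested calls return. The
  goal is \<open>excluded 0\<close>, reached by descending from
  \<open>excluded (t + 2)\<close>.\<close>

definition excluded :: "nat \<Rightarrow> bool" where
  "excluded k \<longleftrightarrow> (\<forall>c S F H b \<alpha>. c = V \<or> c = X \<longrightarrow> unit S \<longrightarrow> \<not> immortal (Conf c (ones k S) F H b \<alpha>))"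

lemma immortal_V:
  assumes "immortal (Conf V S F H b \<alpha>)"
  shows "\<exists>F H \<alpha>. immortal (Conf U (push 1 S) F H b \<alpha>)"
proof -
  obtain d where d: "hstep (Conf V S F H b \<alpha>) d" "immortal d" using immortal_next[OF assms] by blast
  then show ?thesis by cases auto
qed

text \<open>This is the purpose of \<open>check\<close>: even a fabricated frame that resumes in
  \<open>X\<close> must have a one on \<open>F\<close>. In \<open>excluded_down\<close> it provides
  the additional one that reaches \<open>Suc k\<close>.\<close>

lemma immortal_X:
  assumes "immortal (Conf X S F H b \<alpha>)"
  shows "\<exists>F'. F = push 1 F' \<and> unit F' \<and> immortal (Conf D S F H b \<alpha>)"
proof -
  obtain d where d: "hstep (Conf X S F H b \<alpha>) d" "immortal d" using immortal_next[OF assms] by blast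
  then show ?thesis by cases (auto intro!: exI[of _ "pop 1 F"])
qed

lemma D_bound:
  assumes "immortal (Conf D (ones i z) F H b \<alpha>)" "unit z"
  shows "i \<le> Suc t"
  using assms(1)
proof (cases rule: immortal_D)
  case (down f y H' b' \<alpha>')
  then show ?thesis using ones_le[of i z "Suc f" y] assms by simp
next
  case finish
  then show ?thesis using ones_le[of i z 0] assms by simp
qed

text \<open>So many ones on \<open>S\<close> do not allow \<open>finish\<close>; hence
  \<open>S\<close>, possibly after one \<open>pop\<close>, becomes the fuel of a fresh call and
  exceeds \<open>t\<close>.\<close>

lemma excluded_large: "excluded (t + 2)"
  unfolding excluded_def
proof (intro allI impI notI)
  fix c S F H b \<alpha>
  assume c: "c = V \<or> c = X" "unit S" and imm: "immortal (Conf c (ones (t + 2) S) F H b \<alpha>)"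
  show False
  proof (cases "c = V")
    case True
    then obtain F' H' \<alpha>' where "immortal (Conf U (ones (t + 3) S) F' H' b \<alpha>')"
      using immortal_V imm by (fastforce simp: numeral_eq_Suc)
    from immortal_U[OF this] show False using D_bound[of "t + 3" S] ones_le[of "t + 3" S] c by fastforce
  next
    case False
    then have "immortal (Conf D (ones (t + 2) S) F H b \<alpha>)" using immortal_X imm c by blast
    then show False using D_bound[of "t + 2" S] c by fastforce
  qed
qed

text \<open>Going down moves the ones of \<open>S\<close> to \<open>F\<close>, keeping their total
  \<open>f + j\<close>. At the end \<open>F\<close> becomes the step stack of the frame returned to,
  and that frame is excluded.\<close>

lemma D_dies_exact:
  assumes "excluded (Suc k)" "unit z"
  shows "immortal (Conf D (ones f y) (ones j z) H b \<alpha>) \<Longrightarrow> top 0 y \<Longrightarrow> f + j \<ge> Suc k \<Longrightarrow> False"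
proof (induction f arbitrary: j H b \<alpha>)
  case 0
  from 0(1) show ?case
  proof (cases rule: immortal_D)
    case (down f y' H' b' \<alpha>')
    then show ?thesis using ones_le[of "Suc f" y' 0 y] 0 top_unit[of 0 y'] by simp
  next
    case (finish c S' H' b' \<alpha>')
    have "ones j z = ones (Suc k) (ones (j - Suc k) z)" using 0(3) by (metis add_0 comp_apply funpow_add le_add_diff_inverse)
    then show ?thesis using finish assms unfolding excluded_def by (metis unit_ones)
  qed
next
  case (Suc f)
  from Suc(2) show ?case
  proof (cases rule: immortal_D)
    case (down g y' H' b' \<alpha>')
    have y: "unit y" "unit y'" using down Suc top_unit[of 0] by auto
    have "g = f" using ones_le[of "Suc f" y "Suc g" y'] ones_le[of "Suc g" y' "Suc f" y] down y Suc by simp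
    then have "ones f y = ones g y'" using down by (metis comp_apply funpow.simps(2) pop_push)
    then have "immortal (Conf D (ones f y) (ones (Suc j) z) H' b' \<alpha>')"
      using immortal_X[OF down(4)] by auto
    then show ?thesis using Suc by (metis add_Suc_right add_Suc)
  next
    case finish
    then show ?thesis using ones_le[of "Suc f" y 0 "ones (Suc f) y"] Suc top_unit[of 0 y] by simp
  qed
qed

lemma D_dies:
  assumes "excluded (Suc k)" and imm: "immortal (Conf D (ones i x) (ones j z) H b \<alpha>)"
    and "unit x" "unit z" "i + j \<ge> Suc k"
  shows False
  using imm
proof (cases rule: immortal_D)
  case (down f y H' b' \<alpha>')
  have "i \<le> Suc f" using ones_le[of i x "Suc f" y] down assms by simp
  then show ?thesis using D_dies_exact[of k z "Suc f" y j] down assms by auto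
next
  case finish
  have "i = 0" using ones_le[of i x 0 "ones i x"] finish assms by simp
  then show ?thesis using D_dies_exact[of k z 0 "ones i x" j] finish assms by auto
qed

text \<open>
  After a return the number of completed steps of the resumed frame exceeds that of the frame
  below it, so it grows without bound along returns; once it exceeds \<open>t\<close>, the next call is a
  run from the initial configuration that is long enough to get stuck.
\<close>

lemma excluded_down: "excluded (Suc k) \<Longrightarrow> excluded k"
  unfolding excluded_def[of k]
proof (intro allI impI notI)
  fix c S F H b \<alpha>
  assume ex: "excluded (Suc k)" and c: "c = V \<or> c = X" "unit S" and imm: "immortal (Conf c (ones k S) F H b \<alpha>)"
  show False
  proof (cases "c = V")
    case True
    then obtain F' H' \<alpha>' where U: "immortal (Conf U (ones (Suc k) S) F' H' b \<alpha>')"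
      using immortal_V imm by fastforce
    have "unit F'" using immortal_unit[OF U] by simp
    with immortal_U[OF U] show False
      using D_dies[OF ex, of "Suc k" S 0 F'] c ex unfolding excluded_def by fastforce
  next
    case False
    then obtain F' where "F = push 1 F'" "unit F'" "immortal (Conf D (ones k S) F H b \<alpha>)"
      using immortal_X imm c by blast
    then show False using D_dies[OF ex, of k S 1 F' H b \<alpha>] c by (auto simp: One_nat_def)
  qed
qed

lemma excluded_0: "excluded 0"
proof -
  have "excluded (t + 2 - k)" for k
  proof (induction k)
    case (Suc k)
    show ?case
    proof (cases "k < t + 2")
      case True
      then have "t + 2 - k = Suc (t + 2 - Suc k)" by simp
      then show ?thesis using Suc excluded_down by metis
    qed (use Suc in auto)
  qed (use excluded_large in auto)
  from this[of "t + 2"] show ?thesis by simp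
qed

text \<open>Every infinite orbit passes through \<open>V\<close> or \<open>X\<close>, because the
  loops end and fresh calls return.\<close>

lemma not_immortal: "\<not> immortal c"
proof
  assume imm: "immortal c"
  have VX: False if "immortal (Conf c S F H b \<alpha>)" "c = V \<or> c = X" for c S F H b \<alpha>
    using excluded_0 that immortal_unit[OF that(1)] unfolding excluded_def by fastforce
  have D: False if "immortal (Conf D S F H b \<alpha>)" for S F H b \<alpha>
    using that by (cases rule: immortal_D) (use VX in blast)+
  have U: False if "immortal (Conf U S F H b \<alpha>)" for S F H b \<alpha>
    using immortal_U[OF that] D VX by blast
  obtain e S F H b \<alpha> where c: "c = Conf e S F H b \<alpha>" by (cases c)
  show False
  proof (cases e)
    case L then show ?thesis using imm c immortal_L U by blast
  next
    case W then show ?thesis using imm c immortal_W VX by blast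
  next
    case C
    then have imm': "immortal (enter 1 F S H \<alpha>)"
      using imm c call_down unfolding enter_def by (blast intro: immortal_step)
    have "unit_conf c" using imm by (rule immortal_unit)
    then obtain b where "immortal (leave 1 F S H \<alpha> b)"
      using imm' c by (elim immortal_enter) auto
    then have "immortal (Conf X S F H b \<alpha>)" by (simp add: leave_def)
    then show ?thesis by (rule VX) simp
  next
    case V
    then have "immortal (Conf V S F H b \<alpha>)" using imm c by simp
    then show ?thesis by (rule VX) simp
  next
    case X
    then have "immortal (Conf X S F H b \<alpha>)" using imm c by simp
    then show ?thesis by (rule VX) simp
  qed (use imm c U D in blast)+
qed

end

section \<open>Machine steps as guarded affine rules\<close>

datatype label = Load | Loaded | Call_up | Turn | Up nat nat | Down nat | Call_down | Finish | Unload
  | Return nat | Check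

fun ctl_code :: "ctl \<Rightarrow> nat" where
  "ctl_code L = 0" | "ctl_code U = 1" | "ctl_code V = 2" | "ctl_code C = 3" | "ctl_code D = 4"
| "ctl_code X = 5" | "ctl_code W = 6"

lemma ctl_code_inject [simp]: "ctl_code c = ctl_code c' \<longleftrightarrow> c = c'"
  by (cases c; cases c'; simp)

lemma ctl_code_less: "ctl_code c < 7"
  by (cases c) auto

fun op_reg :: "op \<Rightarrow> nat" where
  "op_reg (Inc i) = i" | "op_reg (Dec i) = i" | "op_reg (Pos i) = i" | "op_reg (Zer i) = i"

type_synonym box = "nat \<Rightarrow> rat \<times> rat"
type_synonym update = "nat \<Rightarrow> rat \<times> nat \<times> rat \<times> rat"

locale rule_machine = stack_machine +
  fixes R :: nat
  assumes R_pos: "R > 0" and op_reg: "\<And>k. k < length trs \<Longrightarrow> op_reg (opr k) < R"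
begin

definition topr :: "nat \<Rightarrow> rat \<times> rat" where
  "topr j = (2 * of_nat j / (2 * of_nat J), (2 * of_nat j + 1) / (2 * of_nat J))"
definition pushr :: "nat \<Rightarrow> nat \<Rightarrow> rat \<times> nat \<times> rat \<times> rat" where
  "pushr s j = (1 / (2 * of_nat J), s, 2 * of_nat j / (2 * of_nat J), 0)"
definition popr :: "nat \<Rightarrow> nat \<Rightarrow> rat \<times> nat \<times> rat \<times> rat" where
  "popr s j = (2 * of_nat J, s, - 2 * of_nat j, 0)"
definition setr :: "rat \<Rightarrow> rat \<times> nat \<times> rat \<times> rat" where
  "setr q = (0, 0, q, 0)"
definition copyr :: "nat \<Rightarrow> rat \<times> nat \<times> rat \<times> rat" where
  "copyr s = (1, s, 0, 0)"
definition loopr :: "rat \<times> nat \<times> rat \<times> rat" where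
  "loopr = (2, 4, 0, 1 / 2)"
text \<open>A control is stored as a top symbol with rest \<open>0\<close>, so the separation of
  stack symbols also separates the controls.\<close>

definition goto :: "ctl \<Rightarrow> rat \<times> nat \<times> rat \<times> rat" where
  "goto c = setr (2 * of_nat (ctl_code c) / (2 * of_nat J))"

text \<open>Registers 0 to 4 hold the control symbol and \<open>S\<close>, \<open>F\<close>, \<open>H\<close>, \<open>b\<close>; register \<open>5 + i\<close> holds counter stack \<open>i\<close>.\<close>

definition free :: "ctl \<Rightarrow> box" where "free c = (\<lambda>r. (0, 1))(0 := topr (ctl_code c))"
definition call :: "nat \<Rightarrow> update" where
  "call j = (\<lambda>r. if r < 5 then copyr r else pushr r 0)
     (0 := goto L, 1 := pushr 2 0, 2 := copyr 1, 3 := pushr 3 j, 4 := setr 0)"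

fun op_box :: "op \<Rightarrow> box \<Rightarrow> box" where
  "op_box (Inc i) g = g"
| "op_box (Dec i) g = g(5 + i := topr 1)"
| "op_box (Pos i) g = g(5 + i := topr 1)"
| "op_box (Zer i) g = g(5 + i := topr 0)"

fun op_update :: "op \<Rightarrow> update \<Rightarrow> update" where
  "op_update (Inc i) u = u(5 + i := pushr (5 + i) 1)"
| "op_update (Dec i) u = u(5 + i := popr (5 + i) 1)"
| "op_update (Pos i) u = u"
| "op_update (Zer i) u = u"

fun undo_box :: "op \<Rightarrow> box \<Rightarrow> box" where
  "undo_box (Inc i) g = g(5 + i := topr 1)"
| "undo_box (Dec i) g = g"
| "undo_box (Pos i) g = g(5 + i := topr 1)"
| "undo_box (Zer i) g = g(5 + i := topr 0)"

fun undo_update :: "op \<Rightarrow> update \<Rightarrow> update" where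
  "undo_update (Inc i) u = u(5 + i := popr (5 + i) 1)"
| "undo_update (Dec i) u = u(5 + i := pushr (5 + i) 1)"
| "undo_update (Pos i) u = u"
| "undo_update (Zer i) u = u"

fun from_ctl :: "label \<Rightarrow> ctl" where
  "from_ctl Load = L" | "from_ctl Loaded = L" | "from_ctl Call_up = U" | "from_ctl Turn = U" | "from_ctl (Up h k) = V"
| "from_ctl (Down k) = D" | "from_ctl Call_down = C" | "from_ctl Finish = D" | "from_ctl Unload = W"
| "from_ctl (Return h) = W" | "from_ctl Check = X"

fun to_ctl :: "label \<Rightarrow> ctl" where
  "to_ctl Load = L" | "to_ctl Loaded = U" | "to_ctl Call_up = L" | "to_ctl Turn = D" | "to_ctl (Up h k) = U"
| "to_ctl (Down k) = C" | "to_ctl Call_down = L" | "to_ctl Finish = W" | "to_ctl Unload = W"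
| "to_ctl (Return h) = (if h = 0 then V else X)" | "to_ctl Check = D"

fun box :: "label \<Rightarrow> box" where
  "box Load = (free L)(4 := (0, 1/4))"
| "box Loaded = (free L)(4 := (3/8, 1))"
| "box Call_up = (free U)(2 := topr 1)"
| "box Turn = (free U)(2 := topr 0)"
| "box (Up h k) = op_box (opr k) ((free V)(2 := topr 1, 3 := topr h))"
| "box (Down k) = undo_box (opr k) ((free D)(1 := topr 1, 3 := topr (k + 2)))"
| "box Call_down = free C"
| "box Finish = (free D)(1 := topr 0)"
| "box Unload = (free W)(4 := (0, 1/4), 5 := topr 1)"
| "box (Return h) = (\<lambda>r. if r < 5 then free W r else topr 0)(1 := topr 0, 3 := topr h, 4 := (3/8, 1))"
| "box Check = (free X)(2 := topr 1)"

fun update :: "label \<Rightarrow> update" where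
  "update Load = copyr(0 := goto L, 4 := loopr, 5 := pushr 5 1)"
| "update Loaded = copyr(0 := goto U)"
| "update Call_up = call 0"
| "update Turn = copyr(0 := goto D)"
| "update (Up h k) = op_update (opr k) (copyr(0 := goto U, 1 := pushr 1 1, 2 := popr 2 1, 3 := pushr 3 (k + 2)))"
| "update (Down k) = undo_update (opr k) (copyr(0 := goto C, 1 := popr 1 1, 2 := pushr 2 1, 3 := popr 3 (k + 2)))"
| "update Call_down = call 1"
| "update Finish = copyr(0 := goto W, 4 := setr 0)"
| "update Unload = copyr(0 := goto W, 4 := loopr, 5 := popr 5 1)"
| "update (Return h) = (\<lambda>r. if r < 5 then copyr r else popr r 0)
     (0 := goto (to_ctl (Return h)), 1 := copyr 2, 2 := popr 1 0, 3 := popr 3 h)"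
| "update Check = copyr(0 := goto D)"

text \<open>The program state has no register of its own, hence one \<open>Up\<close> rule for every
  history symbol \<open>h\<close> and every transition \<open>k\<close> that starts in
  \<open>state h\<close>.\<close>

definition labels :: "label list" where
  "labels = [Load, Loaded, Call_up, Turn, Call_down, Finish, Unload, Return 0, Return 1, Check] @
     map Down [0..<length trs] @
     map (\<lambda>(h, k). Up h k) (filter (\<lambda>(h, k). src k = state h)
       (List.product [0..<length trs + 2] [0..<length trs]))"

definition rule_of :: "label \<Rightarrow> rule" where
  "rule_of l = \<lparr>lower = \<lambda>r. fst (box l r), upper = \<lambda>r. snd (box l r),
     coeff = \<lambda>r. fst (update l r), source = \<lambda>r. fst (snd (update l r)),
     const = \<lambda>r. fst (snd (snd (update l r))), param = \<lambda>r. snd (snd (snd (update l r)))\<rparr>"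

abbreviation d :: nat where "d \<equiv> 5 + R"

lemma distinct_labels: "distinct labels"
  by (auto simp: labels_def distinct_map distinct_product inj_on_def distinct_filter)

lemma in_labels [simp]:
  "Load \<in> set labels" "Loaded \<in> set labels" "Call_up \<in> set labels" "Turn \<in> set labels"
  "Call_down \<in> set labels" "Finish \<in> set labels" "Unload \<in> set labels" "Check \<in> set labels"
  "Return h \<in> set labels \<longleftrightarrow> h < 2" "Down k \<in> set labels \<longleftrightarrow> k < length trs"
  "Up h k \<in> set labels \<longleftrightarrow> h < length trs + 2 \<and> k < length trs \<and> src k = state h"
  by (auto simp: labels_def)

definition inside :: "rat \<times> rat \<Rightarrow> real \<Rightarrow> bool" where
  "inside p x \<longleftrightarrow> of_rat (fst p) \<le> x \<and> x \<le> of_rat (snd p)"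

definition eval_upd :: "(nat \<Rightarrow> real) \<Rightarrow> rat \<times> nat \<times> rat \<times> rat \<Rightarrow> real" where
  "eval_upd x u = (case u of (a, s, b, p) \<Rightarrow> of_rat a * x s + of_rat b + of_rat p * \<eta>)"

lemma inside_topr [simp]: "inside (topr j) x \<longleftrightarrow> top j x"
  using J_pos by (auto simp: inside_def topr_def top_def of_rat_divide of_rat_mult of_rat_add field_simps)

lemma inside_simps: "inside (0, 1) x \<longleftrightarrow> unit x"
  "inside (0, 1/4) x \<longleftrightarrow> 0 \<le> x \<and> x \<le> 1/4" "inside (3/8, 1) x \<longleftrightarrow> 3/8 \<le> x \<and> x \<le> 1"
  by (auto simp: inside_def unit_def of_rat_divide)

lemma eval_simps [simp]: "eval_upd x (pushr s j) = push j (x s)" "eval_upd x (popr s j) = pop j (x s)"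
  "eval_upd x (setr 0) = 0" "eval_upd x (copyr s) = x s" "eval_upd x (goto c) = push (ctl_code c) 0"
  "eval_upd x loopr = 2 * x 4 + \<eta> / 2"
  using J_pos by (simp_all add: eval_upd_def pushr_def popr_def goto_def setr_def copyr_def loopr_def push_def pop_def
    of_rat_divide of_rat_mult of_rat_minus add_divide_distrib)

lemma rule_step_iff: "rule_step d (map rule_of labels) \<eta> x y \<longleftrightarrow>
    (\<exists>l\<in>set labels. (\<forall>r<d. inside (box l r) (x r)) \<and> (\<forall>r<d. y r = clip 1 (eval_upd x (update l r))))"
proof -
  have "(\<exists>i<length labels. P (labels ! i)) \<longleftrightarrow> (\<exists>l\<in>set labels. P l)" for P
    by (metis in_set_conv_nth)
  from this[of "\<lambda>l. (\<forall>r<d. inside (box l r) (x r)) \<and> (\<forall>r<d. y r = clip 1 (eval_upd x (update l r)))"]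
  show ?thesis by (simp add: rule_step_def rule_of_def inside_def eval_upd_def case_prod_unfold cong: conj_cong)
qed

text \<open>Counters without a register are set to \<open>0\<close>, the infinite stack of zeros: it
  is fixed by \<open>push 0\<close> and \<open>pop 0\<close> and passes the test
  \<open>top 0\<close> of \<open>return\<close>.\<close>

definition counter_part :: "(nat \<Rightarrow> real) \<Rightarrow> nat \<Rightarrow> real" where
  "counter_part x = (\<lambda>i. if i < R then x (5 + i) else 0)"

definition conf_of :: "ctl \<Rightarrow> (nat \<Rightarrow> real) \<Rightarrow> conf" where
  "conf_of c x = Conf c (x 1) (x 2) (x 3) (x 4) (counter_part x)"

lemma push_0_0 [simp]: "push 0 0 = 0" and pop_0_0 [simp]: "pop 0 0 = 0" and top_0_0 [simp]: "top 0 0"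
  by (simp_all add: push_def pop_def top_def)

lemma unit_0 [simp]: "unit 0" and unit_1 [simp]: "unit 1"
  by (simp_all add: unit_def)

lemma clip_unit: "unit x \<Longrightarrow> clip 1 x = x"
  by (simp add: unit_def clip_def)

lemma counter_part_op_update:
  assumes "op_reg f < R" "\<And>i. u (5 + i) = copyr (5 + i)"
  shows "counter_part (\<lambda>r. eval_upd x (op_update f u r)) = act f (counter_part x)"
  using assms by (cases f) (auto simp: counter_part_def fun_eq_iff)

lemma counter_part_undo_update:
  assumes "op_reg f < R" "\<And>i. u (5 + i) = copyr (5 + i)"
  shows "counter_part (\<lambda>r. eval_upd x (undo_update f u r)) = undo f (counter_part x)"
  using assms by (cases f) (auto simp: counter_part_def fun_eq_iff)

lemma op_update_small: "r < 5 \<Longrightarrow> op_update f u r = u r" and undo_update_small: "r < 5 \<Longrightarrow> undo_update f u r = u r"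
  by (cases f; simp)+

lemma op_box_small: "r < 5 \<Longrightarrow> op_box f g r = g r" and undo_box_small: "r < 5 \<Longrightarrow> undo_box f g r = g r"
  by (cases f; simp)+

lemma guard_op_box:
  "op_reg f < R \<Longrightarrow> \<forall>r<d. inside (op_box f g r) (x r) \<Longrightarrow> guard f (counter_part x)"
  by (cases f) (force simp: counter_part_def dest: spec[of _ "5 + op_reg f"])+

lemma guard_undo_box:
  "op_reg f < R \<Longrightarrow> \<forall>r<d. inside (undo_box f g r) (x r) \<Longrightarrow> undo_guard f (counter_part x)"
  by (cases f) (force simp: counter_part_def dest: spec[of _ "5 + op_reg f"])+

lemma less_d: "0 < d" "1 < d" "2 < d" "3 < d" "4 < d" "5 < d"
  using R_pos by auto

section \<open>Correspondence of rule steps and machine steps\<close>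

lemma hstep_of_label:
  assumes l: "l \<in> set labels" and inside: "\<forall>r<d. inside (box l r) (x r)"
  shows "top (ctl_code (from_ctl l)) (x 0) \<and>
    hstep (conf_of (from_ctl l) x) (conf_of (to_ctl l) (\<lambda>r. eval_upd x (update l r)))"
proof -
  note at = inside[rule_format, OF less_d(1)] inside[rule_format, OF less_d(2)] inside[rule_format, OF less_d(3)]
    inside[rule_format, OF less_d(4)] inside[rule_format, OF less_d(5)] inside[rule_format, OF less_d(6)]
  note simps = conf_of_def counter_part_def fun_eq_iff free_def call_def inside_simps
  have top0: "top 0 (counter_part x i)" if "l = Return h" for i h
    using inside[rule_format, of "5 + i"] that by (auto simp: counter_part_def)
  note hstep.intros [intro]
  show ?thesis
  proof (cases l)
    case Load
    have "conf_of L (\<lambda>r. eval_upd x (update l r)) = Conf L (x 1) (x 2) (x 3) (2 * x 4 + \<eta> / 2)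
      ((counter_part x)(0 := push 1 (counter_part x 0)))"
      using R_pos by (auto simp: Load simps)
    then show ?thesis using at by (auto simp: Load conf_of_def free_def inside_simps intro: load)
  next
    case Unload
    have "conf_of W (\<lambda>r. eval_upd x (update l r)) = Conf W (x 1) (x 2) (x 3) (2 * x 4 + \<eta> / 2)
      ((counter_part x)(0 := pop 1 (counter_part x 0)))"
      using R_pos by (auto simp: Unload simps)
    moreover have "top 1 (counter_part x 0)" using at R_pos by (simp add: Unload counter_part_def)
    ultimately show ?thesis using at by (auto simp: Unload conf_of_def free_def inside_simps intro: unload)
  next
    case (Up h k)
    have k: "op_reg (opr k) < R" "h < length trs + 2" "k < length trs" "src k = state h" using l op_reg by (auto simp: Up)
    have "guard (opr k) (counter_part x)" using guard_op_box k inside by (simp add: Up)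
    moreover have "counter_part (\<lambda>r. eval_upd x (update l r)) = act (opr k) (counter_part x)"
      using k by (simp add: Up counter_part_op_update)
    ultimately show ?thesis using at k
      by (auto simp: Up conf_of_def free_def op_box_small op_update_small intro!: up simp del: add_2_eq_Suc')
  next
    case (Down k)
    have k: "op_reg (opr k) < R" "k < length trs" using l op_reg by (auto simp: Down)
    have "undo_guard (opr k) (counter_part x)" using guard_undo_box k inside by (simp add: Down)
    moreover have "counter_part (\<lambda>r. eval_upd x (update l r)) = undo (opr k) (counter_part x)"
      using k by (simp add: Down counter_part_undo_update)
    ultimately show ?thesis using at k
      by (auto simp: Down conf_of_def free_def undo_box_small undo_update_small intro!: down simp del: add_2_eq_Suc')
  next
    case Call_up
    have "counter_part (\<lambda>r. eval_upd x (update l r)) = (\<lambda>i. push 0 (counter_part x i))"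
      by (auto simp: Call_up simps)
    then show ?thesis using at by (auto simp: Call_up conf_of_def free_def call_def intro!: call_up)
  next
    case Call_down
    have "counter_part (\<lambda>r. eval_upd x (update l r)) = (\<lambda>i. push 0 (counter_part x i))"
      by (auto simp: Call_down simps)
    then show ?thesis using at by (auto simp: Call_down conf_of_def free_def call_def intro!: call_down)
  next
    case (Return h)
    have "counter_part (\<lambda>r. eval_upd x (update l r)) = (\<lambda>i. pop 0 (counter_part x i))"
      by (auto simp: Return simps)
    moreover have "hstep (Conf W (x 1) (x 2) (x 3) (x 4) (counter_part x))
      (Conf (if h = 0 then V else X) (x 2) (pop 0 (x 1)) (pop h (x 3)) (x 4) (\<lambda>i. pop 0 (counter_part x i)))"
      using at top0 l by (intro return) (auto simp: Return inside_simps)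
    ultimately show ?thesis using at
      by (cases "h = 0") (simp_all add: Return conf_of_def free_def)
  next
    case Loaded
    have "counter_part (\<lambda>r. eval_upd x (update l r)) = counter_part x" by (auto simp: Loaded simps)
    then show ?thesis using at by (auto simp: Loaded conf_of_def free_def inside_simps intro: loaded)
  next
    case Turn
    have "counter_part (\<lambda>r. eval_upd x (update l r)) = counter_part x" by (auto simp: Turn simps)
    then show ?thesis using at by (auto simp: Turn conf_of_def free_def inside_simps intro: turn)
  next
    case Finish
    have "counter_part (\<lambda>r. eval_upd x (update l r)) = counter_part x" by (auto simp: Finish simps)
    then show ?thesis using at by (auto simp: Finish conf_of_def free_def inside_simps intro: finish)
  next
    case Check
    have "counter_part (\<lambda>r. eval_upd x (update l r)) = counter_part x" by (auto simp: Check simps)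
    then show ?thesis using at by (auto simp: Check conf_of_def free_def inside_simps intro: check)
  qed
qed

lemma topr_bounds: "j < J \<Longrightarrow> 0 \<le> fst (topr j) \<and> snd (topr j) \<le> 1"
proof -
  assume "j < J"
  then have "of_nat (2 * j + 1) \<le> (of_nat (2 * J) :: rat)" unfolding of_nat_le_iff by simp
  then show ?thesis using \<open>j < J\<close> by (simp add: topr_def divide_simps)
qed

lemma op_box_bounds:
  assumes "\<And>r. 0 \<le> fst (g r) \<and> snd (g r) \<le> 1"
  shows "0 \<le> fst (op_box f g r) \<and> snd (op_box f g r) \<le> 1"
    and "0 \<le> fst (undo_box f g r) \<and> snd (undo_box f g r) \<le> 1"
  using assms topr_bounds by (cases f; simp)+

lemma box_bounds:
  assumes "l \<in> set labels"
  shows "0 \<le> fst (box l r) \<and> snd (box l r) \<le> 1"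
proof -
  have free: "0 \<le> fst (free c r) \<and> snd (free c r) \<le> 1" for c r
    using topr_bounds[of "ctl_code c"] ctl_code_less[of c] J_ge by (simp add: free_def)
  show ?thesis
  proof (cases l)
    case (Up h k)
    then show ?thesis using assms J_ge
      by (auto intro!: op_box_bounds simp: free topr_bounds simp del: fun_upd_apply) (auto simp: free topr_bounds)
  next
    case (Down k)
    then show ?thesis using assms J_ge
      by (auto intro!: op_box_bounds simp: free topr_bounds simp del: fun_upd_apply) (auto simp: free topr_bounds)
  qed (use assms in \<open>auto simp: free topr_bounds\<close>)
qed

lemma op_update_source:
  assumes "op_reg f < R" "fst (snd (u r)) < d"
  shows "fst (snd (op_update f u r)) < d" "fst (snd (undo_update f u r)) < d"
  using assms by (cases f; simp add: pushr_def popr_def)+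

lemma update_source:
  assumes "l \<in> set labels" "r < d"
  shows "fst (snd (update l r)) < d"
  by (cases l) (use assms R_pos op_reg in
    \<open>auto intro!: op_update_source simp: copyr_def pushr_def popr_def setr_def goto_def loopr_def call_def\<close>)

text \<open>Before the step register 0 may hold any number with the right top symbol, afterwards it
  is exact. The other registers are not clipped, since machine steps preserve the unit
  interval.\<close>

lemma rule_step_hstep:
  assumes "rule_step d (map rule_of labels) \<eta> x y"
  shows "\<exists>c c'. top (ctl_code c) (x 0) \<and> y 0 = push (ctl_code c') 0 \<and>
    hstep (conf_of c x) (conf_of c' y) \<and> unit_conf (conf_of c x)"
proof -
  obtain l where l: "l \<in> set labels" "\<forall>r<d. inside (box l r) (x r)" "\<forall>r<d. y r = clip 1 (eval_upd x (update l r))"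
    using assms rule_step_iff by blast
  let ?c = "conf_of (from_ctl l) x" and ?c' = "conf_of (to_ctl l) (\<lambda>r. eval_upd x (update l r))"
  have unit_x: "unit (x r)" if "r < d" for r
  proof -
    have "(0::real) \<le> of_rat (fst (box l r))" "of_rat (snd (box l r)) \<le> (1::real)"
      using box_bounds[OF l(1), of r] by simp_all
    then show ?thesis using l(2) that unfolding inside_def unit_def by (meson order_trans)
  qed
  have unit: "unit_conf ?c"
    using unit_x less_d by (simp add: conf_of_def counter_part_def)
  have step: "top (ctl_code (from_ctl l)) (x 0)" "hstep ?c ?c'" using hstep_of_label l by blast+
  then have unit': "unit_conf ?c'" using hstep_unit unit by blast
  have clip: "clip 1 (eval_upd x (update l r)) = eval_upd x (update l r)" if "1 \<le> r" "r < d" for r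
  proof -
    have "unit (eval_upd x (update l r))"
    proof (cases "r < 5")
      case True
      then have "r = 1 \<or> r = 2 \<or> r = 3 \<or> r = 4" using that by auto
      then show ?thesis using unit' by (auto simp: conf_of_def)
    next
      case False
      then have "r - 5 < R" "5 + (r - 5) = r" using that by linarith+
      then have "counter_part (\<lambda>r. eval_upd x (update l r)) (r - 5) = eval_upd x (update l r)"
        by (simp add: counter_part_def)
      moreover have "unit (counter_part (\<lambda>r. eval_upd x (update l r)) (r - 5))"
        using unit' by (simp add: conf_of_def)
      ultimately show ?thesis by simp
    qed
    then show ?thesis by (rule clip_unit)
  qed
  have "conf_of (to_ctl l) y = ?c'"
  proof -
    have y: "y r = eval_upd x (update l r)" if "1 \<le> r" "r < d" for r using l(3) clip that by simp
    then have "counter_part y = counter_part (\<lambda>r. eval_upd x (update l r))"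
      by (auto simp: counter_part_def fun_eq_iff)
    then show ?thesis using y[of 1] y[of 2] y[of 3] y[of 4] less_d by (simp add: conf_of_def)
  qed
  moreover have "y 0 = push (ctl_code (to_ctl l)) 0"
  proof -
    have "eval_upd x (update l 0) = push (ctl_code (to_ctl l)) 0"
      by (cases l) (auto simp: op_update_small undo_update_small call_def)
    moreover have "unit (push (ctl_code (to_ctl l)) 0)" using ctl_code_less[of "to_ctl l"] J_ge by simp
    ultimately show ?thesis using l(3) less_d(1) by (simp add: clip_unit)
  qed
  ultimately show ?thesis using step unit by metis
qed

fun regs :: "conf \<Rightarrow> nat \<Rightarrow> real" where
  "regs (Conf e S F H b \<alpha>) = (\<lambda>r. \<alpha> (r - 5))(0 := push (ctl_code e) 0, 1 := S, 2 := F, 3 := H, 4 := b)"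

lemma all_regs: "(\<forall>r. P r) \<longleftrightarrow> P 0 \<and> P 1 \<and> P 2 \<and> P 3 \<and> P 4 \<and> (\<forall>i. P (5 + i :: nat))"
proof (intro iffI allI)
  fix r :: nat assume P: "P 0 \<and> P 1 \<and> P 2 \<and> P 3 \<and> P 4 \<and> (\<forall>i. P (5 + i))"
  consider "r = 0" | "r = 1" | "r = 2" | "r = 3" | "r = 4" | i where "r = 5 + i"
  proof -
    have "r = 0 \<or> r = 1 \<or> r = 2 \<or> r = 3 \<or> r = 4 \<or> 5 \<le> r" by linarith
    then show thesis using that le_Suc_ex[of 5 r] by blast
  qed
  then show "P r" using P by cases auto
qed auto

lemma label_of_hstep:
  assumes "hstep c c'" "unit_conf c"
  shows "\<exists>l\<in>set labels. (\<forall>r. inside (box l r) (regs c r)) \<and> (\<forall>r. regs c' r = eval_upd (regs c) (update l r))"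
  using assms(1)
proof (cases rule: hstep.cases)
  case load
  show ?thesis
  proof (intro bexI[of _ "Load"] conjI)
    show "\<forall>r. inside (box (Load) r) (regs c r)"
      using assms(2) load by (intro all_regs[THEN iffD2]) (simp add: free_def inside_simps unit_def)
    show "\<forall>r. regs c' r = eval_upd (regs c) (update (Load) r)"
      using load by (intro all_regs[THEN iffD2]) (simp add: call_def)
  qed (use load in simp)
next
  case loaded
  show ?thesis
  proof (intro bexI[of _ "Loaded"] conjI)
    show "\<forall>r. inside (box (Loaded) r) (regs c r)"
      using assms(2) loaded by (intro all_regs[THEN iffD2]) (simp add: free_def inside_simps unit_def)
    show "\<forall>r. regs c' r = eval_upd (regs c) (update (Loaded) r)"
      using loaded by (intro all_regs[THEN iffD2]) (simp add: call_def)
  qed (use loaded in simp)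
next
  case call_up
  show ?thesis
  proof (intro bexI[of _ "Call_up"] conjI)
    show "\<forall>r. inside (box (Call_up) r) (regs c r)"
      using assms(2) call_up by (intro all_regs[THEN iffD2]) (simp add: free_def inside_simps)
    show "\<forall>r. regs c' r = eval_upd (regs c) (update (Call_up) r)"
      using call_up by (intro all_regs[THEN iffD2]) (simp add: call_def)
  qed (use call_up in simp)
next
  case turn
  show ?thesis
  proof (intro bexI[of _ "Turn"] conjI)
    show "\<forall>r. inside (box (Turn) r) (regs c r)"
      using assms(2) turn by (intro all_regs[THEN iffD2]) (simp add: free_def inside_simps)
    show "\<forall>r. regs c' r = eval_upd (regs c) (update (Turn) r)"
      using turn by (intro all_regs[THEN iffD2]) (simp add: call_def)
  qed (use turn in simp)
next
  case (up F h H k \<alpha> S b)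
  have "op_reg (opr k) < R" using up op_reg by simp
  show ?thesis
  proof (intro bexI[of _ "Up h k"] conjI)
    show "\<forall>r. inside (box (Up h k) r) (regs c r)"
      using assms(2) up by (intro all_regs[THEN iffD2], cases "opr k") (simp_all add: free_def inside_simps)
    show "\<forall>r. regs c' r = eval_upd (regs c) (update (Up h k) r)"
      using up by (intro all_regs[THEN iffD2], cases "opr k") simp_all
  qed (use up in simp)
next
  case (down S k H \<alpha> F b)
  have "op_reg (opr k) < R" using down op_reg by simp
  show ?thesis
  proof (intro bexI[of _ "Down k"] conjI)
    show "\<forall>r. inside (box (Down k) r) (regs c r)"
      using assms(2) down by (intro all_regs[THEN iffD2], cases "opr k") (simp_all add: free_def inside_simps)
    show "\<forall>r. regs c' r = eval_upd (regs c) (update (Down k) r)"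
      using down by (intro all_regs[THEN iffD2], cases "opr k") simp_all
  qed (use down in simp)
next
  case call_down
  show ?thesis
  proof (intro bexI[of _ "Call_down"] conjI)
    show "\<forall>r. inside (box (Call_down) r) (regs c r)"
      using assms(2) call_down by (intro all_regs[THEN iffD2]) (simp add: free_def inside_simps)
    show "\<forall>r. regs c' r = eval_upd (regs c) (update (Call_down) r)"
      using call_down by (intro all_regs[THEN iffD2]) (simp add: call_def)
  qed (use call_down in simp)
next
  case finish
  show ?thesis
  proof (intro bexI[of _ "Finish"] conjI)
    show "\<forall>r. inside (box (Finish) r) (regs c r)"
      using assms(2) finish by (intro all_regs[THEN iffD2]) (simp add: free_def inside_simps)
    show "\<forall>r. regs c' r = eval_upd (regs c) (update (Finish) r)"
      using finish by (intro all_regs[THEN iffD2]) (simp add: call_def)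
  qed (use finish in simp)
next
  case unload
  show ?thesis
  proof (intro bexI[of _ "Unload"] conjI)
    show "\<forall>r. inside (box (Unload) r) (regs c r)"
      using assms(2) unload by (intro all_regs[THEN iffD2]) (simp add: free_def inside_simps unit_def)
    show "\<forall>r. regs c' r = eval_upd (regs c) (update (Unload) r)"
      using unload by (intro all_regs[THEN iffD2]) (simp add: call_def)
  qed (use unload in simp)
next
  case (return b S h H \<alpha> F)
  show ?thesis
  proof (intro bexI[of _ "Return h"] conjI)
    show "\<forall>r. inside (box (Return h) r) (regs c r)"
      using assms(2) return by (intro all_regs[THEN iffD2]) (simp add: free_def inside_simps unit_def)
    show "\<forall>r. regs c' r = eval_upd (regs c) (update (Return h) r)"
      using return by (intro all_regs[THEN iffD2]) (simp add: call_def)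
  qed (use return in simp)
next
  case check
  show ?thesis
  proof (intro bexI[of _ "Check"] conjI)
    show "\<forall>r. inside (box (Check) r) (regs c r)"
      using assms(2) check by (intro all_regs[THEN iffD2]) (simp add: free_def inside_simps)
    show "\<forall>r. regs c' r = eval_upd (regs c) (update (Check) r)"
      using check by (intro all_regs[THEN iffD2]) (simp add: call_def)
  qed (use check in simp)
qed

lemma hstep_rule_step:
  assumes "hstep c c'" "unit_conf c"
  shows "rule_step d (map rule_of labels) \<eta> (regs c) (regs c')"
proof -
  obtain l where "l \<in> set labels" "\<forall>r. inside (box l r) (regs c r)" "\<forall>r. regs c' r = eval_upd (regs c) (update l r)"
    using label_of_hstep[OF assms] by blast
  moreover have "clip 1 (regs c' r) = regs c' r" for r
  proof (rule clip_unit)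
    have "unit (push (ctl_code e) 0)" for e using ctl_code_less[of e] J_ge by simp
    then show "unit (regs c' r)" using hstep_unit[OF assms] by (cases c') auto
  qed
  ultimately show ?thesis unfolding rule_step_iff by (intro bexI[of _ l]) auto
qed

lemma rules_immortal_iff: "rules_immortal d (map rule_of labels) \<eta> \<longleftrightarrow> (\<exists>c. immortal c)"
proof
  assume "rules_immortal d (map rule_of labels) \<eta>"
  then obtain x where x: "\<And>k::nat. rule_step d (map rule_of labels) \<eta> (x k) (x (Suc k))"
    unfolding rules_immortal_def by blast
  have "\<exists>c c'. top (ctl_code c) (x k 0) \<and> x (Suc k) 0 = push (ctl_code c') 0 \<and>
    hstep (conf_of c (x k)) (conf_of c' (x (Suc k))) \<and> unit_conf (conf_of c (x k))" for k
    using rule_step_hstep[OF x] .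
  then obtain c c' where c: "\<And>k. top (ctl_code (c k)) (x k 0)" "\<And>k. x (Suc k) 0 = push (ctl_code (c' k)) 0"
    "\<And>k. hstep (conf_of (c k) (x k)) (conf_of (c' k) (x (Suc k)))" "\<And>k. unit_conf (conf_of (c k) (x k))"
    by metis
  have "c' k = c (Suc k)" for k
  proof -
    have "top (ctl_code (c' k)) (x (Suc k) 0)" by (simp add: c(2))
    then show ?thesis using c(1)[of "Suc k"] top_unique ctl_code_inject by metis
  qed
  then have "immortal (conf_of (c 0) (x 0))" using c unfolding immortal_def
    by (intro exI[of _ "\<lambda>k. conf_of (c k) (x k)"]) auto
  then show "\<exists>c. immortal c" by blast
next
  assume "\<exists>c. immortal c"
  then obtain x where x: "unit_conf (x 0)" "\<And>k. hstep (x k) (x (Suc k))" unfolding immortal_def by blast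
  have "unit_conf (x k)" for k by (induction k) (use x hstep_unit in blast)+
  then show "rules_immortal d (map rule_of labels) \<eta>" unfolding rules_immortal_def
    using x hstep_rule_step by (intro exI[of _ "\<lambda>k. regs (x k)"]) blast
qed

section \<open>Disjointness of the guards\<close>

definition apart :: "rat \<times> rat \<Rightarrow> rat \<times> rat \<Rightarrow> bool" where
  "apart p q \<longleftrightarrow> snd p < fst q \<or> snd q < fst p"

lemma apart_topr [simp]: "apart (topr i) (topr j) \<longleftrightarrow> i \<noteq> j"
proof -
  have *: "(2 * of_nat i + 1) / (2 * of_nat J) < (2 * of_nat j / (2 * of_nat J) :: rat) \<longleftrightarrow> i < j" for i j
  proof -
    have "(2 * of_nat i + 1) / (2 * of_nat J) < (2 * of_nat j / (2 * of_nat J) :: rat) \<longleftrightarrow> (of_nat (2 * i + 1) :: rat) < of_nat (2 * j)"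
      unfolding divide_less_cancel using J_pos by simp
    then show ?thesis unfolding of_nat_less_iff by linarith
  qed
  show ?thesis unfolding apart_def topr_def fst_conv snd_conv * by linarith
qed

lemma apart_beta [simp]: "apart (0, 1/4) (3/8, 1)" "apart (3/8, 1) (0, 1/4)"
  by (simp_all add: apart_def)

lemma box_ctl: "box l 0 = topr (ctl_code (from_ctl l))"
  by (cases l) (auto simp: op_box_small undo_box_small free_def)

lemma op_box_apart:
  assumes "exclusive f g" "op_reg f < R"
  shows "apart (op_box f b (5 + op_reg f)) (op_box g c (5 + op_reg f))"
  using assms by (cases f; cases g) auto

text \<open>Rules with the same control differ in a stack symbol or in the range of
  \<open>b\<close>, with one exception: \<open>Up\<close> rules with the same history symbol. These
  start in the same program state, where counter tests exclude each other.\<close>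

lemma boxes_apart:
  assumes "l \<in> set labels" "l' \<in> set labels" "l \<noteq> l'"
  shows "\<exists>r<d. apart (box l r) (box l' r)"
proof (cases "from_ctl l = from_ctl l'")
  case False
  then show ?thesis using less_d(1) by (intro exI[of _ 0]) (simp add: box_ctl)
next
  case True
  have at: "\<exists>r<d. apart (box l r) (box l' r)" if "apart (box l r) (box l' r)" "r < d" for r using that by blast
  show ?thesis
  proof (cases "\<exists>h k h' k'. l = Up h k \<and> l' = Up h' k'")
    case up: True
    then obtain h k h' k' where l: "l = Up h k" "l' = Up h' k'" by blast
    show ?thesis
    proof (cases "h = h'")
      case True
      then have "exclusive (opr k) (opr k')" using exclusive[of k k'] assms l by auto
      then show ?thesis using op_box_apart op_reg assms l by (intro at[of "5 + op_reg (opr k)"]) auto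
    qed (use at[of 3] less_d l in \<open>auto simp: op_box_small\<close>)
  next
    case False
    have "apart (box l 1) (box l' 1) \<or> apart (box l 2) (box l' 2) \<or> apart (box l 3) (box l' 3) \<or> apart (box l 4) (box l' 4)"
    proof (cases l; cases l')
    qed (use True False assms in \<open>simp_all add: undo_box_small split: if_splits\<close>)
    then show ?thesis using less_d by blast
  qed
qed

theorem saturated_system_exists:
  "\<exists>N A. N > 1 \<and> (\<forall>e. 0 < e \<and> e \<le> 1 \<longrightarrow> (if rules_immortal d (map rule_of labels) e
    then sat_unstable N A (\<lambda>i. if i = 0 then e else 1) else sat_stable N A (\<lambda>i. if i = 0 then e else 1)))"
proof (rule saturated_simulation)
  fix \<rho> r assume "\<rho> \<in> set (map rule_of labels)" "r < d"
  then show "0 \<le> lower \<rho> r \<and> upper \<rho> r \<le> 1 \<and> source \<rho> r < d"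
    using box_bounds update_source by (auto simp: rule_of_def)
next
  fix i j assume ij: "i < length (map rule_of labels)" "j < length (map rule_of labels)" "i \<noteq> j"
  then have "labels ! i \<noteq> labels ! j" using distinct_labels nth_eq_iff_index_eq by auto
  then show "\<exists>r<d. upper (map rule_of labels ! i) r < lower (map rule_of labels ! j) r \<or>
      upper (map rule_of labels ! j) r < lower (map rule_of labels ! i) r"
    using boxes_apart[of "labels ! i" "labels ! j"] ij by (auto simp: rule_of_def apart_def)
qed

end

section \<open>While programs\<close>

datatype com = SKIP | INC nat | DEC nat | SEQ com com | WHILE nat com

text \<open>There are no silent steps: each transition performs one operation, and
  \<open>SEQ\<close> looks through a finished first part. A program is finished iff
  \<open>nxt\<close> is empty. The second transition of \<open>DEC\<close> makes it total at
  zero.\<close>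

fun nxt :: "com \<Rightarrow> (op \<times> com) list" where
  "nxt SKIP = []"
| "nxt (INC i) = [(Inc i, SKIP)]"
| "nxt (DEC i) = [(Dec i, SKIP), (Zer i, SKIP)]"
| "nxt (SEQ c d) = (if nxt c = [] then nxt d else map (\<lambda>(f, c'). (f, SEQ c' d)) (nxt c))"
| "nxt (WHILE i c) = [(Zer i, SKIP), (Pos i, SEQ c (WHILE i c))]"

inductive cstep :: "com \<times> (nat \<Rightarrow> nat) \<Rightarrow> com \<times> (nat \<Rightarrow> nat) \<Rightarrow> bool" where
  "(f, c') \<in> set (nxt c) \<Longrightarrow> enabled f s \<Longrightarrow> cstep (c, s) (c', effect f s)"

definition terminates :: "com \<Rightarrow> (nat \<Rightarrow> nat) \<Rightarrow> (nat \<Rightarrow> nat) \<Rightarrow> bool" where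
  "terminates c s s' \<longleftrightarrow> (\<exists>c'. cstep\<^sup>*\<^sup>* (c, s) (c', s') \<and> nxt c' = [])"

definition halts :: "com \<Rightarrow> (nat \<Rightarrow> nat) \<Rightarrow> bool" where
  "halts c s \<longleftrightarrow> (\<exists>s'. terminates c s s')"

lemma nxt_progress: "nxt c \<noteq> [] \<Longrightarrow> \<exists>f c'. (f, c') \<in> set (nxt c) \<and> enabled f s"
proof (induction c)
  case (SEQ c d)
  then show ?case by (cases "nxt c = []") force+
next
  case (DEC i)
  then show ?case by (cases "s i = 0") (auto intro: exI[of _ "Zer i"] exI[of _ "Dec i"])
next
  case (WHILE i c)
  then show ?case by (cases "s i = 0") (auto intro: exI[of _ "Zer i"] exI[of _ "Pos i"])
qed auto

lemma set_nxt_SEQ: "nxt c \<noteq> [] \<Longrightarrow> (f, q) \<in> set (nxt (SEQ c d)) \<longleftrightarrow> (\<exists>c'. (f, c') \<in> set (nxt c) \<and> q = SEQ c' d)"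
  by force

lemma nxt_exclusive:
  "(f, c') \<in> set (nxt c) \<Longrightarrow> (g, d') \<in> set (nxt c) \<Longrightarrow> (f, c') \<noteq> (g, d') \<Longrightarrow> exclusive f g"
proof (induction c arbitrary: c' d')
  case (SEQ c d)
  show ?case
  proof (cases "nxt c = []")
    case True
    then show ?thesis using SEQ.IH(2)[of c' d'] SEQ.prems by simp
  next
    case False
    then obtain a b where "(f, a) \<in> set (nxt c)" "c' = SEQ a d" "(g, b) \<in> set (nxt c)" "d' = SEQ b d"
      using SEQ.prems(1,2) set_nxt_SEQ[OF False] by blast
    then show ?thesis using SEQ.IH(1)[of a b] SEQ.prems(3) by simp
  qed
next
  case (WHILE i c)
  show ?case using WHILE.prems by auto
qed auto

lemma exclusive_enabled: "exclusive f g \<Longrightarrow> enabled f s \<Longrightarrow> \<not> enabled g s"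
  by (cases f; cases g) auto

lemma cstep_deterministic: "cstep x y \<Longrightarrow> cstep x z \<Longrightarrow> y = z"
  by (auto elim!: cstep.cases) (metis exclusive_enabled nxt_exclusive prod.inject)+

text \<open>The residual programs, which become the states of the machine, are finite in number for
  the same reason as the partial derivatives of a regular expression: \<open>SEQ\<close> changes
  only its first part, and \<open>WHILE\<close> comes back to itself.\<close>

lemma finite_control:
  "\<exists>Q R. finite Q \<and> c \<in> Q \<and> (\<forall>q f q'. q \<in> Q \<longrightarrow> (f, q') \<in> set (nxt q) \<longrightarrow> q' \<in> Q \<and> op_reg f < R)"
proof (induction c)
  case SKIP
  show ?case by (rule exI[of _ "{SKIP}"]) simp
next
  case (INC i)
  show ?case by (rule exI[of _ "{INC i, SKIP}"], rule exI[of _ "Suc i"]) auto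
next
  case (DEC i)
  show ?case by (rule exI[of _ "{DEC i, SKIP}"], rule exI[of _ "Suc i"]) auto
next
  case (SEQ c d)
  then obtain Q R Q' R' where Q: "finite Q" "c \<in> Q" "\<And>q f q'. q \<in> Q \<Longrightarrow> (f, q') \<in> set (nxt q) \<Longrightarrow> q' \<in> Q \<and> op_reg f < R"
    "finite Q'" "d \<in> Q'" "\<And>q f q'. q \<in> Q' \<Longrightarrow> (f, q') \<in> set (nxt q) \<Longrightarrow> q' \<in> Q' \<and> op_reg f < R'"
    by blast
  let ?Q = "(\<lambda>c. SEQ c d) ` Q \<union> Q'"
  have "q' \<in> ?Q \<and> op_reg f < max R R'" if q: "q \<in> ?Q" and f: "(f, q') \<in> set (nxt q)" for q f q'
  proof (cases "q \<in> Q'")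
    case True
    then show ?thesis using Q(6)[OF _ f] by (simp add: less_max_iff_disj)
  next
    case False
    then obtain c1 where c1: "q = SEQ c1 d" "c1 \<in> Q" using q by blast
    show ?thesis
    proof (cases "nxt c1 = []")
      case True
      then show ?thesis using Q(6)[OF Q(5), of f q'] f c1 by (simp add: less_max_iff_disj)
    next
      case False
      then obtain c' where "(f, c') \<in> set (nxt c1)" "q' = SEQ c' d" using f c1 set_nxt_SEQ by blast
      then show ?thesis using Q(3)[of c1 f c'] c1 by (simp add: less_max_iff_disj)
    qed
  qed
  moreover have "finite ?Q" "SEQ c d \<in> ?Q" using Q by auto
  ultimately show ?case by (intro exI[of _ ?Q] exI[of _ "max R R'"]) simp
next
  case (WHILE i c)
  then obtain Q R where Q: "finite Q" "c \<in> Q" "\<And>q f q'. q \<in> Q \<Longrightarrow> (f, q') \<in> set (nxt q) \<Longrightarrow> q' \<in> Q \<and> op_reg f < R"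
    by blast
  let ?w = "WHILE i c"
  let ?Q = "(\<lambda>c. SEQ c ?w) ` Q \<union> {?w, SKIP}"
  have "q' \<in> ?Q \<and> op_reg f < max R (Suc i)" if q: "q \<in> ?Q" and f: "(f, q') \<in> set (nxt q)" for q f q'
  proof -
    have w: ?thesis if "(f, q') \<in> set (nxt ?w)" using that Q(2) by auto
    consider "q = ?w" | "q = SKIP" | c1 where "q = SEQ c1 ?w" "c1 \<in> Q" using q by blast
    then show ?thesis
    proof cases
      case 3
      show ?thesis
      proof (cases "nxt c1 = []")
        case True
        then show ?thesis using w f 3 by simp
      next
        case False
        then obtain c' where "(f, c') \<in> set (nxt c1)" "q' = SEQ c' ?w" using f 3 set_nxt_SEQ by blast
        then show ?thesis using Q(3)[of c1 f c'] 3 by (simp add: less_max_iff_disj)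
      qed
    qed (use w f in simp_all)
  qed
  moreover have "finite ?Q" "?w \<in> ?Q" using Q by auto
  ultimately show ?case by (intro exI[of _ ?Q] exI[of _ "max R (Suc i)"]) simp
qed

lemma cstepD: "cstep x y \<Longrightarrow> \<exists>f. (f, fst y) \<in> set (nxt (fst x)) \<and> enabled f (snd x) \<and> snd y = effect f (snd x)"
  by (erule cstep.cases) auto

section \<open>Program runs as machine runs\<close>

context
  fixes c0 :: com and Q and trs :: "(com \<times> op \<times> com) list"
  assumes Q: "c0 \<in> Q" "\<And>q f q'. q \<in> Q \<Longrightarrow> (f, q') \<in> set (nxt q) \<Longrightarrow> q' \<in> Q"
    and trs: "set trs = {(q, f, q'). q \<in> Q \<and> (f, q') \<in> set (nxt q)}"
begin

text \<open>One choice of \<open>\<kappa>\<close> serves all lengths \<open>t\<close>, so that both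
  halting and diverging computations are covered.\<close>

lemma run_of_steps:
  assumes machine: "stack_machine trs J m" and x: "x 0 = (c0, \<lambda>i. if i = 0 then m else 0)"
  shows "\<exists>\<kappa>. \<forall>t. (\<forall>j<t. cstep (x j) (x (Suc j))) \<longrightarrow>
    stack_machine.is_run trs c0 m \<kappa> (\<lambda>j. snd (x j)) t \<and> (\<forall>j<t. snd (snd (trs ! \<kappa> j)) = fst (x (Suc j)))"
proof -
  define P where "P j k \<longleftrightarrow> k < length trs \<and> fst (trs ! k) = fst (x j) \<and> snd (snd (trs ! k)) = fst (x (Suc j)) \<and>
      enabled (fst (snd (trs ! k))) (snd (x j)) \<and> snd (x (Suc j)) = effect (fst (snd (trs ! k))) (snd (x j))" for j k
  have ex: "\<exists>k. P j k" if step: "cstep (x j) (x (Suc j))" and "fst (x j) \<in> Q" for j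
  proof -
    obtain f where f: "(f, fst (x (Suc j))) \<in> set (nxt (fst (x j)))" "enabled f (snd (x j))"
        "snd (x (Suc j)) = effect f (snd (x j))"
      using cstepD[OF step] by blast
    then have "(fst (x j), f, fst (x (Suc j))) \<in> set trs" using that(2) unfolding trs by blast
    then obtain k where "k < length trs" "trs ! k = (fst (x j), f, fst (x (Suc j)))"
      unfolding in_set_conv_nth by blast
    then show ?thesis using f by (intro exI[of _ k]) (simp add: P_def)
  qed
  define \<kappa> where "\<kappa> j = (SOME k. P j k)" for j
  have "stack_machine.is_run trs c0 m \<kappa> (\<lambda>j. snd (x j)) t \<and> (\<forall>j<t. snd (snd (trs ! \<kappa> j)) = fst (x (Suc j)))"
    if steps: "\<And>j. j < t \<Longrightarrow> cstep (x j) (x (Suc j))" for t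
  proof -
    have in_Q: "j \<le> t \<Longrightarrow> fst (x j) \<in> Q" for j
    proof (induction j)
      case (Suc j)
      then have "fst (x j) \<in> Q" "j < t" by simp_all
      then show ?case using cstepD[OF steps] Q(2) by blast
    qed (simp add: x Q)
    have \<kappa>: "P j (\<kappa> j)" if "j < t" for j
      unfolding \<kappa>_def by (rule someI_ex, rule ex[OF steps[OF that] in_Q]) (use that in simp)
    have "stack_machine.is_run trs c0 m \<kappa> (\<lambda>j. snd (x j)) t"
      unfolding stack_machine.is_run_def[OF machine] stack_machine.init_def[OF machine]
    proof (intro conjI allI impI)
      fix j assume j: "j < t"
      show "fst (trs ! \<kappa> j) = (if j = 0 then c0 else snd (snd (trs ! \<kappa> (j - 1))))"
        using \<kappa>[OF j] \<kappa>[of "j - 1"] j x by (cases j) (simp_all add: P_def)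
    next
      fix j assume "j < t"
      from \<kappa>[OF this] show "\<kappa> j < length trs" "enabled (fst (snd (trs ! \<kappa> j))) (snd (x j))"
        "snd (x (Suc j)) = effect (fst (snd (trs ! \<kappa> j))) (snd (x j))" by (simp_all add: P_def)
    qed (simp add: x)
    moreover have "snd (snd (trs ! \<kappa> j)) = fst (x (Suc j))" if "j < t" for j
      using \<kappa>[OF that] by (simp add: P_def)
    ultimately show ?thesis by blast
  qed
  then show ?thesis by blast
qed

lemma immortal_iff_not_halts:
  assumes machine: "stack_machine trs J m"
  shows "(\<exists>c. stack_machine.immortal trs c0 J m c) \<longleftrightarrow> \<not> halts c0 (\<lambda>i. if i = 0 then m else 0)"
proof
  let ?s = "\<lambda>i. if i = 0 then m else 0 :: nat"
  assume imm: "\<exists>c. stack_machine.immortal trs c0 J m c"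
  show "\<not> halts c0 ?s"
  proof
    assume "halts c0 ?s"
    then obtain c' s' where c': "cstep\<^sup>*\<^sup>* (c0, ?s) (c', s')" "nxt c' = []"
      unfolding halts_def terminates_def by blast
    obtain t where "(cstep ^^ t) (c0, ?s) (c', s')" using rtranclp_imp_relpowp[OF c'(1)] by blast
    then obtain x where x: "x 0 = (c0, ?s)" "x t = (c', s')" "\<And>j. j < t \<Longrightarrow> cstep (x j) (x (Suc j))"
      unfolding relpowp_fun_conv by blast
    obtain \<kappa> where all: "\<forall>t. (\<forall>j<t. cstep (x j) (x (Suc j))) \<longrightarrow>
        stack_machine.is_run trs c0 m \<kappa> (\<lambda>j. snd (x j)) t \<and> (\<forall>j<t. snd (snd (trs ! \<kappa> j)) = fst (x (Suc j)))"
      using run_of_steps[where x = x, OF machine x(1)] ..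
    have "\<forall>j<t. cstep (x j) (x (Suc j))" using x(3) by blast
    note \<kappa> = all[THEN spec, THEN mp, OF this, THEN conjunct1] all[THEN spec, THEN mp, OF this, THEN conjunct2]
    have "fst (trs ! k) \<noteq> (if t = 0 then c0 else snd (snd (trs ! \<kappa> (t - 1))))" if "k < length trs" for k
    proof -
      have "(if t = 0 then c0 else snd (snd (trs ! \<kappa> (t - 1)))) = c'"
        using x(1,2) \<kappa>(2) by (cases t) auto
      moreover have "nxt (fst (trs ! k)) \<noteq> []"
      proof -
        have "trs ! k \<in> {(q, f, q'). q \<in> Q \<and> (f, q') \<in> set (nxt q)}" using nth_mem[OF that] trs by simp
        then show ?thesis by auto
      qed
      ultimately show ?thesis using c'(2) by auto
    qed
    then have "halting_stack_machine trs c0 J m \<kappa> (\<lambda>j. snd (x j)) t"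
      using machine \<kappa>(1) by (simp add: halting_stack_machine_def halting_stack_machine_axioms_def)
    from halting_stack_machine.not_immortal[OF this] show False using imm by simp
  qed
next
  let ?s = "\<lambda>i. if i = 0 then m else 0 :: nat"
  assume no: "\<not> halts c0 ?s"
  have "\<exists>y. cstep x y" if reach: "cstep\<^sup>*\<^sup>* (c0, ?s) x" for x
  proof (cases x)
    case (Pair c s)
    have "nxt c \<noteq> []" using no reach unfolding Pair halts_def terminates_def by blast
    then obtain f c' where "(f, c') \<in> set (nxt c)" "enabled f s" using nxt_progress by blast
    from cstep.intros[OF this] show ?thesis using Pair by blast
  qed
  then have "\<exists>y. cstep x y \<and> cstep\<^sup>*\<^sup>* (c0, ?s) y" if "cstep\<^sup>*\<^sup>* (c0, ?s) x" for x
    using that rtranclp.rtrancl_into_rtrancl[of cstep "(c0, ?s)" x] by blast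
  then have "\<forall>x. \<exists>y. cstep\<^sup>*\<^sup>* (c0, ?s) x \<longrightarrow> cstep x y \<and> cstep\<^sup>*\<^sup>* (c0, ?s) y" by blast
  from choice[OF this] obtain g where g: "\<And>x. cstep\<^sup>*\<^sup>* (c0, ?s) x \<Longrightarrow> cstep x (g x) \<and> cstep\<^sup>*\<^sup>* (c0, ?s) (g x)" by blast
  define x where "x j = (g ^^ j) (c0, ?s)" for j
  have x_Suc: "x (Suc j) = g (x j)" for j by (simp add: x_def)
  have reach: "cstep\<^sup>*\<^sup>* (c0, ?s) (x j)" for j
  proof (induction j)
    case (Suc j)
    from g[OF Suc] show ?case unfolding x_Suc by (rule conjunct2)
  qed (simp add: x_def)
  have step: "cstep (x j) (x (Suc j))" for j unfolding x_Suc using g[OF reach] by (rule conjunct1)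
  have x0: "x 0 = (c0, ?s)" by (simp add: x_def)
  obtain \<kappa> where all: "\<forall>t. (\<forall>j<t. cstep (x j) (x (Suc j))) \<longrightarrow>
        stack_machine.is_run trs c0 m \<kappa> (\<lambda>j. snd (x j)) t \<and> (\<forall>j<t. snd (snd (trs ! \<kappa> j)) = fst (x (Suc j)))"
    using run_of_steps[where x = x, OF machine x0] ..
  have "stack_machine.is_run trs c0 m \<kappa> (\<lambda>j. snd (x j)) n" for n
    by (rule all[THEN spec, THEN mp, THEN conjunct1]) (simp add: step)
  then show "\<exists>c. stack_machine.immortal trs c0 J m c"
    by (rule stack_machine.infinite_run_immortal[OF machine])
qed

end

abbreviation load :: "nat \<Rightarrow> nat \<Rightarrow> nat" where
  "load m \<equiv> \<lambda>i. if i = 0 then m else 0"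

theorem saturated_system_of_program:
  "\<exists>N A. N > 1 \<and> (\<forall>m\<ge>2. if halts c (load m) then sat_stable N A (\<lambda>i. if i = 0 then 1 / 2 ^ m else 1)
    else sat_unstable N A (\<lambda>i. if i = 0 then 1 / 2 ^ m else 1))"
proof -
  obtain Q R where Q: "finite Q" "c \<in> Q" "\<And>q f q'. q \<in> Q \<Longrightarrow> (f, q') \<in> set (nxt q) \<Longrightarrow> q' \<in> Q \<and> op_reg f < R"
    using finite_control by metis
  have "{(q, f, q'). q \<in> Q \<and> (f, q') \<in> set (nxt q)} = (\<Union>q\<in>Q. (\<lambda>(f, q'). (q, f, q')) ` set (nxt q))" by auto
  then have "finite {(q, f, q'). q \<in> Q \<and> (f, q') \<in> set (nxt q)}" using Q(1) by simp
  then obtain trs where trs: "set trs = {(q, f, q'). q \<in> Q \<and> (f, q') \<in> set (nxt q)}" "distinct trs"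
    using finite_distinct_list by blast
  define J where "J = length trs + 7"
  have nth: "fst (trs ! k) \<in> Q \<and> (fst (snd (trs ! k)), snd (snd (trs ! k))) \<in> set (nxt (fst (trs ! k)))" if "k < length trs" for k
  proof -
    have "trs ! k \<in> {(q, f, q'). q \<in> Q \<and> (f, q') \<in> set (nxt q)}" using nth_mem[OF that] trs(1) by simp
    then show ?thesis by auto
  qed
  \<comment> \<open>\<open>Suc R\<close> guarantees a register for counter \<open>0\<close>, which
    receives the input.\<close>
  have machine: "rule_machine trs J m (Suc R)" if "m \<ge> 2" for m
  proof unfold_locales
    fix k l assume kl: "k < length trs" "l < length trs" "k \<noteq> l" "fst (trs ! k) = fst (trs ! l)"
    then have "trs ! k \<noteq> trs ! l" using trs(2) nth_eq_iff_index_eq by blast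
    then have "(fst (snd (trs ! k)), snd (snd (trs ! k))) \<noteq> (fst (snd (trs ! l)), snd (snd (trs ! l)))"
      using kl(4) by (simp add: prod_eq_iff)
    then show "exclusive (fst (snd (trs ! k))) (fst (snd (trs ! l)))"
      using nth[OF kl(1)] nth[OF kl(2)] kl(4) nxt_exclusive by metis
  next
    fix k assume "k < length trs"
    then show "op_reg (fst (snd (trs ! k))) < Suc R" using nth Q(3) less_SucI by metis
  qed (use that in \<open>auto simp: J_def\<close>)
  have stack: "stack_machine trs J m" if "m \<ge> 2" for m
    using machine[OF that] by (simp add: rule_machine_def)
  \<comment> \<open>\<open>labels\<close> and \<open>rule_of\<close> do not depend on
    \<open>m\<close>, so the rules obtained for the admissible value \<open>2\<close> are those for
    every \<open>m\<close>.\<close>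
  interpret rule_machine trs c J 2 "Suc R" by (rule machine) simp
  obtain N A where N: "N > 1" "\<And>e. 0 < e \<and> e \<le> 1 \<Longrightarrow> (if rules_immortal d (map rule_of labels) e
    then sat_unstable N A (\<lambda>i. if i = 0 then e else 1) else sat_stable N A (\<lambda>i. if i = 0 then e else 1))"
    using saturated_system_exists by blast
  have iff: "rules_immortal d (map rule_of labels) (1 / 2 ^ m) \<longleftrightarrow> \<not> halts c (load m)" if "m \<ge> 2" for m
    using rule_machine.rules_immortal_iff[OF machine[OF that], of c] immortal_iff_not_halts[OF Q(2) _ trs(1) stack[OF that]] Q(3)
    by (simp add: stack_machine.\<eta>_def[OF stack[OF that]])
  have "if halts c (load m) then sat_stable N A (\<lambda>i. if i = 0 then 1 / 2 ^ m else 1)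
    else sat_unstable N A (\<lambda>i. if i = 0 then 1 / 2 ^ m else 1)" if "m \<ge> 2" for m
    using N(2)[of "1 / 2 ^ m"] iff[OF that] by (simp split: if_splits)
  then show ?thesis using N(1) by blast
qed

section \<open>Compilation of recursive functions\<close>

lemma terminates_SKIP: "terminates SKIP s s"
  by (auto simp: terminates_def intro: exI[of _ SKIP])

lemma terminates_INC: "terminates (INC i) s (s(i := Suc (s i)))"
proof -
  have "cstep (INC i, s) (SKIP, effect (Inc i) s)" by (rule cstep.intros) simp_all
  then show ?thesis unfolding terminates_def by (intro exI[of _ SKIP]) auto
qed

lemma terminates_DEC: "terminates (DEC i) s (s(i := s i - 1))"
proof (cases "s i = 0")
  case True
  have "cstep (DEC i, s) (SKIP, effect (Zer i) s)" by (rule cstep.intros) (use True in simp_all)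
  moreover have "s(i := s i - 1) = s" using True by auto
  ultimately show ?thesis unfolding terminates_def by (intro exI[of _ SKIP]) auto
next
  case False
  have "cstep (DEC i, s) (SKIP, effect (Dec i) s)" by (rule cstep.intros) (use False in simp_all)
  then show ?thesis unfolding terminates_def by (intro exI[of _ SKIP]) auto
qed

lemma steps_SEQ: "cstep\<^sup>*\<^sup>* (c, s) (c', s') \<Longrightarrow> cstep\<^sup>*\<^sup>* (SEQ c d, s) (SEQ c' d, s')"
proof (induction "(c', s')" arbitrary: c' s' rule: rtranclp_induct)
  case (step y)
  obtain c1 s1 where y: "y = (c1, s1)" by fastforce
  have "cstep (SEQ c1 d, s1) (SEQ c' d, s')"
    using step(2) unfolding y
  proof cases
    case (1 f)
    then have "(f, SEQ c' d) \<in> set (nxt (SEQ c1 d))" by force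
    with 1 show ?thesis by (auto intro: cstep.intros)
  qed
  with step(3)[OF y] show ?case by (rule rtranclp.rtrancl_into_rtrancl)
qed simp

lemma terminates_SEQ: "terminates c s s1 \<Longrightarrow> terminates d s1 s2 \<Longrightarrow> terminates (SEQ c d) s s2"
proof -
  assume "terminates c s s1" "terminates d s1 s2"
  then obtain c' d' where c': "cstep\<^sup>*\<^sup>* (c, s) (c', s1)" "nxt c' = []" and d': "cstep\<^sup>*\<^sup>* (d, s1) (d', s2)" "nxt d' = []"
    unfolding terminates_def by blast
  have 1: "cstep\<^sup>*\<^sup>* (SEQ c d, s) (SEQ c' d, s1)" using c'(1) by (rule steps_SEQ)
  from d'(1) show ?thesis
  proof (cases rule: converse_rtranclpE)
    case base
    then show ?thesis using 1 c' d' unfolding terminates_def by (intro exI[of _ "SEQ c' d"]) simp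
  next
    case (step y)
    have "cstep (SEQ c' d, s1) y" using step(1)
    proof cases
      case (1 f c'')
      then show ?thesis using c'(2) by (auto intro!: cstep.intros)
    qed
    then have "cstep\<^sup>*\<^sup>* (SEQ c' d, s1) (d', s2)" using step(2) by (rule converse_rtranclp_into_rtranclp)
    with 1 show ?thesis using d'(2) unfolding terminates_def by (meson rtranclp_trans)
  qed
qed

lemma terminates_step: "cstep (c, s) (d, s1) \<Longrightarrow> terminates d s1 s2 \<Longrightarrow> terminates c s s2"
  unfolding terminates_def by (meson converse_rtranclp_into_rtranclp)

lemma terminates_WHILE_zero: "s i = 0 \<Longrightarrow> terminates (WHILE i c) s s"
proof -
  assume "s i = 0"
  then have "cstep (WHILE i c, s) (SKIP, effect (Zer i) s)" by (intro cstep.intros) simp_all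
  then show ?thesis using terminates_step terminates_SKIP by simp
qed

lemma terminates_WHILE_pos: "s i > 0 \<Longrightarrow> terminates c s s1 \<Longrightarrow> terminates (WHILE i c) s1 s2 \<Longrightarrow> terminates (WHILE i c) s s2"
proof -
  assume *: "s i > 0" "terminates c s s1" "terminates (WHILE i c) s1 s2"
  then have "cstep (WHILE i c, s) (SEQ c (WHILE i c), effect (Pos i) s)" by (intro cstep.intros) simp_all
  then show ?thesis using terminates_step terminates_SEQ *(2,3) by simp
qed

definition CLEAR :: "nat \<Rightarrow> com" where "CLEAR r = WHILE r (DEC r)"

lemma terminates_CLEAR: "terminates (CLEAR r) s (s(r := 0))"
  unfolding CLEAR_def
proof (induction "s r" arbitrary: s)
  case 0
  then have "s(r := 0) = s" by auto
  then show ?case using terminates_WHILE_zero[of s r] 0 by simp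
next
  case (Suc n)
  have "terminates (WHILE r (DEC r)) (s(r := s r - 1)) ((s(r := s r - 1))(r := 0))"
    using Suc(2) by (intro Suc(1)) simp
  then show ?case using Suc(2) terminates_WHILE_pos[OF _ terminates_DEC] by simp
qed

definition MOVE :: "nat \<Rightarrow> nat \<Rightarrow> nat \<Rightarrow> com" where
  "MOVE r d t = WHILE r (SEQ (DEC r) (SEQ (INC d) (INC t)))"

lemma terminates_MOVE:
  assumes "r \<noteq> d" "r \<noteq> t" "d \<noteq> t"
  shows "terminates (MOVE r d t) s (s(r := 0, d := s d + s r, t := s t + s r))"
  unfolding MOVE_def
proof (induction "s r" arbitrary: s)
  case 0
  then have "s r = 0" by simp
  then have "s(r := 0, d := s d + s r, t := s t + s r) = s" by (simp add: fun_eq_iff)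
  with terminates_WHILE_zero[of s r, OF \<open>s r = 0\<close>] show ?case by metis
next
  case (Suc n)
  let ?s1 = "s(r := s r - 1)"
  let ?s2 = "?s1(d := Suc (?s1 d))"
  let ?s3 = "?s2(t := Suc (?s2 t))"
  have body: "terminates (SEQ (DEC r) (SEQ (INC d) (INC t))) s ?s3"
    by (rule terminates_SEQ[OF terminates_DEC terminates_SEQ[OF terminates_INC terminates_INC]])
  have "n = ?s3 r" using Suc(2) assms by simp
  from terminates_WHILE_pos[OF _ body Suc(1)[of ?s3, OF this]]
  have "terminates (WHILE r (SEQ (DEC r) (SEQ (INC d) (INC t)))) s (?s3(r := 0, d := ?s3 d + ?s3 r, t := ?s3 t + ?s3 r))"
    using Suc(2) by simp
  moreover have "?s3(r := 0, d := ?s3 d + ?s3 r, t := ?s3 t + ?s3 r) = s(r := 0, d := s d + s r, t := s t + s r)"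
    using Suc(2) assms by (auto simp: fun_eq_iff)
  ultimately show ?case by simp
qed

text \<open>\<open>MOVE\<close> empties its source, so a second copy in \<open>t\<close> is used to
  restore \<open>r\<close>. Since \<open>MOVE\<close> always fills two registers,
  \<open>Suc t\<close> takes the surplus and is cleared.\<close>

definition COPY :: "nat \<Rightarrow> nat \<Rightarrow> nat \<Rightarrow> com" where
  "COPY r d t = SEQ (CLEAR d) (SEQ (CLEAR t) (SEQ (MOVE r d t) (SEQ (MOVE t r (Suc t)) (CLEAR (Suc t)))))"

lemma terminates_COPY:
  assumes "r \<noteq> d" "r < t" "d < t"
  shows "terminates (COPY r d t) s (s(d := s r, t := 0, Suc t := 0))"
proof -
  let ?s1 = "s(d := 0)"
  let ?s2 = "?s1(t := 0)"
  let ?s3 = "?s2(r := 0, d := ?s2 d + ?s2 r, t := ?s2 t + ?s2 r)"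
  let ?s4 = "?s3(t := 0, r := ?s3 r + ?s3 t, Suc t := ?s3 (Suc t) + ?s3 t)"
  have m: "terminates (MOVE r d t) ?s2 ?s3" "terminates (MOVE t r (Suc t)) ?s3 ?s4"
    using assms by (intro terminates_MOVE; simp)+
  have "terminates (COPY r d t) s (?s4(Suc t := 0))"
    unfolding COPY_def
    by (rule terminates_SEQ[OF terminates_CLEAR terminates_SEQ[OF terminates_CLEAR
          terminates_SEQ[OF m(1) terminates_SEQ[OF m(2) terminates_CLEAR]]]])
  moreover have "?s4(Suc t := 0) = s(d := s r, t := 0, Suc t := 0)" using assms by (auto simp: fun_eq_iff)
  ultimately show ?thesis by simp
qed

lemma map_frame: "\<forall>r<b. s' r = s r \<Longrightarrow> (\<And>i. i \<in> set ins \<Longrightarrow> i < b) \<Longrightarrow> map s' ins = map s ins" for s s' :: "nat \<Rightarrow> nat"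
  by (rule map_cong) auto

text \<open>Registers from \<open>b\<close> on are scratch space.\<close>

definition computes :: "recf \<Rightarrow> nat list \<Rightarrow> nat \<Rightarrow> nat \<Rightarrow> com \<Rightarrow> bool" where
  "computes f ins out b c \<longleftrightarrow> (\<forall>s y. rec_eval f (map s ins) y \<longrightarrow>
     (\<exists>s'. terminates c s s' \<and> s' out = y \<and> (\<forall>r<b. r \<noteq> out \<longrightarrow> s' r = s r)))"

text \<open>All register layouts are covered, so that the induction over \<open>f\<close> can place
  the registers of subprograms above \<open>b\<close>.\<close>

definition compilable :: "recf \<Rightarrow> bool" where
  "compilable f \<longleftrightarrow> (\<forall>ins out b. (\<forall>i\<in>set ins. i < b) \<longrightarrow> out < b \<longrightarrow> out \<notin> set ins \<longrightarrow> (\<exists>c. computes f ins out b c))"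

lemma compilableD: "compilable f \<Longrightarrow> (\<And>i. i \<in> set ins \<Longrightarrow> i < b) \<Longrightarrow> out < b \<Longrightarrow> out \<notin> set ins \<Longrightarrow> \<exists>c. computes f ins out b c"
  by (simp add: compilable_def)

lemma compilable_Zero: "compilable Zero"
proof -
  have "computes Zero ins out b (CLEAR out)" for ins out b
    unfolding computes_def
  proof (intro allI impI)
    fix s y assume "rec_eval Zero (map s ins) y"
    then have "y = 0" by cases
    then show "\<exists>s'. terminates (CLEAR out) s s' \<and> s' out = y \<and> (\<forall>r<b. r \<noteq> out \<longrightarrow> s' r = s r)"
      using terminates_CLEAR[of out s] by (intro exI[of _ "s(out := 0)"]) simp
  qed
  then show ?thesis unfolding compilable_def by blast
qed

lemma compilable_Succ: "compilable Succ"
  unfolding compilable_def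
proof (intro allI impI)
  fix ins :: "nat list" and out b :: nat
  assume b: "\<forall>i\<in>set ins. i < b" "out < b" "out \<notin> set ins"
  have "computes Succ ins out b (SEQ (COPY (hd ins) out b) (INC out))"
    unfolding computes_def
  proof (intro allI impI)
    fix s y assume "rec_eval Succ (map s ins) y"
    then obtain i where i: "ins = [i]" "y = Suc (s i)" by cases auto
    let ?s1 = "s(out := s i, b := 0, Suc b := 0)"
    have "terminates (COPY (hd ins) out b) s ?s1"
      using terminates_COPY[of i out b s] b i by simp
    then have "terminates (SEQ (COPY (hd ins) out b) (INC out)) s (?s1(out := Suc (?s1 out)))"
      by (rule terminates_SEQ) (rule terminates_INC)
    then show "\<exists>s'. terminates (SEQ (COPY (hd ins) out b) (INC out)) s s' \<and> s' out = y \<and> (\<forall>r<b. r \<noteq> out \<longrightarrow> s' r = s r)"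
      using b i by (intro exI[of _ "?s1(out := Suc (?s1 out))"]) simp
  qed
  then show "\<exists>c. computes Succ ins out b c" by blast
qed

lemma compilable_Proj: "compilable (Proj k)"
  unfolding compilable_def
proof (intro allI impI)
  fix ins :: "nat list" and out b :: nat
  assume b: "\<forall>i\<in>set ins. i < b" "out < b" "out \<notin> set ins"
  have "computes (Proj k) ins out b (COPY (ins ! k) out b)"
    unfolding computes_def
  proof (intro allI impI)
    fix s y assume "rec_eval (Proj k) (map s ins) y"
    then have k: "k < length ins" "y = s (ins ! k)" by (cases; simp)+
    let ?s1 = "s(out := s (ins ! k), b := 0, Suc b := 0)"
    have in': "ins ! k \<in> set ins" using k by simp
    then have "terminates (COPY (ins ! k) out b) s ?s1"
      using b by (intro terminates_COPY) auto
    then show "\<exists>s'. terminates (COPY (ins ! k) out b) s s' \<and> s' out = y \<and> (\<forall>r<b. r \<noteq> out \<longrightarrow> s' r = s r)"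
      using b k by (intro exI[of _ ?s1]) simp
  qed
  then show "\<exists>c. computes (Proj k) ins out b c" by blast
qed

text \<open>The results stay in \<open>b\<close>, \<open>b + 1\<close> and so on: each further
  function is compiled with a larger bound for its scratch space and leaves the earlier results
  intact. Hence the induction from the end of the list.\<close>

lemma compute_list:
  assumes "\<And>g. g \<in> set gs \<Longrightarrow> compilable g" "\<And>i. i \<in> set ins \<Longrightarrow> i < b"
  shows "\<exists>c. \<forall>s ys. list_all2 (\<lambda>g y. rec_eval g (map s ins) y) gs ys \<longrightarrow>
     (\<exists>s'. terminates c s s' \<and> map s' [b..<b + length gs] = ys \<and> (\<forall>r<b. s' r = s r))"
  using assms(1)
proof (induction gs rule: rev_induct)
  case Nil
  show ?case using terminates_SKIP by (intro exI[of _ SKIP]) auto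
next
  case (snoc g gs)
  let ?n = "length gs"
  obtain c where c: "\<And>s ys. list_all2 (\<lambda>g y. rec_eval g (map s ins) y) gs ys \<Longrightarrow>
     \<exists>s'. terminates c s s' \<and> map s' [b..<b + ?n] = ys \<and> (\<forall>r<b. s' r = s r)"
    using snoc by auto
  have "\<exists>c. computes g ins (b + ?n) (b + ?n + 1) c"
    using snoc(2)[of g] assms(2) by (intro compilableD) fastforce+
  then obtain d where d: "computes g ins (b + ?n) (b + ?n + 1) d" by blast
  show ?case
  proof (intro exI[of _ "SEQ c d"] allI impI)
    fix s ys assume "list_all2 (\<lambda>g y. rec_eval g (map s ins) y) (gs @ [g]) ys"
    then obtain ys' y where ys: "ys = ys' @ [y]" "list_all2 (\<lambda>g y. rec_eval g (map s ins) y) gs ys'" "rec_eval g (map s ins) y"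
      by (auto simp: list_all2_append1 list_all2_Cons1)
    obtain s1 where s1: "terminates c s s1" "map s1 [b..<b + ?n] = ys'" "\<forall>r<b. s1 r = s r" using c[OF ys(2)] by blast
    have "map s1 ins = map s ins" using s1(3) assms(2) by simp
    then obtain s2 where s2: "terminates d s1 s2" "s2 (b + ?n) = y" "\<forall>r<b + ?n + 1. r \<noteq> b + ?n \<longrightarrow> s2 r = s1 r"
      using d ys(3) unfolding computes_def by metis
    have "map s2 [b..<b + ?n] = map s1 [b..<b + ?n]" using s2(3) by simp
    then have "map s2 [b..<b + length (gs @ [g])] = ys" using s2(2) s1(2) ys(1) by simp
    moreover have "\<forall>r<b. s2 r = s r" using s1(3) s2(3) by simp
    ultimately show "\<exists>s'. terminates (SEQ c d) s s' \<and> map s' [b..<b + length (gs @ [g])] = ys \<and> (\<forall>r<b. s' r = s r)"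
      using terminates_SEQ[OF s1(1) s2(1)] by blast
  qed
qed

lemma compilable_Comp:
  assumes "compilable f" "\<And>g. g \<in> set gs \<Longrightarrow> compilable g"
  shows "compilable (Comp f gs)"
  unfolding compilable_def
proof (intro allI impI)
  fix ins :: "nat list" and out b :: nat
  assume b: "\<forall>i\<in>set ins. i < b" "out < b" "out \<notin> set ins"
  let ?n = "length gs"
  obtain c where c: "\<And>s ys. list_all2 (\<lambda>g y. rec_eval g (map s ins) y) gs ys \<Longrightarrow>
     \<exists>s'. terminates c s s' \<and> map s' [b..<b + ?n] = ys \<and> (\<forall>r<b. s' r = s r)"
    using compute_list[of gs ins b] assms(2) b(1) by blast
  obtain d where d: "computes f [b..<b + ?n] out (b + ?n) d"
    using compilableD[OF assms(1), of "[b..<b + ?n]" "b + ?n" out] b by auto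
  have "computes (Comp f gs) ins out b (SEQ c d)"
    unfolding computes_def
  proof (intro allI impI)
    fix s y assume "rec_eval (Comp f gs) (map s ins) y"
    then obtain ys where ys: "list_all2 (\<lambda>g y. rec_eval g (map s ins) y) gs ys" "rec_eval f ys y"
      by cases auto
    obtain s1 where s1: "terminates c s s1" "map s1 [b..<b + ?n] = ys" "\<forall>r<b. s1 r = s r" using c[OF ys(1)] by blast
    obtain s2 where s2: "terminates d s1 s2" "s2 out = y" "\<forall>r<b + ?n. r \<noteq> out \<longrightarrow> s2 r = s1 r"
      using d ys(2) s1(2) unfolding computes_def by metis
    have "\<forall>r<b. r \<noteq> out \<longrightarrow> s2 r = s r" using s1(3) s2(3) by simp
    then show "\<exists>s'. terminates (SEQ c d) s s' \<and> s' out = y \<and> (\<forall>r<b. r \<noteq> out \<longrightarrow> s' r = s r)"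
      using terminates_SEQ[OF s1(1) s2(1)] s2(2) by blast
  qed
  then show "\<exists>c. computes (Comp f gs) ins out b c" by blast
qed

lemma Prim_values:
  "rec_eval (Prim f g) (n # xs) z \<Longrightarrow>
     \<exists>v. v n = z \<and> rec_eval f xs (v 0) \<and> (\<forall>m<n. rec_eval g (m # v m # xs) (v (Suc m)))"
proof (induction n arbitrary: z)
  case 0
  then have "rec_eval f xs z" by cases
  then show ?case by (intro exI[of _ "\<lambda>_. z"]) simp
next
  case (Suc n)
  from Suc.prems obtain y where y: "rec_eval (Prim f g) (n # xs) y" "rec_eval g (n # y # xs) z"
    by (cases rule: rec_eval.cases) auto
  then obtain v where v: "v n = y" "rec_eval f xs (v 0)" "\<forall>m<n. rec_eval g (m # v m # xs) (v (Suc m))"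
    using Suc.IH by blast
  show ?case
    using v y(2) by (intro exI[of _ "v(Suc n := z)"]) (simp add: less_Suc_eq)
qed

lemma Prim_nonempty: "rec_eval (Prim f g) xs z \<Longrightarrow> xs \<noteq> []"
  by (auto elim: rec_eval.cases)

lemma compilable_Prim:
  assumes f: "compilable f" and g: "compilable g"
  shows "compilable (Prim f g)"
  unfolding compilable_def
proof (intro allI impI)
  fix ins :: "nat list" and out b :: nat
  assume b: "\<forall>i\<in>set ins. i < b" "out < b" "out \<notin> set ins"
  let ?is = "tl ins" and ?k = b and ?j = "b + 1" and ?acc = "b + 2" and ?tmp = "b + 3" and ?B = "b + 4"
  have ib: "i < b" if "i \<in> set ?is" for i using that b(1) by (cases ins) auto
  obtain cf where cf: "computes f ?is ?acc ?B cf"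
    using compilableD[OF f, of ?is ?B ?acc] ib by fastforce
  obtain cg where cg: "computes g (?j # ?acc # ?is) ?tmp ?B cg"
    using compilableD[OF g, of "?j # ?acc # ?is" ?B ?tmp] ib by fastforce
  define body where "body = SEQ (DEC ?k) (SEQ cg (SEQ (COPY ?tmp ?acc ?B) (INC ?j)))"
  define c where "c = SEQ (COPY (hd ins) ?k ?B) (SEQ (CLEAR ?j) (SEQ cf (SEQ (WHILE ?k body) (COPY ?acc out ?B))))"
  have loop: "\<exists>s'. terminates (WHILE ?k body) s s' \<and> s' ?acc = v n \<and> (\<forall>r<b. s' r = s r)"
    if "s ?k = n - j" "s ?j = j" "s ?acc = v j" "map s ?is = xs" "j \<le> n"
      "\<forall>m<n. rec_eval g (m # v m # xs) (v (Suc m))" for s n v j xs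
    using that
  proof (induction "n - j" arbitrary: j s)
    case 0
    then show ?case using terminates_WHILE_zero[of s ?k body] by (intro exI[of _ s]) simp
  next
    case (Suc l)
    have j: "j < n" using Suc.hyps(2) by simp
    let ?s1 = "s(?k := s ?k - 1)"
    have "map ?s1 ?is = xs" using ib Suc.prems(4) by (auto intro!: map_cong dest: ib)
    then have "map ?s1 (?j # ?acc # ?is) = j # v j # xs" using Suc.prems by simp
    then obtain s2 where s2: "terminates cg ?s1 s2" "s2 ?tmp = v (Suc j)" "\<forall>r<?B. r \<noteq> ?tmp \<longrightarrow> s2 r = ?s1 r"
      using cg Suc.prems(6) j unfolding computes_def by metis
    let ?s3 = "s2(?acc := s2 ?tmp, ?B := 0, Suc ?B := 0)"
    let ?s4 = "?s3(?j := Suc (?s3 ?j))"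
    have "terminates (COPY ?tmp ?acc ?B) s2 ?s3" by (rule terminates_COPY) simp_all
    then have body: "terminates body s ?s4"
      unfolding body_def
      by (rule terminates_SEQ[OF terminates_DEC terminates_SEQ[OF s2(1) terminates_SEQ[OF _ terminates_INC]]])
    have s4: "?s4 ?k = n - Suc j" "?s4 ?j = Suc j" "?s4 ?acc = v (Suc j)" "\<forall>r<b. ?s4 r = s r"
      using s2 Suc.prems by simp_all
    have "map ?s4 ?is = xs" using trans[OF map_frame[OF s4(4)] Suc.prems(4)] ib by blast
    then obtain s' where s': "terminates (WHILE ?k body) ?s4 s'" "s' ?acc = v n" "\<forall>r<b. s' r = ?s4 r"
    proof -
      have "l = n - Suc j" using Suc.hyps(2) by simp
      from Suc.hyps(1)[OF this s4(1-3) \<open>map ?s4 ?is = xs\<close> _ Suc.prems(6)] show thesis using that j by auto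
    qed
    have "terminates (WHILE ?k body) s s'"
      using terminates_WHILE_pos[OF _ body s'(1)] Suc.prems(1) j by simp
    moreover have "\<forall>r<b. s' r = s r" using s'(3) s4(4) by simp
    ultimately show ?case using s'(2) by blast
  qed
  have "computes (Prim f g) ins out b c"
    unfolding computes_def
  proof (intro allI impI)
    fix s y assume ev: "rec_eval (Prim f g) (map s ins) y"
    then obtain i is' where ins: "ins = i # is'" using Prim_nonempty by (cases ins) auto
    then obtain v where v: "v (s i) = y" "rec_eval f (map s is') (v 0)"
        "\<forall>m<s i. rec_eval g (m # v m # map s is') (v (Suc m))"
      using Prim_values[of f g "s i" "map s is'" y] ev by auto
    have is': "j < b" if "j \<in> set is'" for j using b(1) that ins by simp
    let ?s1 = "s(?k := s i, ?B := 0, Suc ?B := 0)"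
    let ?s2 = "?s1(?j := 0)"
    have 1: "terminates (COPY (hd ins) ?k ?B) s ?s1" using terminates_COPY[of i ?k ?B s] b(1) ins by simp
    have "\<forall>r<b. ?s2 r = s r" by simp
    from map_frame[OF this, of is'] is' have "map ?s2 ?is = map s is'" using ins by auto
    then obtain s3 where s3: "terminates cf ?s2 s3" "s3 ?acc = v 0" "\<forall>r<?B. r \<noteq> ?acc \<longrightarrow> s3 r = ?s2 r"
      using cf v(2) unfolding computes_def by metis
    have s3s: "\<forall>r<b. s3 r = s r" "s3 ?k = s i - 0" "s3 ?j = 0" using s3(3) by simp_all
    have "map s3 ?is = map s is'" using is' ins s3s(1) by (auto intro!: map_cong)
    then obtain s4 where s4: "terminates (WHILE ?k body) s3 s4" "s4 ?acc = v (s i)" "\<forall>r<b. s4 r = s3 r"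
      using loop[of s3 "s i" 0 v "map s is'"] s3s s3(2) v(3) by auto
    let ?s5 = "s4(out := s4 ?acc, ?B := 0, Suc ?B := 0)"
    have "terminates (COPY ?acc out ?B) s4 ?s5" using b by (intro terminates_COPY) auto
    then have "terminates c s ?s5"
      unfolding c_def by (rule terminates_SEQ[OF 1 terminates_SEQ[OF terminates_CLEAR terminates_SEQ[OF s3(1) terminates_SEQ[OF s4(1)]]]])
    moreover have "?s5 out = y" using b s4(2) v(1) by simp
    moreover have "\<forall>r<b. r \<noteq> out \<longrightarrow> ?s5 r = s r" using s4(3) s3s(1) by simp
    ultimately show "\<exists>s'. terminates c s s' \<and> s' out = y \<and> (\<forall>r<b. r \<noteq> out \<longrightarrow> s' r = s r)" by blast
  qed
  then show "\<exists>c. computes (Prim f g) ins out b c" by blast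
qed

lemma compilable_Mu:
  assumes f: "compilable f"
  shows "compilable (Mu f)"
  unfolding compilable_def
proof (intro allI impI)
  fix ins :: "nat list" and out b :: nat
  assume b: "\<forall>i\<in>set ins. i < b" "out < b" "out \<notin> set ins"
  let ?j = b and ?tmp = "b + 1" and ?B = "b + 2"
  obtain cf where cf: "computes f (?j # ins) ?tmp ?B cf"
    using compilableD[OF f, of "?j # ins" ?B ?tmp] b(1) by fastforce
  define body where "body = SEQ (INC ?j) cf"
  define c where "c = SEQ (CLEAR ?j) (SEQ cf (SEQ (WHILE ?tmp body) (COPY ?j out ?B)))"
  have loop: "\<exists>s'. terminates (WHILE ?tmp body) s s' \<and> s' ?j = n \<and> (\<forall>r<b. s' r = s r)"
    if "s ?j = j" "rec_eval f (j # xs) (s ?tmp)" "map s ins = xs" "j \<le> n"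
      and ex: "\<And>m. m < n \<Longrightarrow> \<exists>y. rec_eval f (m # xs) (Suc y)" and zero: "rec_eval f (n # xs) 0" for s n j xs
    using that(1-4)
  proof (induction "n - j" arbitrary: j s)
    case 0
    then have "j = n" by simp
    then have "s ?tmp = 0" using 0 zero rec_eval_deterministic by blast
    then show ?case using terminates_WHILE_zero[of s ?tmp body] 0 \<open>j = n\<close> by (intro exI[of _ s]) simp
  next
    case (Suc l)
    have j: "j < n" using Suc.hyps(2) by simp
    then obtain y where "rec_eval f (j # xs) (Suc y)" using ex by blast
    then have pos: "s ?tmp > 0" using Suc.prems(2) rec_eval_deterministic by fastforce
    let ?s1 = "s(?j := Suc (s ?j))"
    \<comment> \<open>Below \<open>n\<close> the value of \<open>f\<close> is a successor and at
      \<open>n\<close> it is zero; in either case \<open>f\<close> is defined at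
      \<open>Suc j\<close>.\<close>
    obtain y where y: "rec_eval f (Suc j # xs) y"
      using ex[of "Suc j"] zero j by (cases "Suc j = n") auto
    have "map ?s1 ins = xs" using b(1) Suc.prems(3) by (auto intro!: map_cong)
    then have "map ?s1 (?j # ins) = Suc j # xs" using Suc.prems by simp
    then obtain s2 where s2: "terminates cf ?s1 s2" "s2 ?tmp = y" "\<forall>r<?B. r \<noteq> ?tmp \<longrightarrow> s2 r = ?s1 r"
      using cf y unfolding computes_def by metis
    have body: "terminates body s s2" unfolding body_def by (rule terminates_SEQ[OF terminates_INC s2(1)])
    have s2s: "s2 ?j = Suc j" "\<forall>r<b. s2 r = s r" using s2(3) Suc.prems(1) by simp_all
    have "map s2 ins = xs" using s2s(2) b(1) Suc.prems(3) by (auto intro!: map_cong)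
    then obtain s' where s': "terminates (WHILE ?tmp body) s2 s'" "s' ?j = n" "\<forall>r<b. s' r = s2 r"
    proof -
      have "l = n - Suc j" using Suc.hyps(2) by simp
      from Suc.hyps(1)[OF this s2s(1) _ \<open>map s2 ins = xs\<close>] show thesis using that y j s2(2) s2s(2) by auto
    qed
    have "terminates (WHILE ?tmp body) s s'" using terminates_WHILE_pos[OF pos body s'(1)] .
    moreover have "\<forall>r<b. s' r = s r" using s'(3) s2s(2) by simp
    ultimately show ?case using s'(2) by blast
  qed
  have "computes (Mu f) ins out b c"
    unfolding computes_def
  proof (intro allI impI)
    fix s n assume ev: "rec_eval (Mu f) (map s ins) n"
    let ?xs = "map s ins"
    from ev have n: "\<And>m. m < n \<Longrightarrow> \<exists>y. rec_eval f (m # ?xs) (Suc y)" "rec_eval f (n # ?xs) 0" by (cases; simp)+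
    obtain y where y: "rec_eval f (0 # ?xs) y" using n by (cases n) auto
    let ?s1 = "s(?j := 0)"
    have "map ?s1 ins = ?xs" using b(1) by (auto intro!: map_cong)
    then have "map ?s1 (?j # ins) = 0 # ?xs" by simp
    then obtain s2 where s2: "terminates cf ?s1 s2" "s2 ?tmp = y" "\<forall>r<?B. r \<noteq> ?tmp \<longrightarrow> s2 r = ?s1 r"
      using cf y unfolding computes_def by metis
    have s2s: "s2 ?j = 0" "\<forall>r<b. s2 r = s r" using s2(3) by simp_all
    have "map s2 ins = ?xs" using s2s(2) b(1) by (auto intro!: map_cong)
    then obtain s3 where s3: "terminates (WHILE ?tmp body) s2 s3" "s3 ?j = n" "\<forall>r<b. s3 r = s2 r"
      using loop[of s2 0 ?xs n] s2s s2(2) y n by auto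
    let ?s4 = "s3(out := s3 ?j, ?B := 0, Suc ?B := 0)"
    have "terminates (COPY ?j out ?B) s3 ?s4" using b by (intro terminates_COPY) auto
    then have "terminates c s ?s4" unfolding c_def
      by (rule terminates_SEQ[OF terminates_CLEAR terminates_SEQ[OF s2(1) terminates_SEQ[OF s3(1)]]])
    moreover have "?s4 out = n" using b s3(2) by simp
    moreover have "\<forall>r<b. r \<noteq> out \<longrightarrow> ?s4 r = s r" using s3(3) s2s(2) by simp
    ultimately show "\<exists>s'. terminates c s s' \<and> s' out = n \<and> (\<forall>r<b. r \<noteq> out \<longrightarrow> s' r = s r)" by blast
  qed
  then show "\<exists>c. computes (Mu f) ins out b c" by blast
qed

lemma compilable: "compilable f"
  by (induction f) (simp_all add: compilable_Zero compilable_Succ compilable_Proj compilable_Comp compilable_Prim compilable_Mu)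

section \<open>From an output to halting\<close>

lemma diverges:
  assumes "s i > 0"
  shows "\<not> halts (WHILE i SKIP) s"
proof
  assume "halts (WHILE i SKIP) s"
  then obtain c' s' where *: "cstep\<^sup>*\<^sup>* (WHILE i SKIP, s) (c', s')" "nxt c' = []" unfolding halts_def terminates_def by blast
  have "nxt (fst y) \<noteq> [] \<and> snd y = s \<and> (fst y = WHILE i SKIP \<or> fst y = SEQ SKIP (WHILE i SKIP))"
    if "cstep\<^sup>*\<^sup>* (WHILE i SKIP, s) y" for y
    using that
  proof (induction rule: rtranclp_induct)
    case (step y z)
    obtain f where "(f, fst z) \<in> set (nxt (fst y))" "enabled f (snd y)" "snd z = effect f (snd y)"
      using cstepD[OF step(2)] by blast
    then show ?case using step(3) assms by auto
  qed simp
  from this[OF *(1)] *(2) show False by simp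
qed

text \<open>By determinism the only computation of the sequence passes through the end of
  \<open>c\<close>.\<close>

lemma halts_SEQ:
  assumes "terminates c s s1"
  shows "halts (SEQ c d) s \<longleftrightarrow> halts d s1"
proof
  assume "halts d s1"
  then show "halts (SEQ c d) s" using terminates_SEQ[OF assms] unfolding halts_def by blast
next
  assume "halts (SEQ c d) s"
  then obtain e s2 where e: "cstep\<^sup>*\<^sup>* (SEQ c d, s) (e, s2)" "nxt e = []" unfolding halts_def terminates_def by blast
  obtain c' where c': "cstep\<^sup>*\<^sup>* (c, s) (c', s1)" "nxt c' = []" using assms unfolding terminates_def by blast
  have "cstep\<^sup>*\<^sup>* (SEQ c d, s) (SEQ c' d, s1)" using c'(1) by (rule steps_SEQ)
  then have "cstep\<^sup>*\<^sup>* (SEQ c' d, s1) (e, s2)"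
    using e(1)
  proof (induction rule: rtranclp_induct)
    case (step y z)
    from step.IH[OF step.prems] show ?case
    proof (cases rule: converse_rtranclpE)
      case base
      have "nxt (fst y) \<noteq> []" using cstepD[OF step(2)] by fastforce
      then show ?thesis using base e(2) by simp
    next
      case (step w)
      then show ?thesis using \<open>cstep y z\<close> cstep_deterministic by blast
    qed
  qed
  then show "halts d s1"
  proof (cases rule: converse_rtranclpE)
    case base
    then have "e = SEQ c' d" "s2 = s1" by simp_all
    then have "nxt d = []" using e(2) c'(2) by simp
    then show ?thesis unfolding halts_def terminates_def by blast
  next
    case (step w)
    have "cstep (d, s1) w"
      using step(1)
    proof cases
      case (1 f c'')
      then show ?thesis using c'(2) by (auto intro!: cstep.intros)
    qed
    then show ?thesis using step(2) e(2) unfolding halts_def terminates_def by (meson converse_rtranclp_into_rtranclp)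
  qed
qed

text \<open>After computing the output, the program enters a loop that stops only at zero. Nothing
  is claimed where \<open>f\<close> is undefined: a decision procedure may diverge outside its
  class.\<close>

theorem halting_program:
  obtains c where "\<And>m y. rec_eval f [m] y \<Longrightarrow> halts c (load m) \<longleftrightarrow> y = 0"
proof -
  obtain p where p: "computes f [0] 1 2 p" using compilableD[OF compilable, of "[0]" 2 1 f] by auto
  have "halts (SEQ p (WHILE 1 SKIP)) (load m) \<longleftrightarrow> y = 0" if y: "rec_eval f [m] y" for m y
  proof -
    have "map (load m) [0] = [m]" by simp
    then obtain s' where s': "terminates p (load m) s'" "s' 1 = y"
      using p y unfolding computes_def by metis
    have "halts (WHILE 1 SKIP) s' \<longleftrightarrow> y = 0"
      using diverges[of s' 1 ] terminates_WHILE_zero[of s' 1 SKIP] s'(2) unfolding halts_def by auto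
    then show ?thesis using halts_SEQ[OF s'(1)] by simp
  qed
  then show ?thesis using that by blast
qed

section \<open>Diagonalization\<close>

abbreviation "height m i \<equiv> if i = 0 then 1 / 2 ^ m else 1"

text \<open>\<open>p\<close> is the position of the varying vector in the code. It must be common to
  the whole family, since the diagonal program is built from \<open>template p\<close> before the
  matrix \<open>A\<close> is known.\<close>

lemma undecidable_family:
  fixes J :: "nat \<Rightarrow> (nat \<Rightarrow> nat \<Rightarrow> rat) \<Rightarrow> nat \<Rightarrow> mpc"
  assumes mem: "\<And>N A m. N > 1 \<Longrightarrow> J N A m \<in> K"
    and code: "\<And>N A. N > 1 \<Longrightarrow> \<exists>d pre ts post. d \<ge> 2 \<and> length (d # pre) = p \<and>
      (\<forall>m. mpc_code (J N A m) = list_encode ((d # pre) @ list_encode (rat_code (1 / 2 ^ m) # ts) # post))"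
    and stable: "\<And>N A m. N > 1 \<Longrightarrow> sat_stable N A (height m) \<Longrightarrow> asymptotically_stable (J N A m)"
    and unstable: "\<And>N A m. N > 1 \<Longrightarrow> sat_unstable N A (height m) \<Longrightarrow> \<not> asymptotically_stable (J N A m)"
  shows "undecidable_on mpc_code K asymptotically_stable"
proof
  assume "decidable_on mpc_code K asymptotically_stable"
  then obtain f where f: "\<And>I. I \<in> K \<Longrightarrow> rec_eval f [mpc_code I] (if asymptotically_stable I then 1 else 0)"
    unfolding decidable_on_def by blast
  obtain T where T: "\<And>m. rec_eval T [m] (template p m m)"
    using recursive1_template unfolding recursive1_def by blast
  obtain c where c: "\<And>m y. rec_eval (Comp f [T]) [m] y \<Longrightarrow> halts c (load m) \<longleftrightarrow> y = 0"
    using halting_program by blast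
  obtain N A where N: "N > 1" and A: "\<And>m. m \<ge> 2 \<Longrightarrow> if halts c (load m) then sat_stable N A (height m) else sat_unstable N A (height m)"
    using saturated_system_of_program[of c] by blast
  obtain d pre ts post where d: "d \<ge> 2" and p: "length (d # pre) = p"
    and J: "\<And>m. mpc_code (J N A m) = list_encode ((d # pre) @ list_encode (rat_code (1 / 2 ^ m) # ts) # post)"
    using code[OF N] by metis
  \<comment> \<open>\<open>N\<close> and \<open>A\<close> depend on the program but not on its
    input. So the number that packs the other entries of the instance can itself be the
    input.\<close>
  define m where "m = pack (d # pre) ts post"
  have m: "m \<ge> 2" using d pack_ge[of d pre ts post] unfolding m_def by linarith
  have self: "mpc_code (J N A m) = template p m m"
    using template_pack[of "d # pre" ts post m] unfolding p J m_def[symmetric] by (rule sym)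
  let ?y = "if asymptotically_stable (J N A m) then 1 else 0 :: nat"
  have "rec_eval f [template p m m] ?y" using f[OF mem[OF N]] unfolding self[symmetric] .
  then have "rec_eval (Comp f [T]) [m] ?y"
    by (intro rec_eval.intros(4)[where ys = "[template p m m]"]) (simp_all add: T)
  then have "halts c (load m) \<longleftrightarrow> \<not> asymptotically_stable (J N A m)" using c by simp
  moreover have "halts c (load m) \<longleftrightarrow> asymptotically_stable (J N A m)"
    using A[OF m] stable[OF N] unstable[OF N] by (metis (full_types))
  ultimately show False by blast
qed

lemma vec_code_box:
  assumes "k \<ge> 1"
  shows "\<exists>ts. \<forall>m. vec_code (box_b k (height m)) = list_encode (rat_code (1 / 2 ^ m) # ts)"
proof -
  have "vec_code (box_b k (height m)) = list_encode (rat_code (1 / 2 ^ m) # map (\<lambda>j. rat_code (if j < k then 1 else 0)) [1..<k + k])" for m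
  proof -
    have "list_of_vec (box_b k (height m)) = map (\<lambda>j. box_b k (height m) $ j) [0..<k + k]"
      by (simp add: list_of_vec_map)
    also have "[0..<k + k] = 0 # [1..<k + k]" using assms by (simp add: upt_conv_Cons)
    also have "map (\<lambda>j. box_b k (height m) $ j) (0 # [1..<k + k]) = 1 / 2 ^ m # map (\<lambda>j. if j < k then 1 else 0) [1..<k + k]"
      using assms by (simp, intro ballI impI index_zero_vec(1)) auto
    finally show ?thesis unfolding vec_code_def by (simp add: o_def)
  qed
  then show ?thesis by blast
qed

lemma height_real: "(\<lambda>i. real_of_rat (height m i)) = height m"
  by (simp add: fun_eq_iff of_rat_divide of_rat_power)

lemma terminal_box_height: "N > 1 \<Longrightarrow> terminal_box N (height m)"
  by unfold_locales auto

lemma undecidable_terminal: "undecidable_on mpc_code (terminal_box_class \<inter> regular_instances) asymptotically_stable"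
\<comment> \<open>13 components precede \<open>term_h\<close> in \<open>mpc_code\<close>.\<close>
proof (rule undecidable_family[where J = "\<lambda>N A m. terminal_mpc N A (height m)" and p = 13])
  fix N m :: nat and A assume N: "N > 1"
  interpret terminal_box N A "height m" by (rule terminal_box_height[OF N])
  show "terminal_mpc N A (height m) \<in> terminal_box_class \<inter> regular_instances" using in_class regular by blast
  show "sat_stable N A (height m) \<Longrightarrow> asymptotically_stable (terminal_mpc N A (height m))"
    using stable unfolding height_real .
  show "sat_unstable N A (height m) \<Longrightarrow> \<not> asymptotically_stable (terminal_mpc N A (height m))"
    using unstable unfolding height_real .
next
  fix N :: nat and A assume N: "N > 1"
  then obtain ts where "\<And>m. vec_code (box_b N (height m)) = list_encode (rat_code (1 / 2 ^ m) # ts)"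
    using vec_code_box[of N] by auto
  then show "\<exists>d pre ts post. d \<ge> 2 \<and> length (d # pre) = 13 \<and> (\<forall>m. mpc_code (terminal_mpc N A (height m)) =
      list_encode ((d # pre) @ list_encode (rat_code (1 / 2 ^ m) # ts) # post))"
    using N
    \<comment> \<open>The plant matrix does not depend on the bounds; \<open>height 0\<close> is an
      arbitrary choice.\<close>
    by (intro exI[of _ N] exI[of _ "[N, 0, 1, mat_code (plant_F (terminal_mpc N A (height 0))), mat_code (1\<^sub>m N), mat_code (1\<^sub>m N), mat_code (1\<^sub>m N),
        mat_code (1\<^sub>m N), mat_code (0\<^sub>m 0 N), mat_code (0\<^sub>m 0 N), vec_code (0\<^sub>v 0), mat_code (box_A N)]"]
        exI[of _ ts] exI[of _ "[mat_code (0\<^sub>m (N + N) 0), mat_code (1 \<cdot>\<^sub>m 1\<^sub>m 0)]"])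
      (simp add: mpc_code_def terminal_mpc_def)
qed

lemma undecidable_input:
  assumes box: "\<And>N A m. N > 1 \<Longrightarrow> input_box N (height m) p q (l N) \<rho> law slack"
    and mem: "\<And>N A m. N > 1 \<Longrightarrow> input_mpc N A (height m) p q (l N) \<rho> \<in> K"
  shows "undecidable_on mpc_code (K \<inter> regular_instances) asymptotically_stable"
\<comment> \<open>11 components precede \<open>stage_h\<close> in \<open>mpc_code\<close>.\<close>
proof (rule undecidable_family[where J = "\<lambda>N A m. input_mpc N A (height m) p q (l N) \<rho>" and p = 11])
  fix N m :: nat and A assume N: "N > 1"
  interpret input_box N A "height m" p q "l N" \<rho> law slack by (rule box[OF N])
  show "input_mpc N A (height m) p q (l N) \<rho> \<in> K \<inter> regular_instances" using mem[OF N] regular by blast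
  show "sat_stable N A (height m) \<Longrightarrow> asymptotically_stable (input_mpc N A (height m) p q (l N) \<rho>)"
    using stable unfolding height_real .
  show "sat_unstable N A (height m) \<Longrightarrow> \<not> asymptotically_stable (input_mpc N A (height m) p q (l N) \<rho>)"
    using unstable unfolding height_real .
next
  fix N :: nat and A assume N: "N > 1"
  then obtain ts where "\<And>m. vec_code (box_b N (height m)) = list_encode (rat_code (1 / 2 ^ m) # ts)"
    using vec_code_box[of N] by auto
  then show "\<exists>d pre ts post. d \<ge> 2 \<and> length (d # pre) = 11 \<and> (\<forall>m. mpc_code (input_mpc N A (height m) p q (l N) \<rho>) =
      list_encode ((d # pre) @ list_encode (rat_code (1 / 2 ^ m) # ts) # post))"
    using N
    by (intro exI[of _ "N + N"] exI[of _ "[N, l N, 1, mat_code (plant_F (input_mpc N A (height 0) p q (l N) \<rho>)),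
        mat_code (plant_G (input_mpc N A (height 0) p q (l N) \<rho>)), mat_code (1\<^sub>m (N + N)), mat_code (1\<^sub>m N), mat_code (1\<^sub>m (N + N)),
        mat_code (0\<^sub>m (N + N) (N + N)), mat_code (box_A N)]"]
        exI[of _ ts] exI[of _ "[mat_code (0\<^sub>m 0 (N + N)), vec_code (0\<^sub>v 0), mat_code (slack_rows N (l N)), mat_code (\<rho> \<cdot>\<^sub>m 1\<^sub>m (l N))]"])
      (simp add: mpc_code_def input_mpc_def)
qed

lemma undecidable_hard: "undecidable_on mpc_code (input_box_class \<inter> regular_instances) asymptotically_stable"
proof (rule undecidable_input[where l = "\<lambda>_. 0"])
  fix N m :: nat and A assume N: "N > 1"
  show *: "input_box N (height m) 1 1 0 1 clip (\<lambda>_ _. 0)" using N by (intro hard_input_box) auto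
  show "input_mpc N A (height m) 1 1 0 1 \<in> input_box_class" by (rule input_box.in_input_box_class[OF *]) simp
qed

lemma undecidable_soft:
  assumes \<rho>: "\<rho> > 0"
  shows "undecidable_on mpc_code (soft_input_box_class \<rho> \<inter> regular_instances) asymptotically_stable"
proof (rule undecidable_input[where l = "\<lambda>N. N"])
  fix N m :: nat and A assume N: "N > 1"
  show *: "input_box N (height m) ((2 + \<rho>) / \<rho>) ((1 + \<rho>) / \<rho>) N \<rho> (soft_clip (of_rat \<rho>)) (soft_slack (of_rat \<rho>))"
    using N \<rho> by (intro soft_input_box) auto
  show "input_mpc N A (height m) ((2 + \<rho>) / \<rho>) ((1 + \<rho>) / \<rho>) N \<rho> \<in> soft_input_box_class \<rho>"
    by (rule input_box.in_soft_input_box_class[OF *]) simp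
qed

lemma undecidable_on_mono: "undecidable_on code K P \<Longrightarrow> K \<subseteq> K' \<Longrightarrow> undecidable_on code K' P"
  unfolding decidable_on_def by blast

theorem theorem3:
  shows "undecidable_on mpc_code {I. mpc_instance I} asymptotically_stable \<and>
    undecidable_on mpc_code terminal_box_class asymptotically_stable \<and>
    undecidable_on mpc_code input_box_class asymptotically_stable \<and>
    (\<forall>\<rho>>0. undecidable_on mpc_code (soft_input_box_class \<rho>) asymptotically_stable) \<and>
    undecidable_on mpc_code (terminal_box_class \<inter> regular_instances) asymptotically_stable \<and>
    undecidable_on mpc_code (input_box_class \<inter> regular_instances) asymptotically_stable \<and>
    (\<forall>\<rho>>0. undecidable_on mpc_code (soft_input_box_class \<rho> \<inter> regular_instances)
       asymptotically_stable)"
proof (intro conjI allI impI)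
  show "undecidable_on mpc_code {I. mpc_instance I} asymptotically_stable"
    by (rule undecidable_on_mono[OF undecidable_terminal]) (auto simp: terminal_box_class_def)
qed (rule undecidable_terminal undecidable_hard undecidable_soft
      undecidable_on_mono[OF undecidable_terminal Int_lower1] undecidable_on_mono[OF undecidable_hard Int_lower1]
      undecidable_on_mono[OF undecidable_soft Int_lower1] | assumption)+

end
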